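(* For each $n\ge 1$ let $m=m_n\ge n$ be an integer and let $A=(a_{jk})_{1\le j\le m,\,1\le k\le n}$ be a random real $m\times n$ matrix with i.i.d. standard Cauchy entries (density $\frac{1}{\pi(1+x^2)}$ on $\mathbb R$). Let $\lambda_1\ge\lambda_2\ge\dots\ge\lambda_n\ge 0$ be the eigenvalues of $A^tA$ and put $\tilde\lambda_i=\frac{\lambda_i}{m^2n^2}$, $i=1,\dots,n$. Let $D=\{z\in\mathbb C:\ \Re z>0\}$, and let $\sqrt z$ denote the branch of the square root on $D$ with $\sqrt 1=1$. (i) For every $z\in D$, $$\lim_{n\to\infty}E\left(\det\Big(1+\frac{z}{m^2n^2}A^tA\Big)\right)^{-1/2}=\lim_{n\to\infty}E\prod_{i=1}^n(1+z\tilde\lambda_i)^{-1/2}=\exp\Big(-\frac2\pi\sqrt z\Big)=\mathbf E\prod_{i=1}^\infty(1+zx_i)^{-1/2},$$ where $\mathbf E$ is the expectation with respect to the inhomogeneous Poisson point process $\{x_i\}$ on $(0,+\infty)$ with intensity $\frac{1}{\pi x^{3/2}}$. The convergence is uniform on compact subsets of $D$. (ii) For real $t$ and $z=t^2$ one has the following rate of convergence: for every $\epsilon>0$, $$E\left(\det\Big(1+\frac{t^2}{m^2n^2}A^tA\Big)\right)^{-1/2}=E\prod_{i=1}^n(1+t^2\tilde\lambda_i)^{-1/2}=\exp\Big(-\frac2\pi|t|\,\big(1+o(n^{-1/2+\epsilon})\big)\Big)\qquad (n\to\infty),$$ uniformly for $|t|$ in compact subsets of $[0,+\infty)$.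
   Context: $E$ denotes expectation with respect to the random matrix $A$, and $1$ inside a determinant is the identity matrix. The power $-1/2$ of the determinant is understood as the product $\prod_{i=1}^n(1+z\tilde\lambda_i)^{-1/2}$ with the principal branch in each factor. A Poisson point process on $(0,+\infty)$ with intensity $\rho(x)$ is a random point configuration such that the numbers of points in disjoint intervals $I_1,\dots,I_k$ are independent Poisson random variables with parameters $\int_{I_j}\rho(x)\,dx$; equivalently, its $k$-point correlation functions are $\prod_{j=1}^k\rho(x_j)$. The $x_i$ denote the points of the configuration. In (ii), "$o(n^{-1/2+\epsilon})$ uniformly" means that the error term $\delta_n(t)$ in place of $o(n^{-1/2+\epsilon})$ satisfies $\sup_{|t|\in K}|\delta_n(t)|=o(n^{-1/2+\epsilon})$ for every compact $K\subset[0,+\infty)$. *)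

theory Defs
  imports "HOL-Probability.Probability" "Jordan_Normal_Form.Schur_Decomposition"
begin

definition cauchy_density :: "real \<Rightarrow> real" where
  "cauchy_density x = 1 / (pi * (1 + x\<^sup>2))"

definition cauchy_random_matrix :: "'w measure \<Rightarrow> nat \<Rightarrow> nat \<Rightarrow> ('w \<Rightarrow> real mat) \<Rightarrow> bool" where
  "cauchy_random_matrix M m n A \<longleftrightarrow>
     prob_space M \<and>
     (\<forall>\<omega>\<in>space M. A \<omega> \<in> carrier_mat m n) \<and>
     (\<forall>j<m. \<forall>k<n. distributed M lborel (\<lambda>\<omega>. A \<omega> $$ (j, k)) (\<lambda>x. ennreal (cauchy_density x))) \<and>
     prob_space.indep_vars M (\<lambda>_. borel) (\<lambda>(j, k) \<omega>. A \<omega> $$ (j, k)) ({..<m} \<times> {..<n})"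

(* The i-th largest (i = 1, 2, ...) real eigenvalue of B, repeated according to algebraic
   multiplicity. For B = A^T A the characteristic polynomial splits over the reals, so that
   i = 1, ..., n enumerates the whole spectrum. *)
definition ordered_eigenvalue :: "real mat \<Rightarrow> nat \<Rightarrow> real" where
  "ordered_eigenvalue B i = rev (sorted_list_of_multiset (proots (char_poly B))) ! (i - 1)"

definition scaled_eigenvalue :: "nat \<Rightarrow> nat \<Rightarrow> real mat \<Rightarrow> nat \<Rightarrow> real" where
  "scaled_eigenvalue m n A i = ordered_eigenvalue (A\<^sup>T * A) i / (real m ^ 2 * real n ^ 2)"

(* The power det(C)^s, understood factor by factor: the product of the principal powers of the
   eigenvalues of C, taken with multiplicity. In general this differs from
   (det C) powr s, whose branch depends on the argument of the full product. *)
definition det_powr :: "complex mat \<Rightarrow> complex \<Rightarrow> complex" where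
  "det_powr C s = (\<Prod>\<mu>\<in>#proots (char_poly C). \<mu> powr s)"

lemma det_powr_one:
  assumes C: "C \<in> carrier_mat n n"
  shows "det_powr C 1 = Determinant.det C"
proof -
  have deg: "degree (char_poly C) = n" and mon: "lead_coeff (char_poly C) = 1"
    using degree_monic_char_poly[OF C] by auto
  have "char_poly C = (\<Prod>\<mu>\<in>#proots (char_poly C). [:-\<mu>, 1:])"
    using complex_poly_decompose_multiset[of "char_poly C"] mon by simp
  then have "poly (char_poly C) 0 = (\<Prod>\<mu>\<in>#proots (char_poly C). - \<mu>)"
    by (metis (no_types, lifting) poly_prod_mset image_mset_cong poly_pCons mult_zero_left add.right_neutral
        multiset.map_comp comp_def)
  also have "\<dots> = (-1) ^ n * (\<Prod>\<mu>\<in>#proots (char_poly C). \<mu>)"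
  proof -
    have "(\<Prod>\<mu>\<in>#S. - \<mu>) = (-1) ^ size S * (\<Prod>\<mu>\<in>#S. \<mu>)" for S :: "complex multiset"
      by (induction S) auto
    then show ?thesis using deg size_proots_complex[of "char_poly C"] by simp
  qed
  finally have "poly (char_poly C) 0 = (-1) ^ n * det_powr C 1"
    by (simp add: det_powr_def)
  moreover have "poly (char_poly C) 0 = Determinant.det (- C)"
  proof -
    have "char_matrix C 0 = C" using C by (auto simp: char_matrix_def)
    then show ?thesis using char_poly_matrix[OF C, of 0] by simp
  qed
  moreover have "Determinant.det (- C) = (-1) ^ n * Determinant.det C"
  proof -
    have "- C = (-1) \<cdot>\<^sub>m C" by auto
    then show ?thesis using C by (simp add: det_smult)
  qed
  ultimately show ?thesis by simp
qed

(* For \<Lambda> = \<infinity> the usual convention: N is almost surely infinite. *)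
definition has_poisson_law :: "'p measure \<Rightarrow> ('p \<Rightarrow> ennreal) \<Rightarrow> ennreal \<Rightarrow> bool" where
  "has_poisson_law P N \<Lambda> \<longleftrightarrow>
     (if \<Lambda> = \<infinity> then AE \<omega> in P. N \<omega> = \<infinity>
      else \<forall>k::nat. measure P {\<omega> \<in> space P. N \<omega> = of_nat k}
                     = enn2real \<Lambda> ^ k / fact k * exp (- enn2real \<Lambda>))"

(* A random configuration is a random subset of (0, \<infinity>), finite on compact subintervals; as the
   intensity is a density, points are almost surely simple, so no multiplicities are needed.
   The emeasure of count_space counts the points of the configuration in an interval; intervals
   may reach down to 0 or up to infinity, and may then contain infinitely many points. *)
definition poisson_point_process :: "'p measure \<Rightarrow> ('p \<Rightarrow> real set) \<Rightarrow> (real \<Rightarrow> real) \<Rightarrow> bool" where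
  "poisson_point_process P X \<rho> \<longleftrightarrow>
     prob_space P \<and>
     (\<forall>\<omega>\<in>space P. X \<omega> \<subseteq> {0<..} \<and> (\<forall>a b. 0 < a \<longrightarrow> finite (X \<omega> \<inter> {a..b}))) \<and>
     (\<forall>(k::nat) I. disjoint_family_on I {..<k} \<and> (\<forall>j<k. is_interval (I j) \<and> I j \<subseteq> {0<..}) \<longrightarrow>
        prob_space.indep_vars P (\<lambda>_. borel)
          (\<lambda>j \<omega>. emeasure (count_space UNIV) (X \<omega> \<inter> I j)) {..<k} \<and>
        (\<forall>j<k. has_poisson_law P (\<lambda>\<omega>. emeasure (count_space UNIV) (X \<omega> \<inter> I j))
                 (\<integral>\<^sup>+x\<in>I j. ennreal (\<rho> x) \<partial>lborel)))"

(* Unordered product over a possibly infinite set, the multiplicative counterpart of infsum: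
   it does not depend on an enumeration of S. *)
definition infprod_over :: "('a \<Rightarrow> complex) \<Rightarrow> 'a set \<Rightarrow> complex" where
  "infprod_over f S = Lim (finite_subsets_at_top S) (\<lambda>F. \<Prod>x\<in>F. f x)"

end

(* det (1 + t^2 A^T A)^(-1/2) is the average of exp (-t^2 |A x|^2 / 2) over a standard Gaussian vector x.
   The characteristic function of a second Gaussian vector y linearises the square, and averaging over
   the Cauchy matrix A then gives exp (-t sum |y_j| sum |x_k|). With t = sqrt z / (m n), the expectation
   in question is E exp (-sqrt z W), where W is the product of the mean of the m numbers |y_j| and the
   mean of the n numbers |x_k|; for complex z this follows by analytic continuation from z > 0. The mean of
   W is 2 / pi and its variance is O(1/n), which gives the limit, its uniformity and the rate (ii) (with
   an error that is even O(1/n)). The Poisson side is computed from the independence of the counts in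
   small intervals; the exponent is the integral of (1 - (1 + z x)^(-1/2)) / (pi x^(3/2)), which has
   the antiderivative (2 / pi) (sqrt (1 + z x) - 1) / sqrt x. *)
theory Submission
  imports Defs "HOL-Complex_Analysis.Complex_Analysis" "HOL-Real_Asymp.Real_Asymp"
begin

section \<open>The Cauchy characteristic function\<close>

text \<open>Cauchy entries have no mean, so no moment of \<open>A\<close> is available. Averages
  over \<open>A\<close> are therefore taken of bounded exponentials, where only the characteristic
  function \<open>exp (-|s|)\<close> enters. Since \<open>|t y_j x_k|\<close> is a product of
  absolute values, the double sum splits into a product of two sums, and the remaining randomness is
  Gaussian with finite moments. The constant 2 / pi is the square of sqrt (2 / pi), the mean of |g|
  for a standard normal g.

  The factorwise power is what makes continuation possible: each factor \<open>1 + z x\<close> stays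
  in the right half-plane, while the determinant itself may turn around the origin. For Re z > 0 the
  integrands have modulus at most 1, which supplies both the domination and the holomorphy of the
  integrals.

  In (ii) the error sits in the exponent and is multiplied by |t|, so an additive error of order |t|
  / sqrt n, enough for (i), is too weak near t = 0. Expanding around the mean cancels the linear
  term and leaves an error of order t^2 / n in the logarithm, from which one factor |t| can be
  divided off.\<close>

lemma integrable_cauchy_density: "integrable lborel cauchy_density"
  and integral_cauchy_density: "(LBINT x. cauchy_density x) = 1"
proof -
  have UN: "einterval (-\<infinity>) \<infinity> = UNIV" by (auto simp: einterval_def)
  have i: "integrable lborel (\<lambda>x::real. inverse (1 + x\<^sup>2))"
    using integrable_inverse_1_plus_square UN by (simp add: set_integrable_def)
  have v: "(LBINT x. inverse (1 + x\<^sup>2)) = pi"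
    using LBINT_inverse_1_plus_square UN
    by (simp add: interval_lebesgue_integral_def set_lebesgue_integral_def)
  have e: "cauchy_density = (\<lambda>x. inverse pi * inverse (1 + x\<^sup>2))"
    by (auto simp: cauchy_density_def fun_eq_iff field_simps)
  show "integrable lborel cauchy_density" unfolding e using i by simp
  show "(LBINT x. cauchy_density x) = 1" unfolding e using v by simp
qed

text \<open>Subtracting \<open>exp (- s)\<close>, the value of the exponential at the pole
  \<open>i\<close>, makes the singularity in the upper half-plane removable, so Cauchy's theorem on
  a half disc replaces a residue computation. On the arc \<open>s \<ge> 0\<close> keeps the
  exponential bounded and the contribution is of order 1 / R. As the density has integral 1, the
  vanishing of the remaining integral is the claim.\<close>

lemma cauchy_char_nonneg:
  fixes s :: real
  assumes s: "s \<ge> 0"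
  shows "(LBINT x. complex_of_real (cauchy_density x) * exp (\<i> * complex_of_real (s * x))) = exp (- s)"
proof -
  define f where "f z = exp (\<i> * of_real s * z)" for z :: complex
  \<comment> \<open>\<open>F\<close> is the difference quotient of \<open>f\<close> at
    \<open>i\<close> with the derivative filled in, hence entire; dividing by \<open>z + i\<close>
    leaves a single pole at \<open>-i\<close>, outside the half-plane used below.\<close>
  define F where "F = (\<lambda>z. if z = \<i> then deriv f \<i> else (f z - f \<i>) / (z - \<i>))"
  define G where "G z = F z / (z + \<i>)" for z
  have i2: "exp (\<i> * complex_of_real s * \<i>) = complex_of_real (exp (- s))"
    by (subst exp_of_real[symmetric]) (rule arg_cong[of _ _ exp], simp add: complex_eq_iff)
  have fi: "f \<i> = exp (- s)" by (simp add: f_def i2)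
  have "f holomorphic_on UNIV" unfolding f_def by (intro holomorphic_intros)
  then have "F holomorphic_on UNIV" unfolding F_def by (intro pole_lemma) auto
  then have holG: "G holomorphic_on {z. Im z > -1}"
    unfolding G_def by (intro holomorphic_intros) (auto intro: holomorphic_on_subset simp: complex_eq_iff)
  have cx: "convex {z. Im z > -1}" by (rule convex_halfspace_Im_gt)
  have G_eq: "G z = (f z - exp (- s)) / (z\<^sup>2 + 1)" if "z \<noteq> \<i>" for z
  proof -
    have "(z - \<i>) * (z + \<i>) = z\<^sup>2 + 1" by (simp add: algebra_simps power2_eq_square)
    then show ?thesis using that fi by (simp add: G_def F_def)
  qed
  have Gx: "G (of_real x) = pi * (complex_of_real (cauchy_density x) * (exp (\<i> * complex_of_real (s * x)) - exp (-s)))" for x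
  proof -
    have "complex_of_real x \<noteq> \<i>" by (simp add: complex_eq_iff)
    moreover have "complex_of_real (1 + x\<^sup>2) \<noteq> 0"
      by (simp only: of_real_eq_0_iff) (smt (verit) zero_le_power2)
    ultimately show ?thesis
      by (simp add: G_eq f_def cauchy_density_def add.commute mult.assoc)
  qed
  \<comment> \<open>The closed path is the segment from -R to R followed by the upper half circle.
    The bound is 2 / (R^2 - 1), which dominates |G| on the arc, times the length R pi of the
    arc.\<close>
  have bound: "norm (integral {-R..R} (\<lambda>x. G (of_real x))) \<le> 2 / (R\<^sup>2 - 1) * R * pi" if R: "R > 1" for R :: real
  proof -
    let ?g = "linepath (of_real (-R)) (of_real R) +++ part_circlepath 0 R 0 pi"
    have im: "path_image ?g \<subseteq> {z. Im z > -1}"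
    proof -
      have "path_image (linepath (of_real (-R)) (of_real R)) \<subseteq> {z. Im z > -1}"
        by (auto simp: path_image_def linepath_def)
      moreover have "path_image (part_circlepath 0 R 0 pi) \<subseteq> {z. Im z > -1}"
      proof
        fix z assume "z \<in> path_image (part_circlepath 0 R 0 pi)"
        then obtain x where x: "0 \<le> x" "x \<le> pi" "z = 0 + R * exp (\<i> * of_real x)"
          using R by (auto simp: path_image_part_circlepath)
        then have "Im z = R * sin x" by (simp add: Im_exp)
        also have "\<dots> \<ge> 0" using x R sin_ge_zero by auto
        finally show "z \<in> {z. Im z > -1}" by simp
      qed
      ultimately show ?thesis by (metis path_image_join_subset le_sup_iff order_trans)
    qed
    have fin: "pathfinish (linepath (of_real (-R)) (of_real R)) = pathstart (part_circlepath 0 R 0 pi)"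
      by simp
    have z: "(G has_contour_integral 0) ?g"
      using im by (intro Cauchy_theorem_convex_simple[OF holG cx]) (auto simp: exp_eq_polar)
    have i1: "G contour_integrable_on linepath (of_real (-R)) (of_real R)"
      and i2: "G contour_integrable_on part_circlepath 0 R 0 pi"
      using z contour_integrable_join[of "linepath (of_real (-R)) (of_real R)" "part_circlepath 0 R 0 pi" G]
      by (auto simp: contour_integrable_on_def)
    have sum: "contour_integral (linepath (of_real (-R)) (of_real R)) G + contour_integral (part_circlepath 0 R 0 pi) G = 0"
      using contour_integral_join[OF i1 i2] contour_integral_unique[OF z] by simp
    have "norm (contour_integral (part_circlepath 0 R 0 pi) G) \<le> 2 / (R\<^sup>2 - 1) * R * \<bar>pi - 0\<bar>"
    proof (rule contour_integral_bound_part_circlepath[OF i2])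
      have R2: "R\<^sup>2 > 1" using R by (simp add: one_less_power)
      then show "0 \<le> 2 / (R\<^sup>2 - 1)" by simp
      fix z assume "z \<in> path_image (part_circlepath 0 R 0 pi)"
      then obtain x where x: "0 \<le> x" "x \<le> pi" "z = 0 + R * exp (\<i> * of_real x)"
        using R by (auto simp: path_image_part_circlepath)
      have nz: "norm z = R" using x R by (simp add: norm_mult)
      have "Im z = R * sin x" using x by (simp add: Im_exp)
      also have "\<dots> \<ge> 0" using x R sin_ge_zero by auto
      finally have "norm (f z) \<le> 1" using s by (simp add: f_def)
      moreover have "norm (exp (- s)) \<le> 1" using s by simp
      ultimately have n: "norm (f z - exp (- s)) \<le> 2"
        using norm_triangle_ineq4[of "f z" "exp (- s)"] by simp (smt (verit) exp_le_one_iff)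
      have d: "norm (z\<^sup>2 + 1) \<ge> R\<^sup>2 - 1"
        using norm_diff_ineq[of "z\<^sup>2" 1] nz by (simp add: norm_power)
      have "z \<noteq> \<i>" using nz R by auto
      then show "norm (G z) \<le> 2 / (R\<^sup>2 - 1)"
        using n d R2 by (auto simp: G_eq norm_divide intro!: frac_le)
    qed (use R in auto)
    moreover have "contour_integral (linepath (of_real (-R)) (of_real R)) G = integral {-R..R} (\<lambda>x. G (of_real x))"
      using R by (subst contour_integral_linepath_Reals_eq) auto
    ultimately show "norm (integral {-R..R} (\<lambda>x. G (of_real x))) \<le> 2 / (R\<^sup>2 - 1) * R * pi"
      using sum by (metis add_eq_0_iff norm_minus_cancel diff_zero abs_of_pos pi_gt_zero)
  qed
  let ?e = "\<lambda>x. complex_of_real (cauchy_density x) * exp (\<i> * complex_of_real (s * x))"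
  have ic: "integrable lborel (\<lambda>x. complex_of_real (cauchy_density x))"
    using integrable_cauchy_density by (rule integrable_of_real)
  have meas[measurable]: "?e \<in> borel_measurable lborel"
  proof (rule borel_measurable_times)
    show "(\<lambda>x. exp (\<i> * complex_of_real (s * x))) \<in> borel_measurable lborel"
      by (simp only: measurable_lborel2) (intro borel_measurable_continuous_onI continuous_intros)
  qed (rule borel_measurable_integrable[OF ic])
  have ie: "integrable lborel ?e"
    by (rule Bochner_Integration.integrable_bound[OF ic meas]) (simp add: norm_mult)
  have iG: "integrable lborel (\<lambda>x. G (of_real x))"
    unfolding Gx using ic ie by (simp add: right_diff_distrib)
  \<comment> \<open>The truncated integrals tend to the full integral by domination and to 0 by the
    arc bound.\<close>
  have "(\<lambda>n. LBINT x. indicator {- real n..real n} x *\<^sub>R G (of_real x)) \<longlonglongrightarrow> (LBINT x. G (of_real x))"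
  proof (rule integral_dominated_convergence[where w="\<lambda>x. norm (G (of_real x))"])
    show "(\<lambda>x. G (of_real x)) \<in> borel_measurable lborel" using iG by auto
    show "(\<lambda>x. indicator {- real n..real n} x *\<^sub>R G (of_real x)) \<in> borel_measurable lborel" for n
      using iG by auto
    show "AE x in lborel. (\<lambda>n. indicator {- real n..real n} x *\<^sub>R G (of_real x)) \<longlonglongrightarrow> G (of_real x)"
    proof (intro AE_I2 tendsto_eventually)
      fix x :: real
      obtain N where "\<bar>x\<bar> \<le> real N" using real_arch_simple by blast
      then show "\<forall>\<^sub>F n in sequentially. indicator {- real n..real n} x *\<^sub>R G (of_real x) = G (of_real x)"
        by (intro eventually_sequentiallyI[of N]) (auto simp: indicator_def)
    qed
  qed (use iG in \<open>auto simp: indicator_def\<close>)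
  moreover have "(\<lambda>n. LBINT x. indicator {- real n..real n} x *\<^sub>R G (of_real x)) \<longlonglongrightarrow> 0"
  proof (rule Lim_null_comparison)
    show "\<forall>\<^sub>F n in sequentially. norm (LBINT x. indicator {- real n..real n} x *\<^sub>R G (of_real x)) \<le> 2 / ((real n)\<^sup>2 - 1) * real n * pi"
    proof (intro eventually_sequentiallyI[of 2])
      fix n :: nat assume n: "2 \<le> n"
      have "set_integrable lborel {- real n..real n} (\<lambda>x. G (of_real x))"
        unfolding set_integrable_def using iG by (intro integrable_mult_indicator) auto
      then have "(LBINT x:{- real n..real n}. G (of_real x)) = integral {- real n..real n} (\<lambda>x. G (of_real x))"
        by (rule set_borel_integral_eq_integral)
      then show "norm (LBINT x. indicator {- real n..real n} x *\<^sub>R G (of_real x)) \<le> 2 / ((real n)\<^sup>2 - 1) * real n * pi"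
        using bound[of "real n"] n by (simp add: set_lebesgue_integral_def)
    qed
    show "(\<lambda>n. 2 / ((real n)\<^sup>2 - 1) * real n * pi) \<longlonglongrightarrow> 0" by real_asymp
  qed
  ultimately have "(LBINT x. G (of_real x)) = 0" by (rule LIMSEQ_unique)
  moreover have "(LBINT x. G (of_real x)) = pi * ((LBINT x. ?e x) - exp (-s))"
    unfolding Gx using ic ie integral_cauchy_density by (simp add: right_diff_distrib)
  ultimately show ?thesis by simp
qed

lemma cauchy_char:
  "(LBINT x. complex_of_real (cauchy_density x) * exp (\<i> * complex_of_real (s * x))) = complex_of_real (exp (- \<bar>s\<bar>))"
proof (cases "s \<ge> 0")
  case True then show ?thesis using cauchy_char_nonneg[of s] by simp
next
  case False
  have "(LBINT x. complex_of_real (cauchy_density x) * exp (\<i> * complex_of_real (s * x)))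
     = (LBINT x. complex_of_real (cauchy_density (- x)) * exp (\<i> * complex_of_real (s * (- x))))"
    by (subst lborel_integral_real_affine[where c="-1" and t=0]) auto
  then show ?thesis using False cauchy_char_nonneg[of "-s"] by (simp add: cauchy_density_def)
qed

section \<open>Unordered products, generating functions and partitions\<close>

lemma abs_arctan_le: "\<bar>arctan y\<bar> \<le> \<bar>y\<bar>"
proof -
  have "norm (arctan y - arctan 0) \<le> 1 * norm (y - 0)"
  proof (rule field_differentiable_bound[where S=UNIV and f'="\<lambda>x. inverse (1 + x\<^sup>2)"])
    show "(arctan has_field_derivative inverse (1 + x\<^sup>2)) (at x within UNIV)" for x
      using DERIV_arctan[of x] by simp
    show "norm (inverse (1 + x\<^sup>2)) \<le> 1" for x :: real
      by (simp add: inverse_le_1_iff)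
  qed auto
  then show ?thesis by simp
qed

text \<open>The quantity \<open>x * Re z / (1 + x * Re z)\<close> links the two parts of the
  logarithm: the argument is at most |Im z| / Re z times it, and the logarithm of the modulus is at
  least it. Hence summability of the log-moduli alone makes the complex logarithms absolutely
  summable.\<close>

lemma norm_Ln_le_ln_norm:
  assumes z: "Re z > 0" and x: "x > 0"
  shows "norm (Ln (1 + z * of_real x)) \<le> (1 + \<bar>Im z\<bar> / Re z) * ln (norm (1 + z * of_real x))"
    and "norm (1 + z * of_real x) \<ge> 1"
proof -
  let ?w = "1 + z * of_real x"
  have Re: "Re ?w = 1 + x * Re z" "Im ?w = x * Im z" by (auto simp: mult.commute)
  have pos: "x * Re z > 0" using z x by simp
  have nw: "norm ?w \<ge> 1 + x * Re z" using complex_Re_le_cmod[of ?w] unfolding Re .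
  then show "norm ?w \<ge> 1" using pos by linarith
  have w0: "?w \<noteq> 0" using nw pos by auto
  \<comment> \<open>\<open>ln y \<le> y - 1\<close>, taken at the reciprocal, becomes a lower bound
    for \<open>ln (1 + x * Re z)\<close>.\<close>
  have "ln (1 / (1 + x * Re z)) \<le> 1 / (1 + x * Re z) - 1" using pos by (intro ln_le_minus_one) auto
  then have l1: "x * Re z / (1 + x * Re z) \<le> ln (1 + x * Re z)"
    using pos by (simp add: ln_div field_simps)
  also have l2: "\<dots> \<le> ln (norm ?w)" using nw pos by (subst ln_le_cancel_iff) auto
  finally have l: "x * Re z / (1 + x * Re z) \<le> ln (norm ?w)" .
  have "\<bar>Im (Ln ?w)\<bar> = \<bar>arctan (x * Im z / (1 + x * Re z))\<bar>"
    unfolding Im_Ln_eq[OF w0] Re using pos by simp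
  also have "\<dots> \<le> \<bar>x * Im z / (1 + x * Re z)\<bar>" by (rule abs_arctan_le)
  also have "\<dots> = \<bar>Im z\<bar> / Re z * (x * Re z / (1 + x * Re z))"
    using z x pos by (simp add: abs_mult)
  also have "\<dots> \<le> \<bar>Im z\<bar> / Re z * ln (norm ?w)" using z by (intro mult_left_mono l) auto
  finally have im: "\<bar>Im (Ln ?w)\<bar> \<le> \<bar>Im z\<bar> / Re z * ln (norm ?w)" .
  have re: "\<bar>Re (Ln ?w)\<bar> = ln (norm ?w)" using w0 nw pos by (simp add: Re_Ln)
  have "norm (Ln ?w) \<le> \<bar>Re (Ln ?w)\<bar> + \<bar>Im (Ln ?w)\<bar>" by (rule cmod_le)
  then show "norm (Ln ?w) \<le> (1 + \<bar>Im z\<bar> / Re z) * ln (norm ?w)"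
    using im re by (simp add: algebra_simps)
qed

text \<open>The unordered product always converges: either the logarithms are absolutely summable, or the
  moduli of the partial products tend to 0. Hence no exceptional null set has to be discarded.\<close>

lemma prod_resolvent_tendsto_infprod:
  assumes X: "X \<subseteq> {0<..}" and z: "Re z > 0"
  shows "((\<lambda>F. \<Prod>x\<in>F. (1 + z * complex_of_real x) powr (-1/2)) \<longlongrightarrow>
    infprod_over (\<lambda>x. (1 + z * complex_of_real x) powr (-1/2)) X) (finite_subsets_at_top X)"
proof -
  let ?f = "\<lambda>x. (1 + z * complex_of_real x) powr (-1/2)"
  let ?L = "\<lambda>x. Ln (1 + z * complex_of_real x)"
  let ?u = "\<lambda>x. ln (norm (1 + z * complex_of_real x))"
  have nz: "1 + z * complex_of_real x \<noteq> 0" and u0: "?u x \<ge> 0" if "x \<in> X" for x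
    using norm_Ln_le_ln_norm(2)[OF z, of x] that X by (auto simp: subset_iff)
  have prodf: "(\<Prod>x\<in>F. ?f x) = exp (- (1/2) * (\<Sum>x\<in>F. ?L x))" if "finite F" "F \<subseteq> X" for F
  proof -
    have "(\<Prod>x\<in>F. ?f x) = (\<Prod>x\<in>F. exp (- (1/2) * ?L x))"
      using that nz by (intro prod.cong refl) (auto simp: powr_def)
    then show ?thesis using that by (simp add: exp_sum sum_distrib_left)
  qed
  have "\<exists>l. ((\<lambda>F. \<Prod>x\<in>F. ?f x) \<longlongrightarrow> l) (finite_subsets_at_top X)"
  proof (cases "?u summable_on X")
    case True
    have "(\<lambda>x. (1 + \<bar>Im z\<bar> / Re z) * ?u x) summable_on X"
      using True by (rule summable_on_cmult_right)
    then have "(\<lambda>x. norm (?L x)) summable_on X"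
      by (rule Infinite_Sum.abs_summable_on_comparison_test') (use norm_Ln_le_ln_norm(1)[OF z] X in auto)
    then have "?L summable_on X" by (rule abs_summable_summable)
    then have "(sum ?L \<longlongrightarrow> infsum ?L X) (finite_subsets_at_top X)"
      using has_sum_infsum unfolding has_sum_def by blast
    then have "((\<lambda>F. exp (- (1/2) * (\<Sum>x\<in>F. ?L x))) \<longlongrightarrow> exp (- (1/2) * infsum ?L X)) (finite_subsets_at_top X)"
      by (intro tendsto_intros)
    moreover have "\<forall>\<^sub>F F in finite_subsets_at_top X. exp (- (1/2) * (\<Sum>x\<in>F. ?L x)) = (\<Prod>x\<in>F. ?f x)"
      by (rule eventually_finite_subsets_at_top_weakI) (simp only: prodf)
    ultimately have "((\<lambda>F. \<Prod>x\<in>F. ?f x) \<longlongrightarrow> exp (- (1/2) * infsum ?L X)) (finite_subsets_at_top X)"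
      by (rule Lim_transform_eventually)
    then show ?thesis by (rule exI)
  next
    case False
    have norm_prod: "norm (\<Prod>x\<in>F. ?f x) = exp (- (1/2) * (\<Sum>x\<in>F. ?u x))" if "finite F" "F \<subseteq> X" for F
    proof -
      have "(\<Sum>x\<in>F. Re (?L x)) = (\<Sum>x\<in>F. ?u x)"
        using that nz by (intro sum.cong refl) (auto simp: Re_Ln subset_iff)
      then show ?thesis using prodf[OF that] by simp
    qed
    have "((\<lambda>F. \<Prod>x\<in>F. ?f x) \<longlongrightarrow> 0) (finite_subsets_at_top X)"
    proof (rule tendstoI)
      fix e :: real assume e: "e > 0"
      \<comment> \<open>Chosen so that \<open>exp (- C / 2) = e\<close>: once a finite set has
        log-moduli summing beyond \<open>C\<close>, every larger finite set has a partial product of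
        modulus below \<open>e\<close>.\<close>
      define C where "C = - 2 * ln e"
      have "\<not> bdd_above (sum ?u ` {F. F \<subseteq> X \<and> finite F})"
        using False nonneg_bdd_above_summable_on[of X ?u] u0 by blast
      then obtain F0 where F0: "F0 \<subseteq> X" "finite F0" "sum ?u F0 > C"
        unfolding bdd_above_def by (auto simp: not_le)
      show "\<forall>\<^sub>F F in finite_subsets_at_top X. dist (\<Prod>x\<in>F. ?f x) 0 < e"
        unfolding eventually_finite_subsets_at_top
      proof (intro exI[of _ F0] conjI allI impI)
        fix F assume F: "finite F \<and> F0 \<subseteq> F \<and> F \<subseteq> X"
        then have "sum ?u F0 \<le> sum ?u F" using u0 by (intro sum_mono2) auto
        then have "- (1/2) * sum ?u F < ln e" using F0(3) by (simp add: C_def)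
        then have "exp (- (1/2) * sum ?u F) < e" using e by (metis exp_less_cancel_iff exp_ln)
        then show "dist (\<Prod>x\<in>F. ?f x) 0 < e" using norm_prod[of F] F by (simp only: dist_0_norm dist_commute[of _ 0])
      qed (use F0 in auto)
    qed
    then show ?thesis by blast
  qed
  then obtain l where l: "((\<lambda>F. \<Prod>x\<in>F. ?f x) \<longlongrightarrow> l) (finite_subsets_at_top X)" by blast
  then have "infprod_over ?f X = l"
    unfolding infprod_over_def by (intro tendsto_Lim) auto
  then show ?thesis using l by simp
qed

text \<open>Replaces the net of all finite subsets by one sequence of windows, along which
  measurability and dominated convergence are available. The shift by 2 makes every window a proper
  interval with a positive lower end.\<close>

lemma filterlim_inter_finite_subsets_at_top:
  fixes X :: "real set"
  assumes X: "X \<subseteq> {0<..}" and fin: "\<And>a b. 0 < a \<Longrightarrow> finite (X \<inter> {a..b})"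
  shows "filterlim (\<lambda>N. X \<inter> {1 / (real N + 2)<..real N + 2}) (finite_subsets_at_top X) sequentially"
  unfolding filterlim_finite_subsets_at_top
proof (intro allI impI)
  fix F assume F: "finite F \<and> F \<subseteq> X"
  have ev: "\<forall>\<^sub>F N in sequentially. x \<in> {1 / (real N + 2)<..real N + 2}" if "x > 0" for x :: real
  proof -
    have "(\<lambda>N. 1 / (real N + 2)) \<longlonglongrightarrow> 0" by real_asymp
    then have "\<forall>\<^sub>F N in sequentially. 1 / (real N + 2) < x" using that by (rule order_tendstoD)
    moreover have "\<forall>\<^sub>F N in sequentially. x \<le> real N + 2"
      by real_asymp
    ultimately show ?thesis by eventually_elim auto
  qed
  have "\<forall>\<^sub>F N in sequentially. \<forall>x\<in>F. x \<in> {1 / (real N + 2)<..real N + 2}"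
    using F X by (intro eventually_ball_finite ballI ev) auto
  then show "\<forall>\<^sub>F N in sequentially. finite (X \<inter> {1 / (real N + 2)<..real N + 2}) \<and> F \<subseteq> X \<inter> {1 / (real N + 2)<..real N + 2} \<and> X \<inter> {1 / (real N + 2)<..real N + 2} \<subseteq> X"
  proof eventually_elim
    case (elim N)
    have "finite (X \<inter> {1 / (real N + 2)<..real N + 2})"
      by (rule finite_subset[OF _ fin[of "1 / (real N + 2)" "real N + 2"]]) auto
    then show ?case using elim F by auto
  qed
qed

text \<open>The power is expanded over the level sets of \<open>K\<close>; sum and integral may be
  interchanged because the norms integrate to the terms of an exponential series.\<close>

lemma (in prob_space) poisson_generating_function:
  fixes K :: "'a \<Rightarrow> nat" and w :: complex
  assumes K: "K \<in> measurable M (count_space UNIV)"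
    and law: "\<And>k. prob {\<omega> \<in> space M. K \<omega> = k} = l ^ k / fact k * exp (- l)"
    and w: "norm w \<le> 1"
  shows "(\<integral>\<omega>. w ^ K \<omega> \<partial>M) = exp (- (of_real l * (1 - w)))"
proof -
  let ?E = "\<lambda>k. {\<omega> \<in> space M. K \<omega> = k}"
  let ?f = "\<lambda>k \<omega>. indicator (?E k) \<omega> *\<^sub>R w ^ k"
  have E[measurable]: "?E k \<in> sets M" for k
    using measurable_sets[OF K, of "{k}"] by (simp add: vimage_def Int_def conj_commute)
  have int: "integrable M (?f k)" for k by (intro integrable_scaleR_left integrable_real_indicator) (auto simp: emeasure_eq_measure)
  have Ef: "(\<integral>\<omega>. ?f k \<omega> \<partial>M) = (l ^ k / fact k * exp (- l)) *\<^sub>R w ^ k" for k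
  proof -
    have "(\<integral>\<omega>. ?f k \<omega> \<partial>M) = (\<integral>\<omega>. indicator (?E k) \<omega> \<partial>M) *\<^sub>R w ^ k"
      by (intro integral_scaleR_left integrable_real_indicator) (auto simp: emeasure_eq_measure)
    then show ?thesis using E[of k] by (simp add: law)
  qed
  have fin: "?f k \<omega> = 0" if "k \<notin> {K \<omega>}" for k \<omega> using that by (auto simp: indicator_def)
  have "(\<lambda>k. \<integral>\<omega>. ?f k \<omega> \<partial>M) sums (\<integral>\<omega>. (\<Sum>k. ?f k \<omega>) \<partial>M)"
  proof (rule sums_integral[OF int])
    show "AE \<omega> in M. summable (\<lambda>k. norm (?f k \<omega>))"
    proof (intro AE_I2)
      fix \<omega> show "summable (\<lambda>k. norm (?f k \<omega>))"
        by (rule summable_finite[of "{K \<omega>}"]) (use fin in auto)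
    qed
    have n: "(\<integral>\<omega>. norm (?f k \<omega>) \<partial>M) = (l ^ k / fact k * exp (- l)) * norm w ^ k" for k
    proof -
      have "(\<integral>\<omega>. norm (?f k \<omega>) \<partial>M) = (\<integral>\<omega>. indicator (?E k) \<omega> * norm w ^ k \<partial>M)"
        by (intro Bochner_Integration.integral_cong refl) (auto simp: norm_power)
      then show ?thesis by (simp add: law)
    qed
    have "summable (\<lambda>k. (l * norm w) ^ k /\<^sub>R fact k)" by (rule summable_exp_generic)
    then have "summable (\<lambda>k. ((l * norm w) ^ k /\<^sub>R fact k) * exp (- l))" by (rule summable_mult2)
    then show "summable (\<lambda>k. \<integral>\<omega>. norm (?f k \<omega>) \<partial>M)"
      unfolding n by (simp add: power_mult_distrib field_simps)
  qed
  moreover have "(\<Sum>k. ?f k \<omega>) = w ^ K \<omega>" if "\<omega> \<in> space M" for \<omega>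
    using suminf_finite[of "{K \<omega>}" "\<lambda>k. ?f k \<omega>"] fin that by (simp add: indicator_def)
  then have "(\<integral>\<omega>. (\<Sum>k. ?f k \<omega>) \<partial>M) = (\<integral>\<omega>. w ^ K \<omega> \<partial>M)"
    by (rule Bochner_Integration.integral_cong[OF refl])
  ultimately have s1: "(\<lambda>k. (l ^ k / fact k * exp (- l)) *\<^sub>R w ^ k) sums (\<integral>\<omega>. w ^ K \<omega> \<partial>M)"
    unfolding Ef by simp
  have "(\<lambda>k. (of_real l * w) ^ k /\<^sub>R fact k * of_real (exp (- l))) sums (exp (of_real l * w) * of_real (exp (- l)))"
    by (intro sums_mult2 exp_converges)
  also have "(\<lambda>k. (of_real l * w) ^ k /\<^sub>R fact k * of_real (exp (- l))) = (\<lambda>k. (l ^ k / fact k * exp (- l)) *\<^sub>R w ^ k)"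
    by (simp add: fun_eq_iff scaleR_conv_of_real power_mult_distrib field_simps)
  finally have "(\<integral>\<omega>. w ^ K \<omega> \<partial>M) = exp (of_real l * w) * of_real (exp (- l))"
    using s1 sums_unique2 by blast
  also have "\<dots> = exp (- (of_real l * (1 - w)))"
    by (simp add: exp_of_real[symmetric] exp_add[symmetric] algebra_simps)
  finally show ?thesis .
qed

section \<open>Equal subdivision of an interval\<close>

text \<open>The right end point of the cell containing \<open>x\<close> when \<open>{a<..b}\<close> is cut into \<open>K\<close> equal cells.\<close>

definition cell_end :: "real \<Rightarrow> real \<Rightarrow> nat \<Rightarrow> real \<Rightarrow> real" where
  "cell_end a b K x = a + (b - a) / real K * of_int \<lceil>(x - a) / ((b - a) / real K)\<rceil>"

text \<open>Open on the left and closed on the right, so that the cells tile \<open>{a<..b}\<close>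
  and each contains its own right end point, at which functions are frozen later.\<close>

definition cell :: "real \<Rightarrow> real \<Rightarrow> nat \<Rightarrow> nat \<Rightarrow> real set" where
  "cell a b K j = {a + (b - a) / real K * real j<..a + (b - a) / real K * (real j + 1)}"

lemma cell_end_on_cell:
  assumes "a < b" "K > 0" "x \<in> cell a b K j"
  shows "cell_end a b K x = a + (b - a) / real K * (real j + 1)"
proof -
  define h where "h = (b - a) / real K"
  have h: "h > 0" using assms by (simp add: h_def)
  have hK: "h * real K = b - a" using assms by (simp add: h_def)
  have "real j < (x - a) / h" "(x - a) / h \<le> real j + 1"
    using assms(3) h by (auto simp: cell_def pos_less_divide_eq pos_divide_le_eq mult.commute simp flip: h_def)
  then have "\<lceil>(x - a) / h\<rceil> = int j + 1" by (intro ceiling_unique) auto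
  then show ?thesis by (simp add: cell_end_def flip: h_def)
qed

lemma cell_end_bounds:
  assumes "a < b" "K > 0" "x \<in> {a<..b}"
  shows "x \<le> cell_end a b K x" and "cell_end a b K x \<le> x + (b - a) / real K" and "cell_end a b K x \<in> {a<..b}"
proof -
  define h where "h = (b - a) / real K"
  have h: "h > 0" using assms by (simp add: h_def)
  have hK: "h * real K = b - a" using assms by (simp add: h_def)
  have "(x - a) / h \<le> of_int \<lceil>(x - a) / h\<rceil>" by simp
  then have "x - a \<le> of_int \<lceil>(x - a) / h\<rceil> * h" using h by (simp only: pos_divide_le_eq)
  then show 1: "x \<le> cell_end a b K x" by (simp add: cell_end_def mult.commute flip: h_def)
  have "of_int \<lceil>(x - a) / h\<rceil> \<le> (x - a) / h + 1" by linarith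
  then have "h * of_int \<lceil>(x - a) / h\<rceil> \<le> h * ((x - a) / h + 1)" using h by (intro mult_left_mono) auto
  also have "\<dots> = x - a + h" using h by (simp add: distrib_left)
  finally show "cell_end a b K x \<le> x + (b - a) / real K" by (simp add: cell_end_def flip: h_def)
  have "(x - a) / h \<le> (b - a) / h" using assms h by (intro divide_right_mono) auto
  also have "\<dots> = real K" using hK h by (simp add: field_simps)
  finally have "\<lceil>(x - a) / h\<rceil> \<le> int K" by (simp add: ceiling_le_iff)
  then have "h * of_int \<lceil>(x - a) / h\<rceil> \<le> h * real K" using h by (intro mult_left_mono) linarith+
  also note hK
  finally have "cell_end a b K x \<le> b" by (simp add: cell_end_def flip: h_def)
  then show "cell_end a b K x \<in> {a<..b}" using 1 assms by auto
qed

lemma cell_end_tendsto: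
  assumes "a < b" "x \<in> {a<..b}"
  shows "(\<lambda>K. cell_end a b K x) \<longlonglongrightarrow> x"
proof (rule tendsto_sandwich[where f="\<lambda>_. x" and h="\<lambda>K. x + (b - a) / real K"])
  show "\<forall>\<^sub>F K in sequentially. x \<le> cell_end a b K x" "\<forall>\<^sub>F K in sequentially. cell_end a b K x \<le> x + (b - a) / real K"
    using cell_end_bounds[OF assms(1) _ assms(2)] by (auto intro: eventually_sequentiallyI[of 1])
  show "(\<lambda>K. x + (b - a) / real K) \<longlonglongrightarrow> x" by real_asymp
qed simp

text \<open>\<open>cell_end\<close> is constant on a cell and determines the index of the cell, so a
  common point forces equal indices.\<close>

lemma disjoint_cell: "a < b \<Longrightarrow> K > 0 \<Longrightarrow> disjoint_family_on (cell a b K) J"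
  unfolding disjoint_family_on_def
proof (intro ballI impI)
  fix i j :: nat assume ab: "a < b" "K > 0" and ij: "i \<noteq> j"
  have "(b - a) / real K > 0" using ab by simp
  have "x \<notin> cell a b K j" if "x \<in> cell a b K i" for x
    using cell_end_on_cell[OF ab that] cell_end_on_cell[OF ab, of x j] ab ij by auto
  then show "cell a b K i \<inter> cell a b K j = {}" by auto
qed

lemma UN_cell:
  assumes "a < b" "K > 0"
  shows "(\<Union>j<K. cell a b K j) = {a<..b}"
proof -
  define h where "h = (b - a) / real K"
  have h: "h > 0" using assms by (simp add: h_def)
  have hK: "h * real K = b - a" using assms by (simp add: h_def)
  have "x \<in> {a<..b}" if j: "j < K" and x: "x \<in> cell a b K j" for x j
  proof -
    have "h * (real j + 1) \<le> h * real K" using h j by (intro mult_left_mono) auto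
    moreover have "0 \<le> h * real j" using h by simp
    ultimately show ?thesis using x hK by (auto simp: cell_def simp flip: h_def)
  qed
  moreover have "\<exists>j<K. x \<in> cell a b K j" if x: "x \<in> {a<..b}" for x
  proof -
    \<comment> \<open>The ceiling numbers the cells from 1, whereas \<open>cell\<close> numbers them
      from 0; hence the index \<open>c - 1\<close> below.\<close>
    define c where "c = \<lceil>(x - a) / h\<rceil>"
    have "(x - a) / h > 0" using x h by simp
    then have c1: "c \<ge> 1" unfolding c_def by linarith
    have "(x - a) / h \<le> (b - a) / h" using x h by (intro divide_right_mono) auto
    also have "\<dots> = real K" using hK h by (simp add: field_simps)
    finally have cK: "c \<le> int K" unfolding c_def by (simp add: ceiling_le_iff)
    have "of_int c - 1 < (x - a) / h" "(x - a) / h \<le> of_int c" unfolding c_def by linarith+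
    then have "(of_int c - 1) * h < x - a" "x - a \<le> of_int c * h"
      using h by (simp_all only: pos_less_divide_eq pos_divide_le_eq)
    then have "x \<in> cell a b K (nat (c - 1))" using c1 by (simp add: cell_def mult.commute flip: h_def)
    moreover have "nat (c - 1) < K" using c1 cK by linarith
    ultimately show ?thesis by blast
  qed
  ultimately show ?thesis by blast
qed

section \<open>Products over a Poisson process\<close>

lemma poisson_point_processD:
  assumes "poisson_point_process P X \<rho>"
  shows "prob_space P" and "\<And>\<omega>. \<omega> \<in> space P \<Longrightarrow> X \<omega> \<subseteq> {0<..}"
    and "\<And>\<omega> a b. \<omega> \<in> space P \<Longrightarrow> 0 < a \<Longrightarrow> finite (X \<omega> \<inter> {a..b})"
    and "\<And>(k::nat) I. disjoint_family_on I {..<k} \<Longrightarrow> (\<And>j. j < k \<Longrightarrow> is_interval (I j) \<and> I j \<subseteq> {0<..}) \<Longrightarrow>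
        prob_space.indep_vars P (\<lambda>_. borel) (\<lambda>j \<omega>. emeasure (count_space UNIV) (X \<omega> \<inter> I j)) {..<k}"
    and "\<And>(k::nat) I j. disjoint_family_on I {..<k} \<Longrightarrow> (\<And>j. j < k \<Longrightarrow> is_interval (I j) \<and> I j \<subseteq> {0<..}) \<Longrightarrow> j < k \<Longrightarrow>
        has_poisson_law P (\<lambda>\<omega>. emeasure (count_space UNIV) (X \<omega> \<inter> I j)) (\<integral>\<^sup>+x\<in>I j. ennreal (\<rho> x) \<partial>lborel)"
proof -
  note * = assms[unfolded poisson_point_process_def]
  show "prob_space P" and "\<And>\<omega>. \<omega> \<in> space P \<Longrightarrow> X \<omega> \<subseteq> {0<..}"
    and "\<And>\<omega> a b. \<omega> \<in> space P \<Longrightarrow> 0 < a \<Longrightarrow> finite (X \<omega> \<inter> {a..b})"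
    using * by auto
  show "prob_space.indep_vars P (\<lambda>_. borel) (\<lambda>j \<omega>. emeasure (count_space UNIV) (X \<omega> \<inter> I j)) {..<k}"
    if "disjoint_family_on I {..<k}" "\<And>j. j < k \<Longrightarrow> is_interval (I j) \<and> I j \<subseteq> {0<..}" for k :: nat and I
  proof -
    have "disjoint_family_on I {..<k} \<and> (\<forall>j<k. is_interval (I j) \<and> I j \<subseteq> {0<..})" using that by blast
    then show ?thesis using * by blast
  qed
  show "has_poisson_law P (\<lambda>\<omega>. emeasure (count_space UNIV) (X \<omega> \<inter> I j)) (\<integral>\<^sup>+x\<in>I j. ennreal (\<rho> x) \<partial>lborel)"
    if "disjoint_family_on I {..<k}" "\<And>j. j < k \<Longrightarrow> is_interval (I j) \<and> I j \<subseteq> {0<..}" "j < k" for k :: nat and I j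
  proof -
    have "disjoint_family_on I {..<k} \<and> (\<forall>j<k. is_interval (I j) \<and> I j \<subseteq> {0<..})" using that by blast
    then show ?thesis using * that(3) by blast
  qed
qed

text \<open>With \<open>f\<close> frozen on each cell, the product depends only on the numbers of points in the cells, which are
  independent.\<close>

lemma poisson_step_product:
  fixes f :: "real \<Rightarrow> complex"
  assumes PX: "poisson_point_process P X \<rho>" and ab: "0 < a" "a < b" and K: "K > 0"
    and \<rho>: "set_integrable lborel {a<..b} \<rho>" "\<And>x. x \<in> {a<..b} \<Longrightarrow> \<rho> x \<ge> 0"
    and f: "\<And>x. x \<in> {a<..b} \<Longrightarrow> norm (f x) \<le> 1"
  shows "(\<lambda>\<omega>. \<Prod>x\<in>X \<omega> \<inter> {a<..b}. f (cell_end a b K x)) \<in> borel_measurable P"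
    and "(\<integral>\<omega>. (\<Prod>x\<in>X \<omega> \<inter> {a<..b}. f (cell_end a b K x)) \<partial>P)
      = exp (- (LBINT x:{a<..b}. of_real (\<rho> x) * (1 - f (cell_end a b K x))))"
proof -
  interpret prob_space P by (rule poisson_point_processD(1)[OF PX])
  let ?I = "cell a b K"
  let ?N = "\<lambda>j \<omega>. emeasure (count_space UNIV) (X \<omega> \<inter> ?I j)"
  define p where "p j = a + (b - a) / real K * (real j + 1)" for j
  \<comment> \<open>Counts live in \<open>ennreal\<close>. The Borel map \<open>c\<close> turns a
    finite count into a natural number that can serve as an exponent, while measurability and
    independence are preserved.\<close>
  define c where "c e = nat \<lfloor>enn2real e\<rfloor>" for e
  have cm[measurable]: "c \<in> measurable borel (count_space UNIV)" unfolding c_def by measurable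
  have ce: "cell_end a b K x = p j" if "x \<in> ?I j" for x j
    using cell_end_on_cell[OF ab(2) K that] by (simp add: p_def)
  have sub: "?I j \<subseteq> {a<..b}" if "j < K" for j using UN_cell[OF ab(2) K] that by blast
  have pj: "p j \<in> {a<..b}" if "j < K" for j
  proof -
    have "(b - a) / real K * real j < (b - a) / real K * (real j + 1)"
      using ab K by (intro mult_strict_left_mono divide_pos_pos) auto
    then have "p j \<in> ?I j" unfolding p_def cell_def greaterThanAtMost_iff by linarith
    then show ?thesis using sub[OF that] by blast
  qed
  have disj: "disjoint_family_on ?I {..<K}" by (rule disjoint_cell[OF ab(2) K])
  have int: "is_interval (?I j) \<and> ?I j \<subseteq> {0<..}" if "j < K" for j
    using sub[OF that] ab by (auto simp: cell_def is_interval_1)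
  have fin: "finite (X \<omega> \<inter> {a<..b})" if "\<omega> \<in> space P" for \<omega>
    by (rule finite_subset[OF _ poisson_point_processD(3)[OF PX that ab(1), of b]]) auto
  have finI: "finite (X \<omega> \<inter> ?I j)" if "\<omega> \<in> space P" "j < K" for \<omega> j
    by (rule finite_subset[OF _ fin[OF that(1)]]) (use sub[OF that(2)] in auto)
  have cN: "c (?N j \<omega>) = card (X \<omega> \<inter> ?I j)" if "\<omega> \<in> space P" "j < K" for \<omega> j
    using finI[OF that] by (simp add: c_def)
  have ind: "indep_vars (\<lambda>_. borel) ?N {..<K}" by (rule poisson_point_processD(4)[OF PX disj int])
  have Nm: "?N j \<in> borel_measurable P" if "j < K" for j using ind that by (auto simp: indep_vars_def)
  define l where "l j = (LBINT x:?I j. \<rho> x)" for j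
  have \<rho>I: "set_integrable lborel (?I j) \<rho>" if "j < K" for j
    by (rule set_integrable_subset[OF \<rho>(1)]) (use sub[OF that] in \<open>auto simp: cell_def\<close>)
  have Lam: "(\<integral>\<^sup>+x\<in>?I j. ennreal (\<rho> x) \<partial>lborel) = ennreal (l j)" and l0: "l j \<ge> 0" if "j < K" for j
  proof -
    have nn: "indicator (?I j) x *\<^sub>R \<rho> x \<ge> 0" for x
      using \<rho>(2) sub[OF that] by (auto simp: indicator_def)
    have "(\<integral>\<^sup>+x\<in>?I j. ennreal (\<rho> x) \<partial>lborel) = (\<integral>\<^sup>+x. ennreal (indicator (?I j) x *\<^sub>R \<rho> x) \<partial>lborel)"
      by (intro nn_integral_cong) (auto simp: indicator_def)
    also have "\<dots> = ennreal (l j)"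
      unfolding l_def set_lebesgue_integral_def
      using \<rho>I[OF that] nn by (intro nn_integral_eq_integral) (auto simp: set_integrable_def)
    finally show "(\<integral>\<^sup>+x\<in>?I j. ennreal (\<rho> x) \<partial>lborel) = ennreal (l j)" .
    show "l j \<ge> 0" unfolding l_def set_lebesgue_integral_def using nn by (intro integral_nonneg_AE) auto
  qed
  have gen: "(\<integral>\<omega>. w ^ c (?N j \<omega>) \<partial>P) = exp (- (of_real (l j) * (1 - w)))" if j: "j < K" and w: "norm w \<le> 1" for j and w :: complex
  proof (rule poisson_generating_function[OF _ _ w])
    show "(\<lambda>\<omega>. c (?N j \<omega>)) \<in> measurable P (count_space UNIV)"
      by (rule measurable_compose[OF Nm[OF j] cm])
    fix k
    have "{\<omega> \<in> space P. c (?N j \<omega>) = k} = {\<omega> \<in> space P. ?N j \<omega> = of_nat k}"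
      using finI[OF _ j] cN[OF _ j] by auto
    then show "prob {\<omega> \<in> space P. c (?N j \<omega>) = k} = l j ^ k / fact k * exp (- l j)"
      using poisson_point_processD(5)[OF PX disj int j] Lam[OF j] l0[OF j] by (simp add: has_poisson_law_def)
  qed
  have prod: "(\<Prod>x\<in>X \<omega> \<inter> {a<..b}. f (cell_end a b K x)) = (\<Prod>j<K. f (p j) ^ c (?N j \<omega>))" if \<omega>: "\<omega> \<in> space P" for \<omega>
  proof -
    have "(\<Prod>x\<in>X \<omega> \<inter> {a<..b}. f (cell_end a b K x)) = (\<Prod>x\<in>(\<Union>j<K. X \<omega> \<inter> ?I j). f (cell_end a b K x))"
      using UN_cell[OF ab(2) K] by (intro prod.cong) auto
    also have "\<dots> = (\<Prod>j<K. \<Prod>x\<in>X \<omega> \<inter> ?I j. f (cell_end a b K x))"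
      using finI[OF \<omega>] disj by (intro prod.UNION_disjoint) (auto simp: disjoint_family_on_def)
    also have "\<dots> = (\<Prod>j<K. f (p j) ^ c (?N j \<omega>))"
    proof (intro prod.cong refl)
      fix j assume "j \<in> {..<K}"
      moreover have "(\<Prod>x\<in>X \<omega> \<inter> ?I j. f (cell_end a b K x)) = (\<Prod>x\<in>X \<omega> \<inter> ?I j. f (p j))"
        using ce by (intro prod.cong) auto
      ultimately show "(\<Prod>x\<in>X \<omega> \<inter> ?I j. f (cell_end a b K x)) = f (p j) ^ c (?N j \<omega>)"
        using cN[OF \<omega>, of j] by simp
    qed
    finally show ?thesis .
  qed
  have pm: "(\<lambda>e. f (p j) ^ c e) \<in> borel_measurable borel" for j
    by (rule measurable_compose[OF cm]) simp
  have meas: "(\<lambda>\<omega>. f (p j) ^ c (?N j \<omega>)) \<in> borel_measurable P" if "j < K" for j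
    by (rule measurable_compose[OF Nm[OF that] pm])
  show "(\<lambda>\<omega>. \<Prod>x\<in>X \<omega> \<inter> {a<..b}. f (cell_end a b K x)) \<in> borel_measurable P"
    using meas by (subst measurable_cong[OF prod]) (auto intro!: borel_measurable_prod)
  have "(\<integral>\<omega>. (\<Prod>x\<in>X \<omega> \<inter> {a<..b}. f (cell_end a b K x)) \<partial>P) = (\<integral>\<omega>. (\<Prod>j<K. f (p j) ^ c (?N j \<omega>)) \<partial>P)"
    by (rule Bochner_Integration.integral_cong[OF refl prod])
  also have "\<dots> = (\<Prod>j<K. \<integral>\<omega>. f (p j) ^ c (?N j \<omega>) \<partial>P)"
  proof (rule indep_vars_lebesgue_integral)
    show "indep_vars (\<lambda>_. borel) (\<lambda>j \<omega>. f (p j) ^ c (?N j \<omega>)) {..<K}"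
      by (rule indep_vars_compose2[OF ind pm])
    show "integrable P (\<lambda>\<omega>. f (p j) ^ c (?N j \<omega>))" if "j \<in> {..<K}" for j
      using that f[OF pj] meas by (intro integrable_const_bound[of _ 1]) (auto simp: norm_power power_le_one)
  qed simp
  also have "\<dots> = (\<Prod>j<K. exp (- (of_real (l j) * (1 - f (p j)))))"
    using f pj by (intro prod.cong refl gen) auto
  also have "\<dots> = exp (- (\<Sum>j<K. of_real (l j) * (1 - f (p j))))"
    by (simp add: exp_sum[symmetric] sum_negf)
  also have "(\<Sum>j<K. of_real (l j) * (1 - f (p j))) = (LBINT x:{a<..b}. of_real (\<rho> x) * (1 - f (cell_end a b K x)))"
  proof -
    have i: "integrable lborel (\<lambda>x. complex_of_real (indicator (?I j) x *\<^sub>R \<rho> x) * (1 - f (p j)))" if "j < K" for j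
      using \<rho>I[OF that] unfolding set_integrable_def by (intro integrable_mult_left integrable_of_real)
    have "indicator {a<..b} x *\<^sub>R (complex_of_real (\<rho> x) * (1 - f (cell_end a b K x)))
       = (\<Sum>j<K. complex_of_real (indicator (?I j) x *\<^sub>R \<rho> x) * (1 - f (p j)))" for x
    proof (cases "x \<in> {a<..b}")
      case True
      then obtain i where i: "i < K" "x \<in> ?I i" using UN_cell[OF ab(2) K] by blast
      have other: "indicator (?I j) x = (0::real)" if "j \<noteq> i" for j
      proof -
        have "?I j \<inter> ?I i = {}" using disjoint_cell[OF ab(2) K, of UNIV] that by (auto simp: disjoint_family_on_def)
        then show ?thesis using i(2) by (auto simp: indicator_def)
      qed
      have "(\<Sum>j<K. complex_of_real (indicator (?I j) x *\<^sub>R \<rho> x) * (1 - f (p j))) = (\<Sum>j<K. if j = i then complex_of_real (\<rho> x) * (1 - f (p i)) else 0)"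
        using i other by (intro sum.cong refl) auto
      then show ?thesis using True i ce[OF i(2)] by simp
    next
      case False
      then have "x \<notin> ?I j" if "j < K" for j using sub[OF that] by blast
      then show ?thesis using False by simp
    qed
    then have "(LBINT x:{a<..b}. of_real (\<rho> x) * (1 - f (cell_end a b K x))) = (\<integral>x. (\<Sum>j<K. complex_of_real (indicator (?I j) x *\<^sub>R \<rho> x) * (1 - f (p j))) \<partial>lborel)"
      by (simp add: set_lebesgue_integral_def)
    also have "\<dots> = (\<Sum>j<K. \<integral>x. complex_of_real (indicator (?I j) x *\<^sub>R \<rho> x) * (1 - f (p j)) \<partial>lborel)"
      using i by (intro Bochner_Integration.integral_sum) auto
    also have "\<dots> = (\<Sum>j<K. of_real (l j) * (1 - f (p j)))"
    proof (intro sum.cong refl)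
      fix j
      show "(\<integral>x. complex_of_real (indicator (?I j) x *\<^sub>R \<rho> x) * (1 - f (p j)) \<partial>lborel) = of_real (l j) * (1 - f (p j))"
        unfolding l_def set_lebesgue_integral_def integral_mult_left_zero by (subst integral_complex_of_real) simp
    qed
    finally show ?thesis ..
  qed
  finally show "(\<integral>\<omega>. (\<Prod>x\<in>X \<omega> \<inter> {a<..b}. f (cell_end a b K x)) \<partial>P)
      = exp (- (LBINT x:{a<..b}. of_real (\<rho> x) * (1 - f (cell_end a b K x))))" .
qed

text \<open>Refining the subdivision moves \<open>cell_end\<close> to the point itself, and
  continuity of \<open>f\<close> carries this over to the finite products. Both sides pass to the
  limit by dominated convergence, with bound 1 under the probability measure and bound
  \<open>2 * \<rho>\<close> on the interval.\<close>

lemma poisson_product: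
  fixes f :: "real \<Rightarrow> complex"
  assumes PX: "poisson_point_process P X \<rho>" and ab: "0 < a" "a < b"
    and \<rho>: "set_integrable lborel {a<..b} \<rho>" "\<And>x. x \<in> {a<..b} \<Longrightarrow> \<rho> x \<ge> 0"
    and f: "\<And>x. x \<in> {a<..b} \<Longrightarrow> norm (f x) \<le> 1" and cont: "continuous_on {a<..b} f"
  shows "(\<lambda>\<omega>. \<Prod>x\<in>X \<omega> \<inter> {a<..b}. f x) \<in> borel_measurable P"
    and "(\<integral>\<omega>. (\<Prod>x\<in>X \<omega> \<inter> {a<..b}. f x) \<partial>P) = exp (- (LBINT x:{a<..b}. of_real (\<rho> x) * (1 - f x)))"
proof -
  interpret prob_space P by (rule poisson_point_processD(1)[OF PX])
  let ?c = "\<lambda>K. cell_end a b (Suc K)"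
  let ?S = "\<lambda>K \<omega>. \<Prod>x\<in>X \<omega> \<inter> {a<..b}. f (?c K x)"
  let ?T = "\<lambda>\<omega>. \<Prod>x\<in>X \<omega> \<inter> {a<..b}. f x"
  have step: "?S K \<in> borel_measurable P"
    "(\<integral>\<omega>. ?S K \<omega> \<partial>P) = exp (- (LBINT x:{a<..b}. of_real (\<rho> x) * (1 - f (?c K x))))" for K
    by (rule poisson_step_product[OF PX ab zero_less_Suc \<rho>(1)]; blast intro: \<rho>(2) f)+
  have fc: "(\<lambda>K. f (?c K x)) \<longlonglongrightarrow> f x" if x: "x \<in> {a<..b}" for x
  proof (rule continuous_on_tendsto_compose[OF cont _ x])
    show "(\<lambda>K. ?c K x) \<longlonglongrightarrow> x"
      using LIMSEQ_Suc[OF cell_end_tendsto[OF ab(2) x]] .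
    show "\<forall>\<^sub>F K in sequentially. ?c K x \<in> {a<..b}"
      using cell_end_bounds(3)[OF ab(2) zero_less_Suc x] by (intro always_eventually allI)
  qed
  have ST: "(\<lambda>K. ?S K \<omega>) \<longlonglongrightarrow> ?T \<omega>" for \<omega>
    using fc by (intro tendsto_prod) auto
  have norm_prod: "norm (\<Prod>x\<in>X \<omega> \<inter> {a<..b}. g x) \<le> 1" if "\<And>x. x \<in> {a<..b} \<Longrightarrow> norm (g x) \<le> 1" for g :: "real \<Rightarrow> complex" and \<omega>
    using that by (auto simp: prod_norm[symmetric] intro!: prod_le_1)
  show meas: "?T \<in> borel_measurable P"
    using step(1) ST by (rule borel_measurable_LIMSEQ_metric)
  have "(\<lambda>K. \<integral>\<omega>. ?S K \<omega> \<partial>P) \<longlonglongrightarrow> (\<integral>\<omega>. ?T \<omega> \<partial>P)"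
  proof (rule integral_dominated_convergence[where w="\<lambda>_. 1"])
    show "AE \<omega> in P. norm (?S K \<omega>) \<le> 1" for K
      using f cell_end_bounds(3)[OF ab(2) zero_less_Suc] by (intro AE_I2 norm_prod) blast
  qed (use meas step(1) ST in auto)
  moreover have "(\<lambda>K. \<integral>\<omega>. ?S K \<omega> \<partial>P) \<longlonglongrightarrow> exp (- (LBINT x:{a<..b}. of_real (\<rho> x) * (1 - f x)))"
    unfolding step(2)
  proof (intro tendsto_intros)
    \<comment> \<open>\<open>f\<close> is controlled on \<open>{a<..b}\<close> only, so it is cut
      off by the indicator before it is composed with \<open>cell_end\<close>; the cut-off has no
      effect because \<open>cell_end\<close> maps the interval into itself.\<close>
    have cem: "(\<lambda>x. f (?c K x) * indicator {a<..b} x) \<in> borel_measurable lborel" for K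
    proof -
      let ?g = "\<lambda>y. f y * indicator {a<..b} y"
      have "?g \<in> borel_measurable borel"
        using borel_measurable_continuous_on_indicator[OF _ cont] by (simp add: mult.commute scaleR_conv_of_real of_real_indicator)
      moreover have "?c K \<in> borel_measurable borel" unfolding cell_end_def by measurable
      ultimately have "(\<lambda>x. ?g (?c K x) * indicator {a<..b} x) \<in> borel_measurable lborel" by measurable
      moreover have "(\<lambda>x. ?g (?c K x) * indicator {a<..b} x) = (\<lambda>x. f (?c K x) * indicator {a<..b} x)"
        using cell_end_bounds(3)[OF ab(2) zero_less_Suc, of _ K] by (auto simp: fun_eq_iff indicator_def)
      ultimately show ?thesis by simp
    qed
    have fm: "(\<lambda>x. f x * indicator {a<..b} x) \<in> borel_measurable lborel"
      using borel_measurable_continuous_on_indicator[OF _ cont] by (simp add: mult.commute scaleR_conv_of_real of_real_indicator)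
    have rm: "(\<lambda>x. indicator {a<..b} x *\<^sub>R \<rho> x) \<in> borel_measurable lborel"
      using \<rho>(1) unfolding set_integrable_def by (rule borel_measurable_integrable)
    have sm: "(\<lambda>x. indicator {a<..b} x *\<^sub>R (complex_of_real (\<rho> x) * (1 - g x))) \<in> borel_measurable lborel"
      if "(\<lambda>x. g x * indicator {a<..b} x) \<in> borel_measurable lborel" for g
    proof -
      have "(\<lambda>x. complex_of_real (indicator {a<..b} x *\<^sub>R \<rho> x) * (1 - g x * indicator {a<..b} x)) \<in> borel_measurable lborel"
        using rm that by measurable
      also have "(\<lambda>x. complex_of_real (indicator {a<..b} x *\<^sub>R \<rho> x) * (1 - g x * indicator {a<..b} x))
         = (\<lambda>x. indicator {a<..b} x *\<^sub>R (complex_of_real (\<rho> x) * (1 - g x)))"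
        by (auto simp: fun_eq_iff indicator_def)
      finally show ?thesis .
    qed
    show "(\<lambda>K. LBINT x:{a<..b}. of_real (\<rho> x) * (1 - f (?c K x))) \<longlonglongrightarrow> (LBINT x:{a<..b}. of_real (\<rho> x) * (1 - f x))"
      unfolding set_lebesgue_integral_def
    proof (rule integral_dominated_convergence[where w="\<lambda>x. 2 * (indicator {a<..b} x *\<^sub>R \<rho> x)"])
      show "(\<lambda>x. indicator {a<..b} x *\<^sub>R (complex_of_real (\<rho> x) * (1 - f x))) \<in> borel_measurable lborel" by (rule sm[OF fm])
      show "(\<lambda>x. indicator {a<..b} x *\<^sub>R (complex_of_real (\<rho> x) * (1 - f (?c K x)))) \<in> borel_measurable lborel" for K
        by (rule sm[OF cem])
      show "integrable lborel (\<lambda>x. 2 * (indicator {a<..b} x *\<^sub>R \<rho> x))"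
        using \<rho>(1) unfolding set_integrable_def by (rule integrable_mult_right)
      show "AE x in lborel. (\<lambda>K. indicator {a<..b} x *\<^sub>R (complex_of_real (\<rho> x) * (1 - f (?c K x)))) \<longlonglongrightarrow> indicator {a<..b} x *\<^sub>R (complex_of_real (\<rho> x) * (1 - f x))"
      proof (intro AE_I2)
        fix x
        show "(\<lambda>K. indicator {a<..b} x *\<^sub>R (complex_of_real (\<rho> x) * (1 - f (?c K x)))) \<longlonglongrightarrow> indicator {a<..b} x *\<^sub>R (complex_of_real (\<rho> x) * (1 - f x))"
          by (cases "x \<in> {a<..b}") (auto intro!: tendsto_intros fc simp del: greaterThanAtMost_iff)
      qed
      show "AE x in lborel. norm (indicator {a<..b} x *\<^sub>R (complex_of_real (\<rho> x) * (1 - f (?c K x)))) \<le> 2 * (indicator {a<..b} x *\<^sub>R \<rho> x)" for K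
      proof (intro AE_I2)
        fix x
        show "norm (indicator {a<..b} x *\<^sub>R (complex_of_real (\<rho> x) * (1 - f (?c K x)))) \<le> 2 * (indicator {a<..b} x *\<^sub>R \<rho> x)"
        proof (cases "x \<in> {a<..b}")
          case True
          have "norm (1 - f (?c K x)) \<le> 2"
            using norm_triangle_ineq4[of 1 "f (?c K x)"] f[OF cell_end_bounds(3)[OF ab(2) zero_less_Suc True, of K]] by simp
          then have "\<rho> x * norm (1 - f (?c K x)) \<le> \<rho> x * 2" using \<rho>(2)[OF True] by (rule mult_left_mono)
          then show ?thesis using True \<rho>(2)[OF True] by (simp add: norm_mult)
        qed simp
      qed
    qed
  qed
  ultimately show "(\<integral>\<omega>. ?T \<omega> \<partial>P) = exp (- (LBINT x:{a<..b}. of_real (\<rho> x) * (1 - f x)))"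
    by (rule LIMSEQ_unique)
qed

section \<open>The exponent of the Poisson expectation in closed form\<close>

lemma resolvent_eq_inverse_csqrt:
  assumes "w \<noteq> 0"
  shows "w powr (-1/2) = 1 / csqrt w"
  using assms by (simp add: powr_def csqrt_exp_Ln exp_minus field_simps)

lemma continuous_on_resolvent:
  assumes z: "Re z > 0" and S: "S \<subseteq> {0<..}"
  shows "continuous_on S (\<lambda>x. (1 + z * complex_of_real x) powr (-1/2))"
proof (rule continuous_on_powr_complex)
  have r: "Re (1 + z * complex_of_real x) > 0" if "x \<in> S" for x
    using z S that by (auto intro!: add_pos_pos mult_pos_pos)
  show "S \<subseteq> {x. 0 \<le> Re (1 + z * complex_of_real x) \<or> Im (1 + z * complex_of_real x) \<noteq> 0}"
    using r less_imp_le by blast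
  show "0 < Re (- 1 / 2 :: complex)" if "x \<in> S" "1 + z * complex_of_real x = 0" for x
    using r[OF that(1)] that(2) by simp
qed (intro continuous_intros)+

lemma intensity_integral:
  fixes z :: complex
  assumes z: "Re z > 0" and ab: "0 < a" "a < b"
  shows "(LBINT x:{a<..b}. of_real (1 / (pi * x powr (3/2))) * (1 - (1 + z * of_real x) powr (-1/2)))
    = of_real (2 / pi) * ((csqrt (1 + z * of_real b) - 1) / of_real (sqrt b) - (csqrt (1 + z * of_real a) - 1) / of_real (sqrt a))"
proof -
  let ?g = "\<lambda>x. complex_of_real (1 / (pi * x powr (3/2))) * (1 - (1 + z * of_real x) powr (-1/2))"
  let ?F = "\<lambda>x. complex_of_real (2 / pi) * ((csqrt (1 + z * of_real x) - 1) * complex_of_real (1 / sqrt x))"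
  have Re1: "Re (1 + z * of_real x) > 0" if "x > 0" for x using that z by (simp add: add_pos_pos)
  have nn: "1 + z * of_real x \<notin> \<real>\<^sub>\<le>\<^sub>0" if "x > 0" for x
    using Re1[OF that] by (auto simp: complex_nonpos_Reals_iff)
  have cont: "continuous_on S ?g" if "S \<subseteq> {0<..}" for S
  proof (intro continuous_on_mult continuous_on_diff continuous_on_const continuous_on_of_real continuous_on_resolvent[OF z that])
    show "continuous_on S (\<lambda>x. 1 / (pi * x powr (3/2)))"
      using that by (intro continuous_intros) auto
  qed
  have "(\<integral>x. indicator {a..b} x *\<^sub>R ?g x \<partial>lborel) = ?F b - ?F a"
  proof (rule integral_FTC_Icc)
    show "a \<le> b" using ab by simp
    fix x assume "a \<le> x" "x \<le> b"
    then have x: "x > 0" using ab by simp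
    \<comment> \<open>In the two roots \<open>s\<close> and \<open>r\<close> every quantity is
      rational, and \<open>z = (s^2 - 1) / r^2\<close> eliminates \<open>z\<close>, so that the
      derivative of the antiderivative is verified by field arithmetic.\<close>
    define s where "s = csqrt (1 + z * of_real x)"
    define r where "r = complex_of_real (sqrt x)"
    have s2: "s\<^sup>2 = 1 + z * of_real x" by (simp add: s_def)
    have s0: "s \<noteq> 0" using nn[OF x] by (auto simp: s_def)
    have r2: "r\<^sup>2 = of_real x" using x by (simp add: r_def flip: of_real_power)
    have r0: "r \<noteq> 0" using x by (simp add: r_def)
    have d1: "((\<lambda>x. csqrt (1 + z * of_real x)) has_vector_derivative z / (2 * s)) (at x within {a..b})"
    proof -
      have "((\<lambda>w. csqrt (1 + z * w)) has_field_derivative z / (2 * s)) (at (of_real x))"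
        unfolding s_def using nn[OF x] by (auto intro!: derivative_eq_intros)
      then show ?thesis
        by (rule has_vector_derivative_at_within[OF has_vector_derivative_real_field])
    qed
    have d2: "((\<lambda>x. complex_of_real (1 / sqrt x)) has_vector_derivative of_real (- (1 / (2 * (x * sqrt x))))) (at x within {a..b})"
    proof -
      have "((\<lambda>x. 1 / sqrt x) has_real_derivative - (1 / (2 * (x * sqrt x)))) (at x within {a..b})"
        using x by (auto intro!: derivative_eq_intros simp: field_simps)
      then show ?thesis
        by (intro has_vector_derivative_of_real) (simp add: has_real_derivative_iff_has_vector_derivative)
    qed
    have "(?F has_vector_derivative of_real (2 / pi) * ((s - 1) * of_real (- (1 / (2 * (x * sqrt x)))) + (z / (2 * s) - 0) * of_real (1 / sqrt x))) (at x within {a..b})"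
      unfolding s_def
      by (intro has_vector_derivative_mult_right has_vector_derivative_mult has_vector_derivative_diff has_vector_derivative_const d1[unfolded s_def] d2)
    moreover have "of_real (2 / pi) * ((s - 1) * of_real (- (1 / (2 * (x * sqrt x)))) + (z / (2 * s) - 0) * of_real (1 / sqrt x)) = ?g x"
    proof -
      have "x powr (3/2) = x * sqrt x"
        using x powr_add[of x 1 "1/2"] by (simp add: powr_half_sqrt)
      then have p: "complex_of_real (x powr (3/2)) = r\<^sup>2 * r" using r2 by (simp add: r_def)
      have pw: "(1 + z * of_real x) powr (-1/2) = 1 / s"
        unfolding s_def by (rule resolvent_eq_inverse_csqrt) (use nn[OF x] in auto)
      have zx: "z = (s\<^sup>2 - 1) / r\<^sup>2" using s2 r2 x by simp
      show ?thesis
        unfolding of_real_divide of_real_mult of_real_minus p pw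
        unfolding r2[symmetric] r_def[symmetric] zx using s0 r0
        by (simp add: field_simps power2_eq_square)
    qed
    ultimately show "(?F has_vector_derivative ?g x) (at x within {a..b})" by simp
  next
    show "continuous_on {a..b} ?g" by (rule cont) (use ab in auto)
  qed
  moreover have "(LBINT x:{a<..b}. ?g x) = (\<integral>x. indicator {a..b} x *\<^sub>R ?g x \<partial>lborel)"
    unfolding set_lebesgue_integral_def
  proof (rule integral_cong_AE)
    show "AE x in lborel. indicator {a<..b} x *\<^sub>R ?g x = indicator {a..b} x *\<^sub>R ?g x"
      using AE_lborel_singleton[of a] by eventually_elim (auto simp: indicator_def)
    have "(\<lambda>x. indicator {a..b} x *\<^sub>R ?g x) \<in> borel_measurable borel"
      by (intro borel_measurable_continuous_on_indicator cont) (use ab in auto)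
    then show "(\<lambda>x. indicator {a..b} x *\<^sub>R ?g x) \<in> borel_measurable lborel" by simp
    have "(\<lambda>x. indicator {a<..b} x *\<^sub>R ?g x) \<in> borel_measurable borel"
      by (intro borel_measurable_continuous_on_indicator cont) (use ab in auto)
    then show "(\<lambda>x. indicator {a<..b} x *\<^sub>R ?g x) \<in> borel_measurable lborel" by simp
  qed
  ultimately show ?thesis by (simp add: right_diff_distrib)
qed

text \<open>At the upper end b, dividing by sqrt b turns the root into
  \<open>csqrt (z + 1/b)\<close>, which tends to \<open>csqrt z\<close>. At the lower end a,
  rationalising shows that \<open>csqrt (1 + z a) - 1\<close> is of order a, which outweighs the
  denominator sqrt a.\<close>

lemma intensity_integral_limit:
  fixes z :: complex
  assumes z: "Re z > 0"
  shows "(\<lambda>N. LBINT x:{1 / (real N + 2)<..real N + 2}. of_real (1 / (pi * x powr (3/2))) * (1 - (1 + z * of_real x) powr (-1/2)))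
    \<longlonglongrightarrow> of_real (2 / pi) * csqrt z"
proof -
  let ?H = "\<lambda>x. (csqrt (1 + z * of_real x) - 1) / complex_of_real (sqrt x)"
  have Re1: "Re (1 + z * of_real x) > 0" if "x > 0" for x using that z by (simp add: add_pos_pos)
  have "(\<lambda>N. ?H (real N + 2)) \<longlonglongrightarrow> csqrt z"
  proof -
    have eq: "?H b = csqrt (z + of_real (1 / b)) - of_real (1 / sqrt b)" if b: "b > 0" for b
    proof -
      \<comment> \<open>The quotient has the right square and a positive real part, so it is the
        principal root.\<close>
      have "csqrt (z + of_real (1 / b)) = csqrt (1 + z * of_real b) / of_real (sqrt b)"
      proof (rule csqrt_unique)
        show "(csqrt (1 + z * of_real b) / of_real (sqrt b))\<^sup>2 = z + of_real (1 / b)"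
          using b by (simp add: power_divide add_divide_distrib add.commute flip: of_real_power)
        have "Re (csqrt (1 + z * of_real b)) > 0"
          unfolding csqrt.sel(1)
          by (intro real_sqrt_gt_zero divide_pos_pos add_nonneg_pos norm_ge_zero Re1 b zero_less_numeral)
        then show "0 < Re (csqrt (1 + z * of_real b) / of_real (sqrt b)) \<or> Re (csqrt (1 + z * of_real b) / of_real (sqrt b)) = 0 \<and> 0 \<le> Im (csqrt (1 + z * of_real b) / of_real (sqrt b))"
          using b by (simp add: Re_divide_of_real del: csqrt.sel)
      qed
      then show ?thesis by (simp add: diff_divide_distrib)
    qed
    have "(\<lambda>N. csqrt (z + of_real (1 / (real N + 2))) - of_real (1 / sqrt (real N + 2))) \<longlonglongrightarrow> csqrt (z + of_real 0) - of_real 0"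
    proof (intro tendsto_diff tendsto_of_real)
      have "(\<lambda>N. 1 / (real N + 2)) \<longlonglongrightarrow> 0" by real_asymp
      then have "(\<lambda>N. z + of_real (1 / (real N + 2))) \<longlonglongrightarrow> z + of_real 0" by (intro tendsto_intros)
      moreover have "isCont csqrt (z + of_real 0)"
        using z by (intro continuous_at_csqrt) (auto simp: complex_nonpos_Reals_iff)
      ultimately show "(\<lambda>N. csqrt (z + of_real (1 / (real N + 2)))) \<longlonglongrightarrow> csqrt (z + of_real 0)"
        by (rule isCont_tendsto_compose[rotated])
      show "(\<lambda>N. 1 / sqrt (real N + 2)) \<longlonglongrightarrow> 0" by real_asymp
    qed
    moreover have "?H (real N + 2) = csqrt (z + of_real (1 / (real N + 2))) - of_real (1 / sqrt (real N + 2))" for N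
      by (rule eq) simp
    ultimately show ?thesis by (simp only: of_real_0 add_0_right diff_zero)
  qed
  moreover have "(\<lambda>N. ?H (1 / (real N + 2))) \<longlonglongrightarrow> 0"
  proof (rule Lim_null_comparison)
    show "\<forall>\<^sub>F N in sequentially. norm (?H (1 / (real N + 2))) \<le> norm z * sqrt (1 / (real N + 2))"
    proof (intro always_eventually allI)
      fix N
      define a where "a = 1 / (real N + 2)"
      have a: "a > 0" by (simp add: a_def)
      let ?s = "csqrt (1 + z * of_real a)"
      have "norm (?s + 1) \<ge> 1"
        using complex_Re_le_cmod[of "?s + 1"] Re_csqrt[of "1 + z * of_real a"] by (simp del: csqrt.sel)
      moreover have "(?s - 1) * (?s + 1) = z * of_real a"
        using power2_csqrt[of "1 + z * of_real a"] by (simp add: algebra_simps power2_eq_square del: power2_csqrt)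
      then have "norm (?s - 1) * norm (?s + 1) = norm z * a" using a by (metis norm_mult norm_of_real abs_of_pos)
      ultimately have "norm (?s - 1) \<le> norm z * a"
        using mult_left_mono[of 1 "norm (?s + 1)" "norm (?s - 1)"] by simp
      then have "norm (?H a) \<le> norm z * a / sqrt a" using a by (simp add: norm_divide divide_right_mono)
      also have "\<dots> = norm z * sqrt a" using a by (simp add: real_div_sqrt flip: times_divide_eq_right)
      finally show "norm (?H (1 / (real N + 2))) \<le> norm z * sqrt (1 / (real N + 2))" by (simp only: a_def)
    qed
    have "(\<lambda>N. norm z * sqrt (1 / (real N + 2))) \<longlonglongrightarrow> norm z * 0"
      by (intro tendsto_mult tendsto_const) real_asymp
    then show "(\<lambda>N. norm z * sqrt (1 / (real N + 2))) \<longlonglongrightarrow> 0" by simp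
  qed
  ultimately have "(\<lambda>N. of_real (2 / pi) * (?H (real N + 2) - ?H (1 / (real N + 2)))) \<longlonglongrightarrow> of_real (2 / pi) * (csqrt z - 0)"
    by (intro tendsto_intros)
  moreover have "0 < 1 / (real N + 2)" "1 / (real N + 2) < real N + 2" for N
  proof -
    have "1 / (real N + 2) \<le> 1" by simp
    then show "0 < 1 / (real N + 2)" "1 / (real N + 2) < real N + 2" by (simp, linarith)
  qed
  ultimately show ?thesis by (simp only: intensity_integral[OF z] diff_zero)
qed

text \<open>All factors have modulus at most 1, so the products over the windows are dominated by 1.
  Their pointwise limit is the unordered product, which therefore inherits measurability, and the
  expectation is the limit of the closed forms.\<close>

lemma poisson_infprod:
  assumes PX: "poisson_point_process P X (\<lambda>x. 1 / (pi * x powr (3/2)))" and z: "Re z > 0"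
  shows "(\<integral>\<omega>. infprod_over (\<lambda>x. (1 + z * complex_of_real x) powr (-1/2)) (X \<omega>) \<partial>P) = exp (- (2 / pi) * csqrt z)"
proof -
  interpret prob_space P by (rule poisson_point_processD(1)[OF PX])
  let ?f = "\<lambda>x. (1 + z * complex_of_real x) powr (-1/2)"
  let ?\<rho> = "\<lambda>x. 1 / (pi * x powr (3/2))"
  let ?a = "\<lambda>N::nat. 1 / (real N + 2)" and ?b = "\<lambda>N::nat. real N + 2"
  let ?S = "\<lambda>N \<omega>. \<Prod>x\<in>X \<omega> \<inter> {?a N<..?b N}. ?f x"
  have ab: "0 < ?a N" "?a N < ?b N" for N
  proof -
    have "?a N \<le> 1" by simp
    then show "0 < ?a N" "?a N < ?b N" by (simp, linarith)
  qed
  have f1: "norm (?f x) \<le> 1" if "x > 0" for x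
  proof -
    have n: "norm (1 + z * complex_of_real x) \<ge> 1"
      using complex_Re_le_cmod[of "1 + z * complex_of_real x"] z that mult_pos_pos[OF z that] by (simp del: mult_pos_pos)
    then have "1 + z * complex_of_real x \<noteq> 0" by auto
    then have "norm (?f x) = 1 / sqrt (norm (1 + z * complex_of_real x))"
      by (subst resolvent_eq_inverse_csqrt) (simp_all only: norm_divide norm_one norm_csqrt not_False_eq_True)
    also have "\<dots> \<le> 1 / 1" by (rule frac_le) (use n in auto)
    finally show ?thesis by (simp only: div_by_1)
  qed
  have pos: "x > 0" if "x \<in> {?a N<..?b N}" for x N
    by (rule less_trans[OF ab(1)[of N]]) (use that in simp)
  have cont: "continuous_on {?a N<..?b N} ?f" for N
    by (rule continuous_on_resolvent[OF z]) (use pos in blast)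
  have \<rho>i: "set_integrable lborel {?a N<..?b N} ?\<rho>" for N
  proof (rule set_integrable_subset)
    show "set_integrable lborel {?a N..?b N} ?\<rho>"
      by (rule borel_integrable_atLeastAtMost') (use ab(1)[of N] in \<open>auto intro!: continuous_intros\<close>)
  qed auto
  have S: "?S N \<in> borel_measurable P"
    "(\<integral>\<omega>. ?S N \<omega> \<partial>P) = exp (- (LBINT x:{?a N<..?b N}. of_real (?\<rho> x) * (1 - ?f x)))" for N
    by (rule poisson_product[OF PX ab[of N] \<rho>i[of N] _ _ cont[of N]]; (rule f1, erule pos | simp))+
  have lim: "(\<lambda>N. ?S N \<omega>) \<longlonglongrightarrow> infprod_over ?f (X \<omega>)" if \<omega>: "\<omega> \<in> space P" for \<omega>
    by (rule filterlim_compose[OF prod_resolvent_tendsto_infprod[OF poisson_point_processD(2)[OF PX \<omega>] z]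
          filterlim_inter_finite_subsets_at_top[OF poisson_point_processD(2,3)[OF PX \<omega>]]])
  have "(\<lambda>N. \<integral>\<omega>. ?S N \<omega> \<partial>P) \<longlonglongrightarrow> (\<integral>\<omega>. infprod_over ?f (X \<omega>) \<partial>P)"
  proof (rule integral_dominated_convergence[where w="\<lambda>_. 1"])
    show "(\<lambda>\<omega>. infprod_over ?f (X \<omega>)) \<in> borel_measurable P"
      by (rule borel_measurable_LIMSEQ_metric[OF S(1) lim])
    show "AE \<omega> in P. norm (?S N \<omega>) \<le> 1" for N
      using f1 pos by (intro AE_I2) (auto simp: prod_norm[symmetric] intro!: prod_le_1)
  qed (use S(1) lim in auto)
  moreover have "(\<lambda>N. \<integral>\<omega>. ?S N \<omega> \<partial>P) \<longlonglongrightarrow> exp (- (of_real (2 / pi) * csqrt z))"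
    unfolding S(2) by (intro tendsto_exp tendsto_minus intensity_integral_limit z)
  ultimately have "(\<integral>\<omega>. infprod_over ?f (X \<omega>) \<partial>P) = exp (- (of_real (2 / pi) * csqrt z))"
    by (rule LIMSEQ_unique)
  then show ?thesis by simp
qed

section \<open>Gaussian integrals and determinants\<close>

abbreviation gauss :: "nat \<Rightarrow> (nat \<Rightarrow> real) measure" where
  "gauss n \<equiv> Pi\<^sub>M {..<n} (\<lambda>_. std_normal_distribution)"

lemma prob_space_std_normal: "prob_space std_normal_distribution"
  by (rule prob_space_normal_density) simp

interpretation gauss: product_sigma_finite "\<lambda>_::nat. std_normal_distribution"
  by (intro product_sigma_finite.intro prob_space_imp_sigma_finite prob_space_std_normal)

lemma prob_space_gauss: "prob_space (gauss n)"
  by (rule prob_space_PiM) (rule prob_space_std_normal)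

lemma prob_space_gauss_pair: "prob_space (gauss n \<Otimes>\<^sub>M gauss m)"
  by (intro prob_space_pair prob_space_gauss)

lemmas measure_gauss_pair = prob_space.prob_space[OF prob_space_gauss_pair]

lemmas prob_space_integrable_bound = finite_measure.integrable_const_bound[OF prob_space.finite_measure]

lemma integrable_const_gauss_pair [simp]:
  fixes c :: "'a::{banach, second_countable_topology}"
  shows "integrable (gauss n \<Otimes>\<^sub>M gauss m) (\<lambda>_. c)"
  by (intro finite_measure.integrable_const prob_space.finite_measure prob_space_gauss_pair)

lemma pair_sigma_finite_prob_space:
  "prob_space M \<Longrightarrow> prob_space N \<Longrightarrow> pair_sigma_finite M N"
  by (intro pair_sigma_finite.intro prob_space_imp_sigma_finite)

text \<open>The subtracted \<open>y^2\<close> cancels the weight of the standard normal law. What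
  remains is a normal density with mean - b / d and variance 1 / d, up to the factor
  \<open>1 / sqrt d\<close>.\<close>

lemma gauss_integral_quadratic_1:
  fixes d b :: real
  assumes d: "d > 0"
  shows "(\<integral>\<^sup>+y. ennreal (exp (- (d * (y + b / d)\<^sup>2 - y\<^sup>2) / 2)) \<partial>std_normal_distribution) = ennreal (1 / sqrt d)"
proof -
  have "(\<integral>\<^sup>+y. ennreal (exp (- (d * (y + b / d)\<^sup>2 - y\<^sup>2) / 2)) \<partial>std_normal_distribution)
      = (\<integral>\<^sup>+y. ennreal (std_normal_density y) * ennreal (exp (- (d * (y + b / d)\<^sup>2 - y\<^sup>2) / 2)) \<partial>lborel)"
    by (intro nn_integral_density) auto
  also have "\<dots> = (\<integral>\<^sup>+y. ennreal (1 / sqrt d) * ennreal (normal_density (- b / d) (1 / sqrt d) y) \<partial>lborel)"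
  proof (intro nn_integral_cong)
    fix y :: real
    have "- y\<^sup>2 / 2 + - (d * (y + b / d)\<^sup>2 - y\<^sup>2) / 2 = - (y - - b / d)\<^sup>2 / (2 * (1 / sqrt d)\<^sup>2)"
      using d by (simp add: field_simps)
    then have "exp (- y\<^sup>2 / 2) * exp (- (d * (y + b / d)\<^sup>2 - y\<^sup>2) / 2) = exp (- (y - - b / d)\<^sup>2 / (2 * (1 / sqrt d)\<^sup>2))"
      by (simp only: flip: exp_add)
    moreover have "sqrt (2 * pi * (1 / sqrt d)\<^sup>2) = sqrt (2 * pi) / sqrt d"
      using d by (simp add: power_divide real_sqrt_divide)
    ultimately have "std_normal_density y * exp (- (d * (y + b / d)\<^sup>2 - y\<^sup>2) / 2) = 1 / sqrt d * normal_density (- b / d) (1 / sqrt d) y"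
      using d by (simp add: std_normal_density_def normal_density_def)
    then show "ennreal (std_normal_density y) * ennreal (exp (- (d * (y + b / d)\<^sup>2 - y\<^sup>2) / 2)) = ennreal (1 / sqrt d) * ennreal (normal_density (- b / d) (1 / sqrt d) y)"
      using d by (simp flip: ennreal_mult)
  qed
  also have "\<dots> = ennreal (1 / sqrt d) * (\<integral>\<^sup>+y. ennreal (normal_density (- b / d) (1 / sqrt d) y) \<partial>lborel)"
    by (intro nn_integral_cmult) auto
  also have "(\<integral>\<^sup>+y. ennreal (normal_density (- b / d) (1 / sqrt d) y) \<partial>lborel) = 1"
    using d by (subst nn_integral_eq_integral) auto
  finally show ?thesis by simp
qed

text \<open>One step of block elimination: \<open>C\<close> is a block upper triangular matrix, with
  the Schur complement of the last pivot in its corner, times a unit block lower triangular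
  one.\<close>

lemma det_schur_last:
  fixes C :: "real mat"
  assumes C: "C \<in> carrier_mat (Suc n) (Suc n)" and d: "C $$ (n, n) \<noteq> 0"
  shows "Determinant.det C = C $$ (n, n) *
    Determinant.det (mat n n (\<lambda>(i, j). C $$ (i, j) - C $$ (i, n) * C $$ (n, j) / C $$ (n, n)))"
proof -
  let ?S = "mat n n (\<lambda>(i, j). C $$ (i, j) - C $$ (i, n) * C $$ (n, j) / C $$ (n, n))"
  let ?b = "mat n 1 (\<lambda>(i, j). C $$ (i, n))"
  let ?r = "mat 1 n (\<lambda>(i, j). C $$ (n, j) / C $$ (n, n))"
  let ?d = "mat 1 1 (\<lambda>_. C $$ (n, n))"
  let ?L = "four_block_mat ?S ?b (0\<^sub>m 1 n) ?d"
  let ?R = "four_block_mat (1\<^sub>m n) (0\<^sub>m n 1) ?r (1\<^sub>m 1)"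
  have "?L * ?R = four_block_mat (?S * 1\<^sub>m n + ?b * ?r) (?S * 0\<^sub>m n 1 + ?b * 1\<^sub>m 1)
      (0\<^sub>m 1 n * 1\<^sub>m n + ?d * ?r) (0\<^sub>m 1 n * 0\<^sub>m n 1 + ?d * 1\<^sub>m 1)"
    by (rule mult_four_block_mat) auto
  also have "\<dots> = C"
    using C d by (intro eq_matI) (auto simp: four_block_mat_def scalar_prod_def less_Suc_eq)
  finally have "C = ?L * ?R" ..
  then have "Determinant.det C = Determinant.det ?L * Determinant.det ?R"
    by (metis (no_types, lifting) det_mult four_block_carrier_mat mat_carrier one_carrier_mat)
  also have "Determinant.det ?L = Determinant.det ?S * C $$ (n, n)"
    by (subst det_four_block_mat_lower_left_zero[where n=n and m=1]) (auto simp: det_single)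
  also have "Determinant.det ?R = 1"
    by (subst det_four_block_mat_upper_right_zero[where n=n and m=1]) auto
  finally show ?thesis by simp
qed

text \<open>Induction by completing the square in the last variable: integrating it out gives
  \<open>1 / sqrt d\<close> for the pivot \<open>d\<close> and leaves the quadratic form of the
  Schur complement. The determinant splits off the same pivot. The sum of squares is subtracted
  because the measure already carries the Gaussian weight.\<close>

lemma gauss_integral_quadratic:
  fixes C :: "real mat"
  assumes "C \<in> carrier_mat n n"
    and "\<And>i j. i < n \<Longrightarrow> j < n \<Longrightarrow> C $$ (i, j) = C $$ (j, i)"
    and "\<And>v. (\<exists>i<n. v i \<noteq> 0) \<Longrightarrow> 0 < (\<Sum>i<n. \<Sum>j<n. C $$ (i, j) * v i * v j)"
  shows "0 < Determinant.det C \<and>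
    (\<integral>\<^sup>+x. ennreal (exp (- ((\<Sum>i<n. \<Sum>j<n. C $$ (i, j) * x i * x j) - (\<Sum>i<n. (x i)\<^sup>2)) / 2)) \<partial>gauss n)
      = ennreal (1 / sqrt (Determinant.det C))"
  using assms
proof (induction n arbitrary: C)
  case 0
  then show ?case by (simp add: PiM_empty nn_integral_count_space_finite)
next
  case (Suc n)
  note C = Suc.prems(1) and sym = Suc.prems(2) and pd = Suc.prems(3)
  define d where "d = C $$ (n, n)"
  define S where "S = mat n n (\<lambda>(i, j). C $$ (i, j) - C $$ (i, n) * C $$ (n, j) / C $$ (n, n))"
  \<comment> \<open>The last unit vector is the test vector for the pivot.\<close>
  have d: "d > 0"
    using pd[of "\<lambda>i. if i = n then 1 else 0"] by (auto simp: d_def if_distrib cong: if_cong)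
  define b where "b x = (\<Sum>j<n. C $$ (n, j) * x j)" for x :: "nat \<Rightarrow> real"
  have quad: "(\<Sum>i<Suc n. \<Sum>j<Suc n. C $$ (i, j) * x i * x j)
      = (\<Sum>i<n. \<Sum>j<n. S $$ (i, j) * x i * x j) + d * (x n + b x / d)\<^sup>2" for x
  proof -
    have "(\<Sum>i<Suc n. \<Sum>j<Suc n. C $$ (i, j) * x i * x j)
       = (\<Sum>i<n. \<Sum>j<n. C $$ (i, j) * x i * x j) + (\<Sum>i<n. C $$ (i, n) * x i * x n)
        + (\<Sum>j<n. C $$ (n, j) * x n * x j) + d * x n * x n"
      by (simp add: sum.distrib d_def)
    also have "(\<Sum>i<n. C $$ (i, n) * x i * x n) = b x * x n"
      unfolding b_def sum_distrib_right by (intro sum.cong) (use sym in auto)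
    also have "(\<Sum>j<n. C $$ (n, j) * x n * x j) = b x * x n"
      unfolding b_def sum_distrib_right by (intro sum.cong) auto
    also have "(\<Sum>i<n. \<Sum>j<n. C $$ (i, j) * x i * x j) = (\<Sum>i<n. \<Sum>j<n. S $$ (i, j) * x i * x j) + b x * b x / d"
    proof -
      have "b x * b x / d = (\<Sum>i<n. \<Sum>j<n. C $$ (i, n) * C $$ (n, j) / d * x i * x j)"
        unfolding b_def sum_product sum_divide_distrib
        by (intro sum.cong refl) (use sym in auto)
      then show ?thesis
        unfolding S_def by (simp add: d_def algebra_simps flip: sum.distrib)
    qed
    also have "(\<Sum>i<n. \<Sum>j<n. S $$ (i, j) * x i * x j) + b x * b x / d + b x * x n + b x * x n + d * x n * x n
       = (\<Sum>i<n. \<Sum>j<n. S $$ (i, j) * x i * x j) + d * (x n + b x / d)\<^sup>2"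
      using d by (simp add: power2_eq_square field_simps)
    finally show ?thesis .
  qed
  have bupd: "b (x(n := y)) = b x" for x y
    unfolding b_def by (intro sum.cong) auto
  have IH: "0 < Determinant.det S \<and>
    (\<integral>\<^sup>+x. ennreal (exp (- ((\<Sum>i<n. \<Sum>j<n. S $$ (i, j) * x i * x j) - (\<Sum>i<n. (x i)\<^sup>2)) / 2)) \<partial>gauss n)
      = ennreal (1 / sqrt (Determinant.det S))"
  proof (rule Suc.IH)
    show "S \<in> carrier_mat n n" by (simp add: S_def)
    show "S $$ (i, j) = S $$ (j, i)" if "i < n" "j < n" for i j
      using that sym[of i j] sym[of i n] sym[of j n] by (simp add: S_def)
    \<comment> \<open>The Schur complement inherits positive definiteness: with last coordinate
      \<open>- b v / d\<close> the completed square vanishes and both forms agree.\<close>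
    fix v :: "nat \<Rightarrow> real" assume "\<exists>i<n. v i \<noteq> 0"
    then have "0 < (\<Sum>i<Suc n. \<Sum>j<Suc n. C $$ (i, j) * (v(n := - b v / d)) i * (v(n := - b v / d)) j)"
      by (intro pd) auto
    also have "\<dots> = (\<Sum>i<n. \<Sum>j<n. S $$ (i, j) * v i * v j)"
      unfolding quad bupd by simp
    finally show "0 < (\<Sum>i<n. \<Sum>j<n. S $$ (i, j) * v i * v j)" .
  qed
  have det: "Determinant.det C = d * Determinant.det S"
    using det_schur_last[OF C] d by (simp add: d_def S_def)
  let ?q = "\<lambda>x. (\<Sum>i<n. \<Sum>j<n. S $$ (i, j) * x i * x j) - (\<Sum>i<n. (x i)\<^sup>2)"
  have "(\<integral>\<^sup>+x. ennreal (exp (- ((\<Sum>i<Suc n. \<Sum>j<Suc n. C $$ (i, j) * x i * x j) - (\<Sum>i<Suc n. (x i)\<^sup>2)) / 2)) \<partial>gauss (Suc n))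
    = (\<integral>\<^sup>+x. ennreal (exp (- ((\<Sum>i<n. \<Sum>j<n. S $$ (i, j) * x i * x j) + d * (x n + b x / d)\<^sup>2 - (\<Sum>i<Suc n. (x i)\<^sup>2)) / 2)) \<partial>gauss (Suc n))"
    unfolding quad ..
  also have "\<dots> = (\<integral>\<^sup>+x. (\<integral>\<^sup>+y. ennreal (exp (- ((\<Sum>i<n. \<Sum>j<n. S $$ (i, j) * (x(n:=y)) i * (x(n:=y)) j) + d * (y + b x / d)\<^sup>2 - (\<Sum>i<Suc n. ((x(n:=y)) i)\<^sup>2)) / 2)) \<partial>std_normal_distribution) \<partial>gauss n)"
    unfolding lessThan_Suc
    by (subst gauss.product_nn_integral_insert) (auto simp: bupd b_def)
  also have "\<dots> = (\<integral>\<^sup>+x. (\<integral>\<^sup>+y. ennreal (exp (- ?q x / 2)) * ennreal (exp (- (d * (y + b x / d)\<^sup>2 - y\<^sup>2) / 2)) \<partial>std_normal_distribution) \<partial>gauss n)"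
    by (intro nn_integral_cong) (simp add: field_simps flip: ennreal_mult exp_add)
  also have "\<dots> = (\<integral>\<^sup>+x. ennreal (exp (- ?q x / 2)) * ennreal (1 / sqrt d) \<partial>gauss n)"
    by (intro nn_integral_cong, subst nn_integral_cmult)
      (auto simp only: gauss_integral_quadratic_1[OF d], measurable)
  also have "\<dots> = (\<integral>\<^sup>+x. ennreal (exp (- ?q x / 2)) \<partial>gauss n) * ennreal (1 / sqrt d)"
    by (intro nn_integral_multc) auto
  also have "\<dots> = ennreal (1 / sqrt (Determinant.det C))"
    using IH d by (simp add: det real_sqrt_mult flip: ennreal_mult)
  finally show ?case using IH d by (simp add: det)
qed

text \<open>The form of \<open>1 + s B^T B\<close> at v is |v|^2 + s |B v|^2, which is positive
  definite; subtracting |v|^2 leaves exactly the exponent on the left.\<close>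

lemma gauss_det:
  fixes B :: "real mat"
  assumes B: "B \<in> carrier_mat m n" and s: "s \<ge> 0"
  shows "0 < Determinant.det (1\<^sub>m n + s \<cdot>\<^sub>m (B\<^sup>T * B))"
    and "(\<integral>x. exp (- s * (\<Sum>j<m. (\<Sum>k<n. B $$ (j, k) * x k)\<^sup>2) / 2) \<partial>gauss n)
      = Determinant.det (1\<^sub>m n + s \<cdot>\<^sub>m (B\<^sup>T * B)) powr (-1/2)"
proof -
  let ?C = "1\<^sub>m n + s \<cdot>\<^sub>m (B\<^sup>T * B)"
  have C: "?C $$ (i, k) = (if i = k then 1 else 0) + s * (\<Sum>j<m. B $$ (j, i) * B $$ (j, k))"
    if "i < n" "k < n" for i k
    using that B by (auto simp: scalar_prod_def lessThan_atLeast0)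
  have q: "(\<Sum>i<n. \<Sum>k<n. ?C $$ (i, k) * v i * v k)
     = (\<Sum>i<n. (v i)\<^sup>2) + s * (\<Sum>j<m. (\<Sum>k<n. B $$ (j, k) * v k)\<^sup>2)" for v
  proof -
    have "(\<Sum>i<n. \<Sum>k<n. ?C $$ (i, k) * v i * v k)
      = (\<Sum>i<n. \<Sum>k<n. (if i = k then (v i)\<^sup>2 else 0) + s * (\<Sum>j<m. B $$ (j, i) * v i * (B $$ (j, k) * v k)))"
      by (intro sum.cong refl) (simp add: C algebra_simps power2_eq_square sum_distrib_left)
    also have "\<dots> = (\<Sum>i<n. (v i)\<^sup>2) + s * (\<Sum>i<n. \<Sum>k<n. \<Sum>j<m. B $$ (j, i) * v i * (B $$ (j, k) * v k))"
      by (simp add: sum.distrib sum_distrib_left)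
    also have "(\<Sum>i<n. \<Sum>k<n. \<Sum>j<m. B $$ (j, i) * v i * (B $$ (j, k) * v k))
       = (\<Sum>i<n. \<Sum>j<m. \<Sum>k<n. B $$ (j, i) * v i * (B $$ (j, k) * v k))"
      by (intro sum.cong refl sum.swap)
    also have "\<dots> = (\<Sum>j<m. \<Sum>i<n. \<Sum>k<n. B $$ (j, i) * v i * (B $$ (j, k) * v k))"
      by (rule sum.swap)
    finally show ?thesis by (simp add: power2_eq_square sum_product)
  qed
  have "0 < Determinant.det ?C \<and>
    (\<integral>\<^sup>+x. ennreal (exp (- ((\<Sum>i<n. \<Sum>j<n. ?C $$ (i, j) * x i * x j) - (\<Sum>i<n. (x i)\<^sup>2)) / 2)) \<partial>gauss n)
      = ennreal (1 / sqrt (Determinant.det ?C))"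
  proof (rule gauss_integral_quadratic)
    show "?C \<in> carrier_mat n n" using B by auto
    show "?C $$ (i, j) = ?C $$ (j, i)" if "i < n" "j < n" for i j
      using that by (simp add: C mult.commute)
    fix v :: "nat \<Rightarrow> real" assume "\<exists>i<n. v i \<noteq> 0"
    then obtain i where "i < n" "v i \<noteq> 0" by blast
    then have "0 < (\<Sum>i<n. (v i)\<^sup>2)" by (intro sum_pos2[of _ i]) auto
    then show "0 < (\<Sum>i<n. \<Sum>j<n. ?C $$ (i, j) * v i * v j)"
      unfolding q using s by (auto intro!: add_pos_nonneg mult_nonneg_nonneg sum_nonneg)
  qed
  then have pos: "0 < Determinant.det ?C"
    and nn: "(\<integral>\<^sup>+x. ennreal (exp (- s * (\<Sum>j<m. (\<Sum>k<n. B $$ (j, k) * x k)\<^sup>2) / 2)) \<partial>gauss n) = ennreal (1 / sqrt (Determinant.det ?C))"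
    unfolding q by auto
  show "0 < Determinant.det ?C" by (rule pos)
  show "(\<integral>x. exp (- s * (\<Sum>j<m. (\<Sum>k<n. B $$ (j, k) * x k)\<^sup>2) / 2) \<partial>gauss n) = Determinant.det ?C powr (-1/2)"
    using nn pos by (subst integral_eq_nn_integral) (auto simp: powr_minus_divide powr_half_sqrt)
qed

section \<open>The spectrum of a Gram matrix\<close>

lemma proots_prod_mset_linear:
  fixes f :: "'b \<Rightarrow> 'a::idom"
  shows "proots (\<Prod>x\<in>#S. [:- f x, 1:]) = image_mset f S"
proof (induction S)
  case (add x S)
  have "(\<Prod>x\<in>#S. [:- f x, 1:]) \<noteq> 0" by (auto simp: prod_mset_zero_iff)
  then show ?case using add by (simp add: proots_mult del: mult_pCons_left)
qed simp

text \<open>For a complex eigenvector v with eigenvalue l one has l |v|^2 = |B v|^2, so all complex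
  roots are real and nonnegative. The complex factorisation therefore descends to the real
  characteristic polynomial, and this is what ensures that the real spectrum has n elements.\<close>

lemma proots_char_poly_gram:
  fixes B :: "real mat"
  assumes B: "B \<in> carrier_mat m n"
  shows "proots (char_poly (map_mat complex_of_real (B\<^sup>T * B))) = image_mset of_real (proots (char_poly (B\<^sup>T * B)))"
    and "size (proots (char_poly (B\<^sup>T * B))) = n"
    and "\<And>l. l \<in># proots (char_poly (B\<^sup>T * B)) \<Longrightarrow> l \<ge> 0"
proof -
  let ?G = "B\<^sup>T * B"
  let ?H = "map_mat complex_of_real ?G"
  have G: "?G \<in> carrier_mat n n" using B by auto
  then have H: "?H \<in> carrier_mat n n" by auto
  have nneg: "Re l \<ge> 0 \<and> Im l = 0" if l: "poly (char_poly ?H) l = 0" for l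
  proof -
    have "eigenvalue ?H l" using l by (simp add: eigenvalue_root_char_poly[OF H])
    then obtain v where v: "v \<in> carrier_vec n" "v \<noteq> 0\<^sub>v n" "?H *\<^sub>v v = l \<cdot>\<^sub>v v"
      using H by (auto simp: eigenvalue_def eigenvector_def)
    define y where "y j = (\<Sum>k<n. of_real (B $$ (j, k)) * v $ k)" for j
    have ev: "l * v $ i = (\<Sum>j<m. of_real (B $$ (j, i)) * y j)" if i: "i < n" for i
    proof -
      have "l * v $ i = (l \<cdot>\<^sub>v v) $ i" using v i by simp
      also have "\<dots> = (?H *\<^sub>v v) $ i" using v by simp
      also have "\<dots> = (\<Sum>k<n. of_real (\<Sum>j<m. B $$ (j, i) * B $$ (j, k)) * v $ k)"
        using B v(1) i by (simp add: scalar_prod_def lessThan_atLeast0)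
      also have "\<dots> = (\<Sum>k<n. \<Sum>j<m. of_real (B $$ (j, i)) * (of_real (B $$ (j, k)) * v $ k))"
        by (simp add: sum_distrib_right mult.assoc)
      also have "\<dots> = (\<Sum>j<m. \<Sum>k<n. of_real (B $$ (j, i)) * (of_real (B $$ (j, k)) * v $ k))"
        by (rule sum.swap)
      finally show ?thesis by (simp add: y_def sum_distrib_left)
    qed
    have cy: "cnj (y j) = (\<Sum>k<n. of_real (B $$ (j, k)) * cnj (v $ k))" for j
      by (simp add: y_def)
    have "l * of_real (\<Sum>i<n. (norm (v $ i))\<^sup>2) = (\<Sum>i<n. cnj (v $ i) * (l * v $ i))"
      unfolding of_real_sum complex_norm_square sum_distrib_left by (simp add: mult_ac)
    also have "\<dots> = (\<Sum>i<n. \<Sum>j<m. of_real (B $$ (j, i)) * cnj (v $ i) * y j)"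
      by (intro sum.cong refl) (simp add: ev sum_distrib_left mult_ac)
    also have "\<dots> = (\<Sum>j<m. \<Sum>i<n. of_real (B $$ (j, i)) * cnj (v $ i) * y j)"
      by (rule sum.swap)
    also have "\<dots> = (\<Sum>j<m. cnj (y j) * y j)"
      unfolding cy sum_distrib_right ..
    also have "\<dots> = of_real (\<Sum>j<m. (norm (y j))\<^sup>2)"
      unfolding of_real_sum complex_norm_square by (simp add: mult.commute)
    finally have eq: "l * of_real (\<Sum>i<n. (norm (v $ i))\<^sup>2) = of_real (\<Sum>j<m. (norm (y j))\<^sup>2)" .
    have "\<exists>i<n. v $ i \<noteq> 0" using v(1,2) by (auto simp: vec_eq_iff)
    then obtain i where "i < n" "v $ i \<noteq> 0" by blast
    then have pos: "(\<Sum>i<n. (norm (v $ i))\<^sup>2) > 0" by (intro sum_pos2[of _ i]) auto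
    have "l = of_real ((\<Sum>j<m. (norm (y j))\<^sup>2) / (\<Sum>i<n. (norm (v $ i))\<^sup>2))"
    proof -
      have "complex_of_real (\<Sum>i<n. (norm (v $ i))\<^sup>2) \<noteq> 0" using pos by (simp only: of_real_eq_0_iff)
      then show ?thesis using eq by (simp only: of_real_divide nonzero_eq_divide_eq simp_thms)
    qed
    then show ?thesis
      using pos by (metis Im_complex_of_real Re_complex_of_real divide_nonneg_pos sum_nonneg zero_le_power2)
  qed
  let ?R = "proots (char_poly ?H)"
  have monH: "lead_coeff (char_poly ?H) = 1" "degree (char_poly ?H) = n"
    using degree_monic_char_poly[OF H] by auto
  then have nzH: "char_poly ?H \<noteq> 0" by auto
  have sizeR: "size ?R = n" using size_proots_complex[of "char_poly ?H"] monH by simp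
  \<comment> \<open>No information is lost by taking real parts, since all roots are real.\<close>
  define L where "L = image_mset Re ?R"
  have RL: "?R = image_mset of_real L"
  proof -
    have "image_mset of_real L = image_mset (\<lambda>x. x) ?R"
      unfolding L_def multiset.map_comp
      by (rule image_mset_cong) (use nneg nzH in \<open>auto simp: complex_eq_iff\<close>)
    then show ?thesis by simp
  qed
  \<comment> \<open>The real polynomial and its complexification agree at real arguments, and a real
    polynomial is determined by these values.\<close>
  have "poly (char_poly ?G) x = poly (\<Prod>x\<in>#L. [:- x, 1:]) x" for x
  proof -
    have "complex_of_real (poly (char_poly ?G) x) = poly (char_poly ?H) (of_real x)"
      unfolding of_real_hom.char_poly_hom[OF G] by simp
    also have "char_poly ?H = (\<Prod>x\<in>#?R. [:-x, 1:])"
      using complex_poly_decompose_multiset[of "char_poly ?H"] monH by simp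
    also have "poly (\<Prod>x\<in>#?R. [:-x, 1:]) (of_real x) = (\<Prod>l\<in>#L. complex_of_real (x - l))"
      by (simp add: RL multiset.map_comp o_def poly_prod_mset)
    also have "\<dots> = complex_of_real (\<Prod>l\<in>#L. x - l)"
      by (induction L) auto
    also have "(\<Prod>l\<in>#L. x - l) = poly (\<Prod>x\<in>#L. [:- x, 1:]) x"
      by (simp add: poly_prod_mset multiset.map_comp o_def)
    finally show ?thesis by (simp only: of_real_eq_iff)
  qed
  then have "char_poly ?G = (\<Prod>x\<in>#L. [:- x, 1:])" by (intro poly_ext)
  then have L: "proots (char_poly ?G) = L" by (simp add: proots_prod_mset_linear)
  show "proots (char_poly ?H) = image_mset of_real (proots (char_poly ?G))" using RL L by simp
  show "size (proots (char_poly ?G)) = n" using L sizeR by (simp add: L_def)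
  show "l \<ge> 0" if "l \<in># proots (char_poly ?G)" for l
    using that nneg nzH unfolding L L_def by auto
qed

text \<open>The ordered list is a permutation of the multiset of roots, and a commutative product
  does not see the order. The index starts at 1, the list at 0.\<close>

lemma prod_ordered_eigenvalue:
  fixes f :: "real \<Rightarrow> 'a::comm_monoid_mult"
  assumes "size (proots (char_poly C)) = n"
  shows "(\<Prod>i=1..n. f (ordered_eigenvalue C i)) = (\<Prod>l\<in>#proots (char_poly C). f l)"
proof -
  let ?xs = "rev (sorted_list_of_multiset (proots (char_poly C)))"
  have mset: "mset ?xs = proots (char_poly C)" by simp
  then have len: "length ?xs = n" using assms by (metis size_mset)
  have "(\<Prod>i=1..n. f (ordered_eigenvalue C i)) = (\<Prod>i<n. f (?xs ! i))"
    unfolding ordered_eigenvalue_def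
    by (rule prod.reindex_bij_witness[of _ Suc "\<lambda>i. i - 1"]) auto
  also have "\<dots> = prod_list (map f ?xs)"
    using len by (simp add: prod.list_conv_set_nth lessThan_atLeast0)
  also have "\<dots> = prod_mset (image_mset f (mset ?xs))"
    by (simp only: prod_mset_prod_list flip: mset_map)
  finally show ?thesis by (simp only: mset)
qed

lemma ordered_eigenvalue_nonneg:
  assumes B: "B \<in> carrier_mat m n" and i: "i \<in> {1..n}"
  shows "ordered_eigenvalue (B\<^sup>T * B) i \<ge> 0"
proof -
  let ?xs = "rev (sorted_list_of_multiset (proots (char_poly (B\<^sup>T * B))))"
  have mset: "mset ?xs = proots (char_poly (B\<^sup>T * B))" by simp
  have "length ?xs = n" using proots_char_poly_gram(2)[OF B] by (metis mset size_mset)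
  then have "?xs ! (i - 1) \<in> set ?xs" using i by (intro nth_mem) auto
  then have "?xs ! (i - 1) \<in># proots (char_poly (B\<^sup>T * B))" using mset by (metis set_mset_mset)
  then show ?thesis unfolding ordered_eigenvalue_def by (rule proots_char_poly_gram(3)[OF B])
qed

text \<open>\<open>x - (1 + c C)\<close> equals c times \<open>(x - 1) / c - C\<close>, so the
  characteristic polynomials differ by an affine substitution and a factor \<open>c ^ n\<close>,
  which is distributed over the n linear factors.\<close>

lemma proots_char_poly_affine:
  fixes C :: "complex mat"
  assumes C: "C \<in> carrier_mat n n" and c: "c \<noteq> 0"
  shows "proots (char_poly (1\<^sub>m n + c \<cdot>\<^sub>m C)) = image_mset (\<lambda>l. 1 + c * l) (proots (char_poly C))"
proof -
  let ?D = "1\<^sub>m n + c \<cdot>\<^sub>m C"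
  let ?R = "proots (char_poly C)"
  have D: "?D \<in> carrier_mat n n" using C by auto
  have mon: "lead_coeff (char_poly C) = 1" "degree (char_poly C) = n"
    using degree_monic_char_poly[OF C] by auto
  have sz: "size ?R = n" using size_proots_complex[of "char_poly C"] mon by simp
  have "poly (char_poly ?D) x = poly (\<Prod>l\<in>#?R. [:- (1 + c * l), 1:]) x" for x
  proof -
    have "- char_matrix ?D x = c \<cdot>\<^sub>m (- char_matrix C ((x - 1) / c))"
      using C c by (intro eq_matI) (auto simp: char_matrix_def field_simps)
    then have "poly (char_poly ?D) x = c ^ n * Determinant.det (- char_matrix C ((x - 1) / c))"
      using C by (simp add: char_poly_matrix[OF D] char_matrix_def)
    also have "\<dots> = c ^ n * poly (char_poly C) ((x - 1) / c)"
      by (simp add: char_poly_matrix[OF C])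
    also have "char_poly C = (\<Prod>x\<in>#?R. [:-x, 1:])"
      using complex_poly_decompose_multiset[of "char_poly C"] mon by simp
    also have "c ^ n * poly (\<Prod>x\<in>#?R. [:-x, 1:]) ((x - 1) / c) = (\<Prod>l\<in>#?R. c * ((x - 1) / c - l))"
      unfolding sz[symmetric] by (simp add: poly_prod_mset multiset.map_comp o_def prod_mset.distrib)
    also have "\<dots> = poly (\<Prod>l\<in>#?R. [:- (1 + c * l), 1:]) x"
    proof -
      have "c * ((x - 1) / c - l) = x - (1 + c * l)" for l
        using c by (simp add: field_simps)
      then show ?thesis by (simp add: poly_prod_mset multiset.map_comp o_def) (simp add: algebra_simps)
    qed
    finally show ?thesis .
  qed
  then have "char_poly ?D = (\<Prod>l\<in>#?R. [:- (1 + c * l), 1:])" by (intro poly_ext)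
  then show ?thesis by (simp only: proots_prod_mset_linear)
qed

lemma det_powr_gram:
  fixes B :: "real mat"
  assumes B: "B \<in> carrier_mat m n" and c: "c \<noteq> 0"
  shows "det_powr (1\<^sub>m n + c \<cdot>\<^sub>m map_mat complex_of_real (B\<^sup>T * B)) s
    = (\<Prod>i=1..n. (1 + c * of_real (ordered_eigenvalue (B\<^sup>T * B) i)) powr s)"
proof -
  have H: "map_mat complex_of_real (B\<^sup>T * B) \<in> carrier_mat n n" using B by auto
  show ?thesis
    unfolding det_powr_def proots_char_poly_affine[OF H c] proots_char_poly_gram(1)[OF B]
      prod_ordered_eigenvalue[OF proots_char_poly_gram(2)[OF B], where f="\<lambda>l. (1 + c * of_real l) powr s"]
    by (simp add: multiset.map_comp o_def)
qed

text \<open>Obtained from the factorwise power with exponent 1, which is the determinant. The case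
  \<open>c = 0\<close> is separate because the affine substitution divides by
  \<open>c\<close>.\<close>

lemma det_gram:
  fixes B :: "real mat"
  assumes B: "B \<in> carrier_mat m n"
  shows "Determinant.det (1\<^sub>m n + c \<cdot>\<^sub>m (B\<^sup>T * B)) = (\<Prod>i=1..n. 1 + c * ordered_eigenvalue (B\<^sup>T * B) i)"
proof (cases "c = 0")
  case True
  have "1\<^sub>m n + 0 \<cdot>\<^sub>m (B\<^sup>T * B) = 1\<^sub>m n" using B by (intro eq_matI) auto
  then show ?thesis using True by simp
next
  case False
  let ?H = "1\<^sub>m n + of_real c \<cdot>\<^sub>m map_mat complex_of_real (B\<^sup>T * B)"
  have H: "?H \<in> carrier_mat n n" using B by auto
  have "map_mat complex_of_real (1\<^sub>m n + c \<cdot>\<^sub>m (B\<^sup>T * B)) = ?H"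
    using B by (intro eq_matI) auto
  then have "complex_of_real (Determinant.det (1\<^sub>m n + c \<cdot>\<^sub>m (B\<^sup>T * B))) = Determinant.det ?H"
    by (metis of_real_hom.hom_det)
  also have "\<dots> = (\<Prod>i=1..n. (1 + of_real c * of_real (ordered_eigenvalue (B\<^sup>T * B) i)) powr 1)"
    using False det_powr_gram[OF B, of "of_real c" 1] det_powr_one[OF H] by simp
  also have "\<dots> = of_real (\<Prod>i=1..n. 1 + c * ordered_eigenvalue (B\<^sup>T * B) i)"
  proof -
    have "x powr 1 = x" for x :: complex by (auto simp: powr_def)
    then show ?thesis by simp
  qed
  finally show ?thesis by (simp only: of_real_eq_iff)
qed

section \<open>Holomorphic dependence on a parameter\<close>

text \<open>The difference quotients are dominated by the Cauchy estimate for the derivative.\<close>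

lemma holomorphic_integral_bounded_family:
  fixes F :: "'a \<Rightarrow> complex \<Rightarrow> complex"
  assumes "prob_space M" and S: "open S"
    and hol: "\<And>\<omega>. \<omega> \<in> space M \<Longrightarrow> F \<omega> holomorphic_on S"
    and bnd: "\<And>\<omega> z. \<omega> \<in> space M \<Longrightarrow> z \<in> S \<Longrightarrow> norm (F \<omega> z) \<le> 1"
    and meas: "\<And>z. z \<in> S \<Longrightarrow> (\<lambda>\<omega>. F \<omega> z) \<in> borel_measurable M"
  shows "(\<lambda>z. \<integral>\<omega>. F \<omega> z \<partial>M) holomorphic_on S"
  unfolding holomorphic_on_open[OF S]
proof
  interpret prob_space M by fact
  fix z0 assume z0: "z0 \<in> S"
  \<comment> \<open>With \<open>2 * r\<close> in reserve, the closed disc of radius \<open>r\<close>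
    around every point of \<open>ball z0 r\<close> stays in \<open>S\<close>, as the Cauchy estimate
    requires.\<close>
  then obtain r where r: "r > 0" "cball z0 (2 * r) \<subseteq> S"
  proof -
    obtain e where "e > 0" "cball z0 e \<subseteq> S" using S z0 open_contains_cball by blast
    then show ?thesis using that[of "e/2"] by simp
  qed
  have int: "integrable M (\<lambda>\<omega>. F \<omega> z)" if "z \<in> S" for z
    using meas[OF that] bnd[OF _ that] by (intro integrable_const_bound[of _ 1]) auto
  have dbound: "norm (deriv (F \<omega>) z) \<le> 1 / r" if \<omega>: "\<omega> \<in> space M" and z: "z \<in> ball z0 r" for \<omega> z
  proof -
    have sub: "cball z r \<subseteq> S"
    proof -
      have "cball z r \<subseteq> cball z0 (2 * r)"
      proof
        fix x assume "x \<in> cball z r"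
        then have "dist z x \<le> r" by simp
        moreover have "dist z0 z < r" using z by simp
        ultimately show "x \<in> cball z0 (2 * r)"
          using dist_triangle[of z0 x z] by simp
      qed
      then show ?thesis using r(2) by (rule order_trans)
    qed
    have "norm ((deriv ^^ 1) (F \<omega>) z) \<le> fact 1 * 1 / r ^ 1"
    proof (rule Cauchy_inequality)
      show "F \<omega> holomorphic_on ball z r"
        using hol[OF \<omega>] by (rule holomorphic_on_subset) (use sub ball_subset_cball in blast)
      show "continuous_on (cball z r) (F \<omega>)"
        by (rule holomorphic_on_imp_continuous_on[OF holomorphic_on_subset[OF hol[OF \<omega>] sub]])
      show "norm (F \<omega> x) \<le> 1" if "norm (z - x) = r" for x
      proof (rule bnd[OF \<omega>])
        have "x \<in> cball z r" using that by (simp add: dist_norm)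
        then show "x \<in> S" using sub by blast
      qed
      show "0 < r" by (rule r(1))
    qed
    then show ?thesis by simp
  qed
  have ballS: "ball z0 r \<subseteq> S"
  proof -
    have "ball z0 r \<subseteq> cball z0 (2 * r)" using r(1) by (auto simp: subset_iff)
    then show ?thesis using r(2) by (rule order_trans)
  qed
  define Q where "Q \<omega> z = (F \<omega> z - F \<omega> z0) / (z - z0)" for \<omega> z
  have Qbound: "norm (Q \<omega> z) \<le> 1 / r" if \<omega>: "\<omega> \<in> space M" and z: "z \<in> ball z0 r" "z \<noteq> z0" for \<omega> z
  proof -
    have "norm (F \<omega> z - F \<omega> z0) \<le> 1 / r * norm (z - z0)"
    proof (rule field_differentiable_bound[where S="ball z0 r"])
      show "(F \<omega> has_field_derivative deriv (F \<omega>) x) (at x within ball z0 r)" if "x \<in> ball z0 r" for x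
      proof -
        have "x \<in> S" using that ballS by blast
        then show ?thesis
          by (rule holomorphic_derivI[OF hol[OF \<omega>] S])
      qed
      show "norm (deriv (F \<omega>) x) \<le> 1 / r" if "x \<in> ball z0 r" for x
        using that by (rule dbound[OF \<omega>])
      show "convex (ball z0 r)" by (rule convex_ball)
      show "z \<in> ball z0 r" by (rule z)
      show "z0 \<in> ball z0 r" using r by simp
    qed
    then show ?thesis using z(2) by (simp add: Q_def norm_divide divide_le_eq)
  qed
  have lim: "(\<lambda>k. Q \<omega> (X k)) \<longlonglongrightarrow> deriv (F \<omega>) z0"
    if \<omega>: "\<omega> \<in> space M" and X: "X \<longlonglongrightarrow> z0" "\<And>k. X k \<noteq> z0" for \<omega> X
  proof -
    have "(F \<omega> has_field_derivative deriv (F \<omega>) z0) (at z0)"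
      using hol[OF \<omega>] S z0 by (rule holomorphic_derivI)
    then have "(Q \<omega> \<longlongrightarrow> deriv (F \<omega>) z0) (at z0)"
      unfolding has_field_derivative_iff Q_def .
    then show ?thesis
      by (rule filterlim_compose) (use X in \<open>auto simp: filterlim_at\<close>)
  qed
  have measQ: "(\<lambda>\<omega>. Q \<omega> z) \<in> borel_measurable M" if "z \<in> S" for z
    unfolding Q_def using meas[OF that] meas[OF z0] by measurable
  have "((\<lambda>z. ((\<integral>\<omega>. F \<omega> z \<partial>M) - (\<integral>\<omega>. F \<omega> z0 \<partial>M)) / (z - z0)) \<longlongrightarrow> (\<integral>\<omega>. deriv (F \<omega>) z0 \<partial>M)) (at z0)"
    unfolding tendsto_at_iff_sequentially
  proof (intro allI impI)
    \<comment> \<open>Dominated convergence acts along sequences; the shift by \<open>N\<close>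
      discards the terms outside the ball on which the difference quotients are bounded.\<close>
    fix X :: "nat \<Rightarrow> complex" assume X: "\<forall>i. X i \<in> UNIV - {z0}" "X \<longlonglongrightarrow> z0"
    have "\<forall>\<^sub>F k in sequentially. X k \<in> ball z0 r"
      by (intro topological_tendstoD[OF X(2)]) (use r(1) in auto)
    then obtain N where N: "X (k + N) \<in> ball z0 r" for k
      unfolding eventually_sequentially by (meson le_add2)
    have XN: "(\<lambda>k. X (k + N)) \<longlonglongrightarrow> z0" using X(2) by (rule LIMSEQ_ignore_initial_segment)
    have nz: "X k \<noteq> z0" for k using X(1) by auto
    \<comment> \<open>The derivative is measurable in the parameter as a pointwise limit of
      difference quotients.\<close>
    have dm: "(\<lambda>\<omega>. deriv (F \<omega>) z0) \<in> borel_measurable M"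
    proof (rule borel_measurable_LIMSEQ_metric)
      show "(\<lambda>\<omega>. Q \<omega> (X (k + N))) \<in> borel_measurable M" for k
        using subsetD[OF ballS N] by (rule measQ)
      show "(\<lambda>k. Q \<omega> (X (k + N))) \<longlonglongrightarrow> deriv (F \<omega>) z0" if "\<omega> \<in> space M" for \<omega>
        using that XN nz by (intro lim) auto
    qed
    have "(\<lambda>k. \<integral>\<omega>. Q \<omega> (X (k + N)) \<partial>M) \<longlonglongrightarrow> (\<integral>\<omega>. deriv (F \<omega>) z0 \<partial>M)"
    proof (rule integral_dominated_convergence[where w="\<lambda>_. 1 / r"])
      show "(\<lambda>\<omega>. Q \<omega> (X (k + N))) \<in> borel_measurable M" for k
        using subsetD[OF ballS N] by (rule measQ)
      show "AE \<omega> in M. (\<lambda>k. Q \<omega> (X (k + N))) \<longlonglongrightarrow> deriv (F \<omega>) z0"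
        using XN nz by (intro AE_I2 lim) auto
      show "AE \<omega> in M. norm (Q \<omega> (X (k + N))) \<le> 1 / r" for k
        using N nz by (intro AE_I2 Qbound) auto
    qed (use dm in auto)
    moreover have "(\<integral>\<omega>. Q \<omega> (X (k + N)) \<partial>M) = ((\<integral>\<omega>. F \<omega> (X (k + N)) \<partial>M) - (\<integral>\<omega>. F \<omega> z0 \<partial>M)) / (X (k + N) - z0)" for k
    proof -
      have "X (k + N) \<in> S" using subsetD[OF ballS N] .
      then show ?thesis unfolding Q_def using int z0 by simp
    qed
    ultimately have "(\<lambda>k. ((\<lambda>z. ((\<integral>\<omega>. F \<omega> z \<partial>M) - (\<integral>\<omega>. F \<omega> z0 \<partial>M)) / (z - z0)) \<circ> X) (k + N)) \<longlonglongrightarrow> (\<integral>\<omega>. deriv (F \<omega>) z0 \<partial>M)"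
      by (simp add: o_def)
    then show "((\<lambda>z. ((\<integral>\<omega>. F \<omega> z \<partial>M) - (\<integral>\<omega>. F \<omega> z0 \<partial>M)) / (z - z0)) \<circ> X) \<longlonglongrightarrow> (\<integral>\<omega>. deriv (F \<omega>) z0 \<partial>M)"
      by (rule LIMSEQ_offset)
  qed
  then show "\<exists>f'. ((\<lambda>z. \<integral>\<omega>. F \<omega> z \<partial>M) has_field_derivative f') (at z0)"
    unfolding has_field_derivative_iff by blast
qed

text \<open>The identity theorem: the positive reals accumulate at 1, and the half-plane is
  connected.\<close>

lemma holomorphic_eq_right_half_plane:
  fixes f g :: "complex \<Rightarrow> complex"
  assumes f: "f holomorphic_on {z. Re z > 0}" and g: "g holomorphic_on {z. Re z > 0}"
    and eq: "\<And>t::real. t > 0 \<Longrightarrow> f (of_real t) = g (of_real t)"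
    and z: "Re z > 0"
  shows "f z = g z"
proof -
  have "(\<lambda>z. f z - g z) z = 0"
  proof (rule analytic_continuation[where f="\<lambda>z. f z - g z" and w=z and S="{z. Re z > 0}" and U="of_real ` {0<..}" and \<xi>=1])
    show "(\<lambda>z. f z - g z) holomorphic_on {z. Re z > 0}" using f g by (intro holomorphic_intros)
    show "open {z. Re z > 0}" by (rule open_halfspace_Re_gt)
    show "connected {z. Re z > 0}" by (intro convex_connected convex_halfspace_Re_gt)
    show "(1::complex) islimpt of_real ` {0<..}"
      unfolding islimpt_sequential
    proof (intro exI conjI allI)
      let ?X = "\<lambda>n::nat. complex_of_real (1 + 1 / (real n + 1))"
      show "?X n \<in> of_real ` {0<..} - {1}" for n
      proof
        have "?X n \<noteq> complex_of_real 1" by (simp only: of_real_eq_iff) simp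
        then show "?X n \<notin> {1}" by simp
        show "?X n \<in> of_real ` {0<..}" by (rule imageI) (simp add: add_pos_pos)
      qed
      have "?X \<longlonglongrightarrow> complex_of_real 1"
        by (intro tendsto_of_real) real_asymp
      then show "?X \<longlonglongrightarrow> 1" by simp
    qed
  qed (use z eq in auto)
  then show ?thesis by simp
qed

section \<open>Averaging over the Cauchy matrix\<close>

lemma gauss_component_measurable[measurable]:
  "k < n \<Longrightarrow> (\<lambda>x. x k) \<in> borel_measurable (gauss n)"
  using measurable_component_singleton[of k "{..<n}" "\<lambda>_. std_normal_distribution"] by simp

text \<open>At real t > 0 both sides are the determinant to the power -1/2. Each factor on the left
  is holomorphic because \<open>1 + z r\<close> has positive real part for \<open>r \<ge> 0\<close>;
  on the right the exponent has nonpositive real part, which bounds the integrand by 1.\<close>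

lemma prod_resolvent_eq_gauss:
  fixes B :: "real mat" and a :: real
  assumes B: "B \<in> carrier_mat m n" and a: "a \<ge> 0" and z: "Re z > 0"
  shows "(\<Prod>i=1..n. (1 + z * of_real (a * ordered_eigenvalue (B\<^sup>T * B) i)) powr (-1/2))
    = (\<integral>x. exp (- z * of_real (a * (\<Sum>j<m. (\<Sum>k<n. B $$ (j, k) * x k)\<^sup>2) / 2)) \<partial>gauss n)"
proof -
  define r where "r i = a * ordered_eigenvalue (B\<^sup>T * B) i" for i
  define q where "q x = a * (\<Sum>j<m. (\<Sum>k<n. B $$ (j, k) * x k)\<^sup>2) / 2" for x :: "nat \<Rightarrow> real"
  have r: "r i \<ge> 0" if "i \<in> {1..n}" for i
    using a ordered_eigenvalue_nonneg[OF B that] by (simp add: r_def)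
  have q: "q x \<ge> 0" for x using a by (auto simp: q_def intro!: mult_nonneg_nonneg sum_nonneg)
  have qm[measurable]: "q \<in> borel_measurable (gauss n)" unfolding q_def by measurable
  have "(\<Prod>i=1..n. (1 + z * of_real (r i)) powr (-1/2)) = (\<integral>x. exp (- z * of_real (q x)) \<partial>gauss n)"
  proof (rule holomorphic_eq_right_half_plane[OF _ _ _ z])
    have "1 + z * of_real (r i) \<notin> \<real>\<^sub>\<le>\<^sub>0" if "Re z > 0" "i \<in> {1..n}" for i z
    proof -
      have "Re (1 + z * of_real (r i)) > 0" using that r[OF that(2)] by (simp add: add_pos_nonneg)
      then show ?thesis by (auto simp: complex_nonpos_Reals_iff)
    qed
    then show "(\<lambda>z. \<Prod>i=1..n. (1 + z * of_real (r i)) powr (-1/2)) holomorphic_on {z. Re z > 0}"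
      by (intro holomorphic_intros) auto
    show "(\<lambda>z. \<integral>x. exp (- z * of_real (q x)) \<partial>gauss n) holomorphic_on {z. Re z > 0}"
    proof (rule holomorphic_integral_bounded_family[OF prob_space_gauss])
      show "open {z. Re z > 0}" by (rule open_halfspace_Re_gt)
      show "(\<lambda>z. exp (- z * of_real (q x))) holomorphic_on {z. Re z > 0}" for x
        by (intro holomorphic_intros)
      show "norm (exp (- z * of_real (q x))) \<le> 1" if "z \<in> {z. Re z > 0}" for z x
        using that q[of x] by (simp add: mult_nonneg_nonneg)
    qed auto
    fix t :: real assume t: "t > 0"
    have "(\<Prod>i=1..n. (1 + of_real t * of_real (r i)) powr (-1/2)) = complex_of_real (\<Prod>i=1..n. (1 + t * r i) powr (-1/2))"
      unfolding of_real_prod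
    proof (intro prod.cong refl)
      fix i assume "i \<in> {1..n}"
      then have "0 \<le> 1 + t * r i" using t r[of i] by (simp add: add_nonneg_nonneg)
      then show "(1 + of_real t * of_real (r i)) powr (-1/2) = complex_of_real ((1 + t * r i) powr (-1/2))"
        using powr_of_real[of "1 + t * r i" "-1/2"] by simp
    qed
    \<comment> \<open>Collecting the powers into one power of the determinant is done at real
      arguments; for complex factors the arguments may add up beyond the principal range.\<close>
    also have "(\<Prod>i=1..n. (1 + t * r i) powr (-1/2)) = (\<Prod>i=1..n. (1 + t * r i)) powr (-1/2)"
      by (rule prod_powr_distrib[symmetric])
    also have "(\<Prod>i=1..n. (1 + t * r i)) = Determinant.det (1\<^sub>m n + (t * a) \<cdot>\<^sub>m (B\<^sup>T * B))"
      by (simp add: det_gram[OF B] r_def mult.assoc)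
    also have "\<dots> powr (-1/2) = (\<integral>x. exp (- t * q x) \<partial>gauss n)"
      using gauss_det(2)[OF B, of "t * a"] t a by (simp add: q_def mult.assoc)
    also have "complex_of_real \<dots> = (\<integral>x. exp (- of_real t * of_real (q x)) \<partial>gauss n)"
      by (subst integral_complex_of_real[symmetric]) (simp add: exp_of_real[symmetric])
    finally show "(\<Prod>i=1..n. (1 + of_real t * of_real (r i)) powr (-1/2)) = (\<integral>x. exp (- complex_of_real t * of_real (q x)) \<partial>gauss n)" .
  qed
  then show ?thesis by (simp add: r_def q_def)
qed

lemma cauchy_matrixD:
  assumes "cauchy_random_matrix M m n A"
  shows "prob_space M" and "\<And>\<omega>. \<omega> \<in> space M \<Longrightarrow> A \<omega> \<in> carrier_mat m n"
    and "\<And>j k. j < m \<Longrightarrow> k < n \<Longrightarrow> (\<lambda>\<omega>. A \<omega> $$ (j, k)) \<in> borel_measurable M"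
    and "\<And>j k. j < m \<Longrightarrow> k < n \<Longrightarrow> distributed M lborel (\<lambda>\<omega>. A \<omega> $$ (j, k)) (\<lambda>x. ennreal (cauchy_density x))"
    and "prob_space.indep_vars M (\<lambda>_. borel) (\<lambda>(j, k) \<omega>. A \<omega> $$ (j, k)) ({..<m} \<times> {..<n})"
  using assms unfolding cauchy_random_matrix_def distributed_def by auto

text \<open>Independence over the index pairs factors the expectation into one-dimensional
  characteristic functions, whose exponents add.\<close>

lemma cauchy_matrix_char:
  assumes A: "cauchy_random_matrix M m n A"
  shows "(\<integral>\<omega>. exp (\<i> * of_real (\<Sum>j<m. \<Sum>k<n. c j k * A \<omega> $$ (j, k))) \<partial>M)
    = complex_of_real (exp (- (\<Sum>j<m. \<Sum>k<n. \<bar>c j k\<bar>)))"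
proof -
  interpret prob_space M by (rule cauchy_matrixD(1)[OF A])
  let ?I = "{..<m} \<times> {..<n}"
  let ?X = "\<lambda>p \<omega>. exp (\<i> * of_real (case_prod c p * A \<omega> $$ p))"
  have em[measurable]: "(\<lambda>x. exp (\<i> * complex_of_real (s * x))) \<in> borel_measurable borel" for s
    by (intro borel_measurable_continuous_onI continuous_intros)
  have am: "(\<lambda>\<omega>. A \<omega> $$ p) \<in> borel_measurable M" if "p \<in> ?I" for p
    using that cauchy_matrixD(3)[OF A] by auto
  have "indep_vars (\<lambda>_. borel) (\<lambda>p \<omega>. (\<lambda>x. exp (\<i> * complex_of_real (case_prod c p * x))) ((\<lambda>(j, k) \<omega>. A \<omega> $$ (j, k)) p \<omega>)) ?I"
    by (rule indep_vars_compose2[OF cauchy_matrixD(5)[OF A]]) (rule em)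
  then have ind: "indep_vars (\<lambda>_. borel) ?X ?I" by (simp add: case_prod_beta)
  have Xint: "integrable M (?X p)" if "p \<in> ?I" for p
    using measurable_compose[OF am[OF that] em] by (intro integrable_const_bound[of _ 1]) auto
  have "(\<integral>\<omega>. exp (\<i> * of_real (\<Sum>j<m. \<Sum>k<n. c j k * A \<omega> $$ (j, k))) \<partial>M) = (\<integral>\<omega>. (\<Prod>p\<in>?I. ?X p \<omega>) \<partial>M)"
    by (intro Bochner_Integration.integral_cong refl)
      (simp add: sum.cartesian_product exp_sum[symmetric] sum_distrib_left case_prod_beta)
  also have "\<dots> = (\<Prod>p\<in>?I. \<integral>\<omega>. ?X p \<omega> \<partial>M)"
    by (rule indep_vars_lebesgue_integral) (use ind Xint in auto)
  also have "\<dots> = (\<Prod>p\<in>?I. complex_of_real (exp (- \<bar>case_prod c p\<bar>)))"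
  proof (intro prod.cong refl)
    fix p assume p: "p \<in> ?I"
    then obtain j k where jk: "p = (j, k)" "j < m" "k < n" by auto
    have "(\<integral>\<omega>. ?X p \<omega> \<partial>M) = (\<integral>x. exp (\<i> * of_real (case_prod c p * x)) \<partial>distr M lborel (\<lambda>\<omega>. A \<omega> $$ p))"
      using am[OF p] by (subst integral_distr) auto
    also have "distr M lborel (\<lambda>\<omega>. A \<omega> $$ p) = density lborel (\<lambda>x. ennreal (cauchy_density x))"
      using cauchy_matrixD(4)[OF A jk(2,3)] jk(1) by (simp add: distributed_def)
    also have "(\<integral>x. exp (\<i> * of_real (case_prod c p * x)) \<partial>density lborel (\<lambda>x. ennreal (cauchy_density x)))
      = (\<integral>x. cauchy_density x *\<^sub>R exp (\<i> * of_real (case_prod c p * x)) \<partial>lborel)"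
      using integrable_cauchy_density by (intro integral_density) (auto simp: cauchy_density_def)
    also have "\<dots> = complex_of_real (exp (- \<bar>case_prod c p\<bar>))"
      unfolding scaleR_conv_of_real by (rule cauchy_char)
    finally show "(\<integral>\<omega>. ?X p \<omega> \<partial>M) = complex_of_real (exp (- \<bar>case_prod c p\<bar>))" .
  qed
  also have "\<dots> = complex_of_real (exp (- (\<Sum>j<m. \<Sum>k<n. \<bar>c j k\<bar>)))"
    by (simp add: sum.cartesian_product exp_sum[symmetric] case_prod_beta flip: sum_negf of_real_prod)
  finally show ?thesis .
qed

text \<open>For fixed \<open>x\<close>, each factor exp (- u^2 / 2), with u being t times a row sum,
  is the characteristic function of a standard normal variable at u. The integrand then has modulus
  1, so the order of integration may be exchanged, and \<open>A\<close> enters linearly.\<close>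

lemma cauchy_matrix_gauss:
  assumes A: "cauchy_random_matrix M m n A" and t: "t \<ge> 0"
  shows "(\<integral>\<omega>. exp (- t\<^sup>2 * (\<Sum>j<m. (\<Sum>k<n. A \<omega> $$ (j, k) * x k)\<^sup>2) / 2) \<partial>M)
    = (\<integral>y. exp (- t * ((\<Sum>j<m. \<bar>y j\<bar>) * (\<Sum>k<n. \<bar>x k\<bar>))) \<partial>gauss m)"
proof -
  note M = cauchy_matrixD(1)[OF A]
  note am[measurable] = cauchy_matrixD(3)[OF A]
  define s where "s \<omega> j = (\<Sum>k<n. A \<omega> $$ (j, k) * x k)" for \<omega> j
  have sm[measurable]: "(\<lambda>\<omega>. s \<omega> j) \<in> borel_measurable M" if "j < m" for j
    unfolding s_def using that by (intro borel_measurable_sum borel_measurable_times am) auto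
  have em[measurable]: "(\<lambda>x. exp (\<i> * complex_of_real x)) \<in> borel_measurable borel"
    by (intro borel_measurable_continuous_onI continuous_intros)
  have "complex_of_real (\<integral>\<omega>. exp (- t\<^sup>2 * (\<Sum>j<m. (s \<omega> j)\<^sup>2) / 2) \<partial>M)
     = (\<integral>\<omega>. complex_of_real (exp (- t\<^sup>2 * (\<Sum>j<m. (s \<omega> j)\<^sup>2) / 2)) \<partial>M)"
    by (rule integral_complex_of_real[symmetric])
  also have "\<dots> = (\<integral>\<omega>. (\<integral>y. exp (\<i> * of_real (\<Sum>j<m. t * s \<omega> j * y j)) \<partial>gauss m) \<partial>M)"
  proof (intro Bochner_Integration.integral_cong refl)
    fix \<omega>
    have "complex_of_real (exp (- t\<^sup>2 * (\<Sum>j<m. (s \<omega> j)\<^sup>2) / 2)) = (\<Prod>j<m. complex_of_real (exp (- (t * s \<omega> j)\<^sup>2 / 2)))"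
      by (simp add: exp_sum[symmetric] sum_negf sum_distrib_left sum_divide_distrib power_mult_distrib flip: of_real_prod)
    also have "\<dots> = (\<Prod>j<m. \<integral>y. exp (\<i> * of_real (t * s \<omega> j * y)) \<partial>std_normal_distribution)"
    proof (intro prod.cong refl)
      fix j
      show "complex_of_real (exp (- (t * s \<omega> j)\<^sup>2 / 2)) = (\<integral>y. exp (\<i> * of_real (t * s \<omega> j * y)) \<partial>std_normal_distribution)"
        using fun_cong[OF char_std_normal_distribution, of "t * s \<omega> j"] unfolding char_def by simp
    qed
    also have "\<dots> = (\<integral>y. (\<Prod>j<m. exp (\<i> * of_real (t * s \<omega> j * y j))) \<partial>gauss m)"
    proof (rule gauss.product_integral_prod[symmetric])
      fix j
      show "integrable std_normal_distribution (\<lambda>y. exp (\<i> * of_real (t * s \<omega> j * y)))"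
        by (intro finite_measure.integrable_const_bound[of _ _ 1] prob_space.finite_measure prob_space_std_normal) auto
    qed simp
    also have "\<dots> = (\<integral>y. exp (\<i> * of_real (\<Sum>j<m. t * s \<omega> j * y j)) \<partial>gauss m)"
      by (simp add: exp_sum[symmetric] sum_distrib_left)
    finally show "complex_of_real (exp (- t\<^sup>2 * (\<Sum>j<m. (s \<omega> j)\<^sup>2) / 2)) = (\<integral>y. exp (\<i> * of_real (\<Sum>j<m. t * s \<omega> j * y j)) \<partial>gauss m)" .
  qed
  also have "\<dots> = (\<integral>y. (\<integral>\<omega>. exp (\<i> * of_real (\<Sum>j<m. t * s \<omega> j * y j)) \<partial>M) \<partial>gauss m)"
  proof (rule pair_sigma_finite.Fubini_integral[OF pair_sigma_finite_prob_space[OF M prob_space_gauss], symmetric])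
    have "(\<lambda>p. \<Sum>j<m. t * s (fst p) j * snd p j) \<in> borel_measurable (M \<Otimes>\<^sub>M gauss m)"
      by (intro borel_measurable_sum borel_measurable_times borel_measurable_const
          measurable_compose[OF measurable_fst sm] measurable_compose[OF measurable_snd gauss_component_measurable]) auto
    then have "(\<lambda>p. exp (\<i> * of_real (\<Sum>j<m. t * s (fst p) j * snd p j))) \<in> borel_measurable (M \<Otimes>\<^sub>M gauss m)"
      by (rule measurable_compose[OF _ em])
    then show "integrable (M \<Otimes>\<^sub>M gauss m) (\<lambda>(\<omega>, y). exp (\<i> * of_real (\<Sum>j<m. t * s \<omega> j * y j)))"
      by (intro prob_space_integrable_bound[OF prob_space_pair[OF M prob_space_gauss], of _ 1]) (auto simp: case_prod_beta)
  qed
  also have "\<dots> = (\<integral>y. complex_of_real (exp (- t * ((\<Sum>j<m. \<bar>y j\<bar>) * (\<Sum>k<n. \<bar>x k\<bar>)))) \<partial>gauss m)"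
  proof (intro Bochner_Integration.integral_cong refl)
    fix y :: "nat \<Rightarrow> real"
    have "(\<Sum>j<m. t * s \<omega> j * y j) = (\<Sum>j<m. \<Sum>k<n. (t * y j * x k) * A \<omega> $$ (j, k))" for \<omega>
      by (simp add: s_def sum_distrib_left sum_distrib_right mult_ac)
    \<comment> \<open>The coefficients have rank one, which is why the sum of their absolute values
      is a product.\<close>
    moreover have "(\<Sum>j<m. \<Sum>k<n. \<bar>t * y j * x k\<bar>) = t * ((\<Sum>j<m. \<bar>y j\<bar>) * (\<Sum>k<n. \<bar>x k\<bar>))"
      using t by (simp add: sum_product sum_distrib_left abs_mult mult_ac)
    ultimately show "(\<integral>\<omega>. exp (\<i> * of_real (\<Sum>j<m. t * s \<omega> j * y j)) \<partial>M) = complex_of_real (exp (- t * ((\<Sum>j<m. \<bar>y j\<bar>) * (\<Sum>k<n. \<bar>x k\<bar>))))"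
      using cauchy_matrix_char[OF A, of "\<lambda>j k. t * y j * x k"] by simp
  qed
  also have "\<dots> = complex_of_real (\<integral>y. exp (- t * ((\<Sum>j<m. \<bar>y j\<bar>) * (\<Sum>k<n. \<bar>x k\<bar>))) \<partial>gauss m)"
    by (rule integral_complex_of_real)
  finally show ?thesis by (simp only: of_real_eq_iff s_def)
qed

text \<open>The variable W on pairs of Gaussian vectors: the first component is the n-vector from
  the determinant, the second the m-vector from the linearisation.\<close>

definition mean_abs_prod :: "nat \<Rightarrow> nat \<Rightarrow> (nat \<Rightarrow> real) \<times> (nat \<Rightarrow> real) \<Rightarrow> real" where
  "mean_abs_prod m n p = ((\<Sum>j<m. \<bar>snd p j\<bar>) / real m) * ((\<Sum>k<n. \<bar>fst p k\<bar>) / real n)"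

lemma mean_abs_prod_measurable[measurable]: "mean_abs_prod m n \<in> borel_measurable (gauss n \<Otimes>\<^sub>M gauss m)"
  unfolding mean_abs_prod_def by measurable

lemma mean_abs_prod_nonneg: "mean_abs_prod m n p \<ge> 0"
  by (auto simp: mean_abs_prod_def intro!: mult_nonneg_nonneg divide_nonneg_nonneg sum_nonneg)

text \<open>The normalisation of the eigenvalues is absorbed into \<open>u = t / (m n)\<close>,
  which turns the two sums of absolute values into means.\<close>

lemma expectation_prod_resolvent_real:
  assumes A: "cauchy_random_matrix M m n A" and t: "t \<ge> 0" and mn: "m \<ge> 1" "n \<ge> 1"
  shows "(\<integral>\<omega>. (\<integral>x. exp (- t\<^sup>2 * (1 / (real m ^ 2 * real n ^ 2) * (\<Sum>j<m. (\<Sum>k<n. A \<omega> $$ (j, k) * x k)\<^sup>2) / 2)) \<partial>gauss n) \<partial>M)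
    = (\<integral>p. exp (- t * mean_abs_prod m n p) \<partial>(gauss n \<Otimes>\<^sub>M gauss m))"
proof -
  note M = cauchy_matrixD(1)[OF A]
  note am[measurable] = cauchy_matrixD(3)[OF A]
  define u where "u = t / (real m * real n)"
  have u: "u \<ge> 0" using t by (simp add: u_def)
  have tu: "t\<^sup>2 * (1 / (real m ^ 2 * real n ^ 2) * q / 2) = u\<^sup>2 * q / 2" for q
    by (simp add: u_def power_divide power_mult_distrib)
  have "(\<integral>\<omega>. (\<integral>x. exp (- t\<^sup>2 * (1 / (real m ^ 2 * real n ^ 2) * (\<Sum>j<m. (\<Sum>k<n. A \<omega> $$ (j, k) * x k)\<^sup>2) / 2)) \<partial>gauss n) \<partial>M)
     = (\<integral>\<omega>. (\<integral>x. exp (- u\<^sup>2 * (\<Sum>j<m. (\<Sum>k<n. A \<omega> $$ (j, k) * x k)\<^sup>2) / 2) \<partial>gauss n) \<partial>M)"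
    by (simp only: minus_mult_left[symmetric] minus_divide_left[symmetric] tu)
  also have "\<dots> = (\<integral>x. (\<integral>\<omega>. exp (- u\<^sup>2 * (\<Sum>j<m. (\<Sum>k<n. A \<omega> $$ (j, k) * x k)\<^sup>2) / 2) \<partial>M) \<partial>gauss n)"
  proof (rule pair_sigma_finite.Fubini_integral[OF pair_sigma_finite_prob_space[OF M prob_space_gauss], symmetric])
    have "(\<lambda>p. \<Sum>j<m. (\<Sum>k<n. A (fst p) $$ (j, k) * snd p k)\<^sup>2) \<in> borel_measurable (M \<Otimes>\<^sub>M gauss n)"
      by (intro borel_measurable_sum borel_measurable_power borel_measurable_times
          measurable_compose[OF measurable_fst am] measurable_compose[OF measurable_snd gauss_component_measurable]) auto
    then have "(\<lambda>p. exp (- u\<^sup>2 * (\<Sum>j<m. (\<Sum>k<n. A (fst p) $$ (j, k) * snd p k)\<^sup>2) / 2)) \<in> borel_measurable (M \<Otimes>\<^sub>M gauss n)"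
      by measurable
    then show "integrable (M \<Otimes>\<^sub>M gauss n) (\<lambda>(\<omega>, x). exp (- u\<^sup>2 * (\<Sum>j<m. (\<Sum>k<n. A \<omega> $$ (j, k) * x k)\<^sup>2) / 2))"
      unfolding case_prod_beta
      by (rule prob_space_integrable_bound[OF prob_space_pair[OF M prob_space_gauss], of _ 1, rotated]) (intro AE_I2, simp add: sum_nonneg)
  qed
  also have "\<dots> = (\<integral>x. (\<integral>y. exp (- u * ((\<Sum>j<m. \<bar>y j\<bar>) * (\<Sum>k<n. \<bar>x k\<bar>))) \<partial>gauss m) \<partial>gauss n)"
    by (simp only: cauchy_matrix_gauss[OF A u])
  also have "\<dots> = (\<integral>x. (\<integral>y. exp (- t * mean_abs_prod m n (x, y)) \<partial>gauss m) \<partial>gauss n)"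
    by (simp add: u_def mean_abs_prod_def)
  also have "\<dots> = (\<integral>p. exp (- t * mean_abs_prod m n p) \<partial>(gauss n \<Otimes>\<^sub>M gauss m))"
  proof (rule pair_sigma_finite.integral_fst'[OF pair_sigma_finite_prob_space[OF prob_space_gauss prob_space_gauss]])
    show "integrable (gauss n \<Otimes>\<^sub>M gauss m) (\<lambda>p. exp (- t * mean_abs_prod m n p))"
      by (intro prob_space_integrable_bound[OF prob_space_gauss_pair, of _ 1]) (use t mean_abs_prod_nonneg in \<open>auto\<close>)
  qed
  finally show ?thesis .
qed

text \<open>A second continuation, now after averaging over the matrix. The real identity involves t
  with z = t^2, so its continuation carries \<open>csqrt z\<close>; since this root has nonnegative
  real part and W is nonnegative, the integrand stays bounded by 1.\<close>

lemma expectation_prod_resolvent: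
  assumes A: "cauchy_random_matrix M m n A" and mn: "m \<ge> 1" "n \<ge> 1" and z: "Re z > 0"
  shows "(\<integral>\<omega>. (\<Prod>i=1..n. (1 + z * complex_of_real (scaled_eigenvalue m n (A \<omega>) i)) powr (-1/2)) \<partial>M)
    = (\<integral>p. exp (- csqrt z * of_real (mean_abs_prod m n p)) \<partial>(gauss n \<Otimes>\<^sub>M gauss m))"
proof -
  note M = cauchy_matrixD(1)[OF A]
  note am[measurable] = cauchy_matrixD(3)[OF A]
  define q where "q \<omega> x = 1 / (real m ^ 2 * real n ^ 2) * (\<Sum>j<m. (\<Sum>k<n. A \<omega> $$ (j, k) * x k)\<^sup>2) / 2" for \<omega> and x :: "nat \<Rightarrow> real"
  have q: "q \<omega> x \<ge> 0" for \<omega> x by (auto simp: q_def intro!: mult_nonneg_nonneg divide_nonneg_nonneg sum_nonneg)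
  have qm: "(\<lambda>p. q (fst p) (snd p)) \<in> borel_measurable (M \<Otimes>\<^sub>M gauss n)"
    unfolding q_def
    by (intro borel_measurable_sum borel_measurable_power borel_measurable_times borel_measurable_divide borel_measurable_const
          measurable_compose[OF measurable_fst am] measurable_compose[OF measurable_snd gauss_component_measurable]) auto
  have cm: "(\<lambda>x. exp (- z * complex_of_real x)) \<in> borel_measurable borel" for z
    by (intro borel_measurable_continuous_onI continuous_intros)
  have eq: "(\<integral>\<omega>. (\<Prod>i=1..n. (1 + z * complex_of_real (scaled_eigenvalue m n (A \<omega>) i)) powr (-1/2)) \<partial>M)
    = (\<integral>\<omega>. (\<integral>x. exp (- z * of_real (q \<omega> x)) \<partial>gauss n) \<partial>M)" if z: "Re z > 0" for z
  proof (intro Bochner_Integration.integral_cong refl)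
    fix \<omega> assume "\<omega> \<in> space M"
    note B = cauchy_matrixD(2)[OF A this]
    show "(\<Prod>i=1..n. (1 + z * complex_of_real (scaled_eigenvalue m n (A \<omega>) i)) powr (-1/2)) = (\<integral>x. exp (- z * of_real (q \<omega> x)) \<partial>gauss n)"
      using prod_resolvent_eq_gauss[OF B _ z, of "1 / (real m ^ 2 * real n ^ 2)"]
      by (simp add: q_def scaled_eigenvalue_def)
  qed
  \<comment> \<open>A single integral over the product space lets holomorphy be obtained in one step
    from the bounded family.\<close>
  have pair: "(\<integral>\<omega>. (\<integral>x. exp (- z * of_real (q \<omega> x)) \<partial>gauss n) \<partial>M) = (\<integral>p. exp (- z * of_real (q (fst p) (snd p))) \<partial>(M \<Otimes>\<^sub>M gauss n))"
    if z: "Re z > 0" for z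
  proof -
    have "integrable (M \<Otimes>\<^sub>M gauss n) (\<lambda>p. exp (- z * of_real (q (fst p) (snd p))))"
      by (intro prob_space_integrable_bound[OF prob_space_pair[OF M prob_space_gauss], of _ 1] measurable_compose[OF qm cm]) (use z q in auto)
    from pair_sigma_finite.integral_fst'[OF pair_sigma_finite_prob_space[OF M prob_space_gauss] this] show ?thesis by simp
  qed
  have "(\<integral>p. exp (- z * of_real (q (fst p) (snd p))) \<partial>(M \<Otimes>\<^sub>M gauss n))
    = (\<integral>p. exp (- csqrt z * of_real (mean_abs_prod m n p)) \<partial>(gauss n \<Otimes>\<^sub>M gauss m))"
  proof (rule holomorphic_eq_right_half_plane[OF _ _ _ z])
    show "(\<lambda>z. \<integral>p. exp (- z * of_real (q (fst p) (snd p))) \<partial>(M \<Otimes>\<^sub>M gauss n)) holomorphic_on {z. Re z > 0}"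
    proof (rule holomorphic_integral_bounded_family[OF prob_space_pair[OF M prob_space_gauss]])
      show "open {z. Re z > 0}" by (rule open_halfspace_Re_gt)
      show "(\<lambda>z. exp (- z * of_real (q (fst p) (snd p)))) holomorphic_on {z. Re z > 0}" for p
        by (intro holomorphic_intros)
      show "norm (exp (- z * of_real (q (fst p) (snd p)))) \<le> 1" if "z \<in> {z. Re z > 0}" for z p
        using that q by simp
      show "(\<lambda>p. exp (- z * complex_of_real (q (fst p) (snd p)))) \<in> borel_measurable (M \<Otimes>\<^sub>M gauss n)" for z
        by (rule measurable_compose[OF qm cm])
    qed
    show "(\<lambda>z. \<integral>p. exp (- csqrt z * of_real (mean_abs_prod m n p)) \<partial>(gauss n \<Otimes>\<^sub>M gauss m)) holomorphic_on {z. Re z > 0}"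
    proof (rule holomorphic_integral_bounded_family[OF prob_space_gauss_pair])
      show "open {z. Re z > 0}" by (rule open_halfspace_Re_gt)
      show "(\<lambda>z. exp (- csqrt z * of_real (mean_abs_prod m n p))) holomorphic_on {z. Re z > 0}" for p
        by (intro holomorphic_intros) (auto simp: complex_nonpos_Reals_iff)
      show "norm (exp (- csqrt z * of_real (mean_abs_prod m n p))) \<le> 1" if "z \<in> {z. Re z > 0}" for z p
        using Re_csqrt[of z] mean_abs_prod_nonneg[of m n p] by simp
      show "(\<lambda>p. exp (- csqrt z * of_real (mean_abs_prod m n p))) \<in> borel_measurable (gauss n \<Otimes>\<^sub>M gauss m)" for z
        by (rule measurable_compose[OF mean_abs_prod_measurable cm])
    qed
    \<comment> \<open>The real identity is applied with \<open>sqrt s\<close> in place of t.\<close>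
    fix s :: real assume s: "s > 0"
    have "(\<integral>p. exp (- of_real s * of_real (q (fst p) (snd p))) \<partial>(M \<Otimes>\<^sub>M gauss n))
       = (\<integral>\<omega>. (\<integral>x. complex_of_real (exp (- s * q \<omega> x)) \<partial>gauss n) \<partial>M)"
      using pair[of "of_real s"] s by (simp add: exp_of_real[symmetric])
    also have "\<dots> = complex_of_real (\<integral>\<omega>. (\<integral>x. exp (- (sqrt s)\<^sup>2 * q \<omega> x) \<partial>gauss n) \<partial>M)"
      using s by simp
    also have "(\<integral>\<omega>. (\<integral>x. exp (- (sqrt s)\<^sup>2 * q \<omega> x) \<partial>gauss n) \<partial>M) = (\<integral>p. exp (- sqrt s * mean_abs_prod m n p) \<partial>(gauss n \<Otimes>\<^sub>M gauss m))"
      unfolding q_def by (rule expectation_prod_resolvent_real[OF A _ mn]) (use s in simp)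
    also have "complex_of_real \<dots> = (\<integral>p. exp (- csqrt (of_real s) * of_real (mean_abs_prod m n p)) \<partial>(gauss n \<Otimes>\<^sub>M gauss m))"
      using s by (subst integral_complex_of_real[symmetric]) (simp add: exp_of_real[symmetric] csqrt_of_real_nonneg)
    finally show "(\<integral>p. exp (- complex_of_real s * of_real (q (fst p) (snd p))) \<partial>(M \<Otimes>\<^sub>M gauss n))
       = (\<integral>p. exp (- csqrt (of_real s) * of_real (mean_abs_prod m n p)) \<partial>(gauss n \<Otimes>\<^sub>M gauss m))" .
  qed
  then show ?thesis using eq[OF z] pair[OF z] by simp
qed

section \<open>Moments and Laplace transform of the product of means\<close>

text \<open>\<open>c\<close> is the first absolute moment of the standard normal law, so centring by
  it leaves mean 0 and variance \<open>1 - c^2\<close>.\<close>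

lemma gauss_abs_centered_moments:
  defines "c \<equiv> sqrt (2 / pi)"
  shows "integrable std_normal_distribution (\<lambda>y. \<bar>y\<bar> - c)"
    and "(\<integral>y. \<bar>y\<bar> - c \<partial>std_normal_distribution) = 0"
    and "integrable std_normal_distribution (\<lambda>y. (\<bar>y\<bar> - c)\<^sup>2)"
    and "(\<integral>y. (\<bar>y\<bar> - c)\<^sup>2 \<partial>std_normal_distribution) = 1 - c\<^sup>2"
proof -
  interpret N: prob_space std_normal_distribution by (rule prob_space_std_normal)
  have a1: "has_bochner_integral lborel (\<lambda>x. std_normal_density x * \<bar>x\<bar>) c"
    using std_normal_moment_abs_odd[of 0] by (simp add: c_def)
  have a2: "has_bochner_integral lborel (\<lambda>x. std_normal_density x * x\<^sup>2) 1"
    using std_normal_moment_even[of 1] by simp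
  have i1: "integrable std_normal_distribution (\<lambda>y. \<bar>y\<bar>)" and e1: "(\<integral>y. \<bar>y\<bar> \<partial>std_normal_distribution) = c"
    using a1 by (auto simp: has_bochner_integral_iff integrable_density integral_density)
  have i2: "integrable std_normal_distribution (\<lambda>y. y\<^sup>2)" and e2: "(\<integral>y. y\<^sup>2 \<partial>std_normal_distribution) = 1"
    using a2 by (auto simp: has_bochner_integral_iff integrable_density integral_density)
  show "integrable std_normal_distribution (\<lambda>y. \<bar>y\<bar> - c)" using i1 by simp
  show "(\<integral>y. \<bar>y\<bar> - c \<partial>std_normal_distribution) = 0" using i1 e1 N.prob_space by simp
  have sq: "(\<bar>y\<bar> - c)\<^sup>2 = y\<^sup>2 - 2 * c * \<bar>y\<bar> + c\<^sup>2" for y :: real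
    by (simp add: power2_diff)
  show "integrable std_normal_distribution (\<lambda>y. (\<bar>y\<bar> - c)\<^sup>2)" unfolding sq using i1 i2 by simp
  show "(\<integral>y. (\<bar>y\<bar> - c)\<^sup>2 \<partial>std_normal_distribution) = 1 - c\<^sup>2"
    unfolding sq using i1 i2 e1 e2 N.prob_space by (simp add: power2_eq_square)
qed

definition centered_mean_abs :: "nat \<Rightarrow> (nat \<Rightarrow> real) \<Rightarrow> real" where
  "centered_mean_abs m y = (\<Sum>j<m. \<bar>y j\<bar>) / real m - sqrt (2 / pi)"

text \<open>Distinct coordinates are independent and centred, so only the diagonal terms of the
  squared sum survive; the variance is that of one summand divided by m, and the former is at most
  1.\<close>

lemma centered_mean_abs_moments:
  assumes m: "m \<ge> 1"
  shows "integrable (gauss m) (centered_mean_abs m)"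
    and "(\<integral>y. centered_mean_abs m y \<partial>gauss m) = 0"
    and "integrable (gauss m) (\<lambda>y. (centered_mean_abs m y)\<^sup>2)"
    and "(\<integral>y. (centered_mean_abs m y)\<^sup>2 \<partial>gauss m) \<le> 1 / real m"
proof -
  interpret N: prob_space std_normal_distribution by (rule prob_space_std_normal)
  define g where "g y = \<bar>y\<bar> - sqrt (2 / pi)" for y :: real
  define v where "v = 1 - (sqrt (2 / pi))\<^sup>2"
  note gm = gauss_abs_centered_moments[folded g_def v_def]
  have V: "centered_mean_abs m y = (\<Sum>j<m. g (y j)) / real m" for y
    using m by (simp add: centered_mean_abs_def g_def sum_subtractf field_simps)
  have one: "integrable (gauss m) (\<lambda>y. g (y j)) \<and> (\<integral>y. g (y j) \<partial>gauss m) = 0" if j: "j < m" for j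
  proof -
    \<comment> \<open>The constant 1 at all other coordinates presents a function of one coordinate
      as a product over all of them.\<close>
    let ?f = "\<lambda>i. if i = j then g else (\<lambda>_. 1)"
    have int: "integrable std_normal_distribution (?f i)" for i
      using gm(1) by simp
    have p: "(\<Prod>i<m. ?f i (y i)) = g (y j)" for y
      using j by (simp add: if_distrib[of "\<lambda>h. h _"] prod.delta cong: if_cong)
    have z: "(\<Prod>i<m. \<integral>x. ?f i x \<partial>std_normal_distribution) = 0"
      using j gm(2) by (intro prod_zero) auto
    show ?thesis
      using gauss.product_integrable_prod[of "{..<m}" ?f, OF _ int] gauss.product_integral_prod[of "{..<m}" ?f, OF _ int] z
      unfolding p by simp
  qed
  have two: "integrable (gauss m) (\<lambda>y. g (y j) * g (y k)) \<and> (\<integral>y. g (y j) * g (y k) \<partial>gauss m) = (if j = k then v else 0)"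
    if j: "j < m" and k: "k < m" for j k
  proof -
    \<comment> \<open>The two conditional factors cover both cases: they produce the square when
      \<open>j = k\<close>, and two separate centred factors otherwise.\<close>
    let ?f = "\<lambda>i x. (if i = j then g x else 1) * (if i = k then g x else 1)"
    have int: "integrable std_normal_distribution (?f i)" for i
      using gm(1,3) by (cases "i = j"; cases "i = k") (auto simp: power2_eq_square)
    have p: "(\<Prod>i<m. ?f i (y i)) = g (y j) * g (y k)" for y
      using j k by (simp add: prod.distrib prod.delta)
    have z: "(\<Prod>i<m. \<integral>x. ?f i x \<partial>std_normal_distribution) = (if j = k then v else 0)"
    proof (cases "j = k")
      case True
      then have "(\<Prod>i<m. \<integral>x. ?f i x \<partial>std_normal_distribution) = (\<Prod>i<m. if i = j then v else 1)"
        using gm(4) N.prob_space by (intro prod.cong refl) (auto simp: power2_eq_square)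
      then show ?thesis using True j by simp
    next
      case False
      then show ?thesis using j gm(2) by (intro trans[OF prod_zero]) (auto intro!: bexI[of _ j])
    qed
    show ?thesis
      using gauss.product_integrable_prod[of "{..<m}" ?f, OF _ int] gauss.product_integral_prod[of "{..<m}" ?f, OF _ int] z
      unfolding p by simp
  qed
  have i1: "integrable (gauss m) (\<lambda>y. \<Sum>j<m. g (y j))" using one by (intro Bochner_Integration.integrable_sum) auto
  then show "integrable (gauss m) (centered_mean_abs m)" unfolding V[abs_def] by simp
  have "(\<integral>y. (\<Sum>j<m. g (y j)) \<partial>gauss m) = 0" using one by (subst Bochner_Integration.integral_sum) auto
  then show "(\<integral>y. centered_mean_abs m y \<partial>gauss m) = 0" unfolding V by simp
  have sq: "(centered_mean_abs m y)\<^sup>2 = (\<Sum>j<m. \<Sum>k<m. g (y j) * g (y k)) / (real m)\<^sup>2" for y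
    unfolding V by (simp add: power_divide power2_eq_square sum_product)
  have i2: "integrable (gauss m) (\<lambda>y. \<Sum>j<m. \<Sum>k<m. g (y j) * g (y k))"
    using two by (intro Bochner_Integration.integrable_sum) auto
  then show "integrable (gauss m) (\<lambda>y. (centered_mean_abs m y)\<^sup>2)" unfolding sq by simp
  have "(\<integral>y. (\<Sum>j<m. \<Sum>k<m. g (y j) * g (y k)) \<partial>gauss m) = (\<Sum>j<m. \<Sum>k<m. if j = k then v else 0)"
  proof -
    have "(\<integral>y. (\<Sum>j<m. \<Sum>k<m. g (y j) * g (y k)) \<partial>gauss m) = (\<Sum>j<m. \<integral>y. (\<Sum>k<m. g (y j) * g (y k)) \<partial>gauss m)"
      using two by (intro Bochner_Integration.integral_sum Bochner_Integration.integrable_sum) auto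
    also have "\<dots> = (\<Sum>j<m. \<Sum>k<m. \<integral>y. g (y j) * g (y k) \<partial>gauss m)"
      using two by (intro sum.cong refl Bochner_Integration.integral_sum) auto
    finally show ?thesis using two by simp
  qed
  also have "\<dots> = real m * v" by simp
  finally have "(\<integral>y. (centered_mean_abs m y)\<^sup>2 \<partial>gauss m) = v / real m"
    unfolding sq using m by (simp add: power2_eq_square)
  also have "\<dots> \<le> 1 / real m" by (intro divide_right_mono) (auto simp: v_def)
  finally show "(\<integral>y. (centered_mean_abs m y)\<^sup>2 \<partial>gauss m) \<le> 1 / real m" .
qed

lemma (in pair_sigma_finite) integrable_integral_fst_times_snd:
  fixes f :: "'a \<Rightarrow> real" and g :: "'b \<Rightarrow> real"
  assumes f: "integrable M1 f" and g: "integrable M2 g"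
  shows "integrable (M1 \<Otimes>\<^sub>M M2) (\<lambda>p. f (fst p) * g (snd p))"
    and "(\<integral>p. f (fst p) * g (snd p) \<partial>(M1 \<Otimes>\<^sub>M M2)) = (\<integral>x. f x \<partial>M1) * (\<integral>y. g y \<partial>M2)"
proof -
  note [measurable] = borel_measurable_integrable[OF f] borel_measurable_integrable[OF g]
  show int: "integrable (M1 \<Otimes>\<^sub>M M2) (\<lambda>p. f (fst p) * g (snd p))"
  proof (rule Fubini_integrable)
    show "(\<lambda>p. f (fst p) * g (snd p)) \<in> borel_measurable (M1 \<Otimes>\<^sub>M M2)" by measurable
  qed (use f g in \<open>auto simp: abs_mult\<close>)
  show "(\<integral>p. f (fst p) * g (snd p) \<partial>(M1 \<Otimes>\<^sub>M M2)) = (\<integral>x. f x \<partial>M1) * (\<integral>y. g y \<partial>M2)"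
    using integral_fst'[OF int] by simp
qed

text \<open>With P and Q the centred means and c = sqrt (2 / pi), W - 2 / pi equals P Q + c P + c Q,
  and each term has mean 0 because P and Q are independent and centred. This gives the mean; the
  second moment is estimated through the squares of the three terms.\<close>

lemma mean_abs_prod_moments:
  assumes mn: "m \<ge> n" "n \<ge> 1"
  defines "N \<equiv> gauss n \<Otimes>\<^sub>M gauss m" and "W \<equiv> mean_abs_prod m n"
  shows "integrable N W" and "(\<integral>p. W p \<partial>N) = 2 / pi"
    and "integrable N (\<lambda>p. (W p - 2 / pi)\<^sup>2)" and "(\<integral>p. (W p - 2 / pi)\<^sup>2 \<partial>N) \<le> 9 / real n"
proof -
  have m: "m \<ge> 1" using mn by simp
  note Pm = centered_mean_abs_moments[OF m] and Pn = centered_mean_abs_moments[OF mn(2)]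
  let ?c = "sqrt (2 / pi)"
  let ?P = "\<lambda>p::(nat \<Rightarrow> real) \<times> (nat \<Rightarrow> real). centered_mean_abs n (fst p)"
  let ?Q = "\<lambda>p::(nat \<Rightarrow> real) \<times> (nat \<Rightarrow> real). centered_mean_abs m (snd p)"
  have cc: "?c * ?c = 2 / pi" "?c\<^sup>2 = 2 / pi" by (auto simp: power2_eq_square)
  have W: "W p = ?P p * ?Q p + ?c * ?P p + ?c * ?Q p + 2 / pi" for p
    unfolding W_def mean_abs_prod_def centered_mean_abs_def by (simp add: algebra_simps cc)
  have one: "integrable (gauss k) (\<lambda>_. 1 :: real)" "(\<integral>x. (1::real) \<partial>gauss k) = 1" for k
  proof -
    show "integrable (gauss k) (\<lambda>_. 1 :: real)" "(\<integral>x. (1::real) \<partial>gauss k) = 1"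
      using prob_space.prob_space[OF prob_space_gauss, of k] finite_measure.integrable_const[OF prob_space.finite_measure[OF prob_space_gauss]] by auto
  qed
  note PQ = pair_sigma_finite.integrable_integral_fst_times_snd[OF pair_sigma_finite_prob_space[OF prob_space_gauss prob_space_gauss] Pn(1) Pm(1), folded N_def]
  note P1 = pair_sigma_finite.integrable_integral_fst_times_snd[OF pair_sigma_finite_prob_space[OF prob_space_gauss prob_space_gauss] Pn(1) one(1)[of m], folded N_def]
  note Q1 = pair_sigma_finite.integrable_integral_fst_times_snd[OF pair_sigma_finite_prob_space[OF prob_space_gauss prob_space_gauss] one(1)[of n] Pm(1), folded N_def]
  note PQ2 = pair_sigma_finite.integrable_integral_fst_times_snd[OF pair_sigma_finite_prob_space[OF prob_space_gauss prob_space_gauss] Pn(3) Pm(3), folded N_def]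
  note P2 = pair_sigma_finite.integrable_integral_fst_times_snd[OF pair_sigma_finite_prob_space[OF prob_space_gauss prob_space_gauss] Pn(3) one(1)[of m], folded N_def]
  note Q2 = pair_sigma_finite.integrable_integral_fst_times_snd[OF pair_sigma_finite_prob_space[OF prob_space_gauss prob_space_gauss] one(1)[of n] Pm(3), folded N_def]
  have N1: "integrable N (\<lambda>_. 2 / pi)" "(\<integral>p. 2 / pi \<partial>N) = 2 / pi"
    using measure_gauss_pair unfolding N_def by auto
  show Wi: "integrable N W" unfolding W[abs_def] using PQ(1) P1(1) Q1(1) N1 by simp
  show "(\<integral>p. W p \<partial>N) = 2 / pi"
    unfolding W[abs_def] using PQ P1 Q1 N1 Pm(2) Pn(2) one by simp
  let ?b = "\<lambda>p. 3 * ((?P p)\<^sup>2 * (?Q p)\<^sup>2 + (2 / pi) * (?P p)\<^sup>2 + (2 / pi) * (?Q p)\<^sup>2)"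
  have le: "(W p - 2 / pi)\<^sup>2 \<le> ?b p" for p
  proof -
    have "(a + b + c)\<^sup>2 \<le> 3 * (a\<^sup>2 + b\<^sup>2 + c\<^sup>2)" for a b c :: real
      using zero_le_power2[of "a - b"] zero_le_power2[of "a - c"] zero_le_power2[of "b - c"]
      by (simp add: power2_eq_square algebra_simps)
    from this[of "?P p * ?Q p" "?c * ?P p" "?c * ?Q p"] show ?thesis
      by (simp add: W power_mult_distrib cc)
  qed
  have bi: "integrable N ?b" using PQ2(1) P2(1) Q2(1) by simp
  show sqi: "integrable N (\<lambda>p. (W p - 2 / pi)\<^sup>2)"
    by (rule Bochner_Integration.integrable_bound[OF bi])
      (use le borel_measurable_integrable[OF Wi] in \<open>auto intro: order_trans\<close>)
  have "(\<integral>p. (W p - 2 / pi)\<^sup>2 \<partial>N) \<le> (\<integral>p. ?b p \<partial>N)"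
    by (rule integral_mono[OF sqi bi le])
  also have "\<dots> = 3 * ((\<integral>x. (centered_mean_abs n x)\<^sup>2 \<partial>gauss n) * (\<integral>y. (centered_mean_abs m y)\<^sup>2 \<partial>gauss m)
      + (2 / pi) * (\<integral>x. (centered_mean_abs n x)\<^sup>2 \<partial>gauss n) + (2 / pi) * (\<integral>y. (centered_mean_abs m y)\<^sup>2 \<partial>gauss m))"
    using PQ2 P2 Q2 one by simp
  \<comment> \<open>Each of the three terms is at most 1 / n, by \<open>m \<ge> n\<close> and 2 / pi
    \<le> 1; with the factor 3 from squaring a sum of three terms this is the constant 9.\<close>
  also have "\<dots> \<le> 3 * ((1 / real n) * 1 + 1 * (1 / real n) + 1 * (1 / real n))"
  proof (intro mult_left_mono add_mono mult_mono)
    have "1 / real m \<le> 1 / real n" using mn by (simp add: frac_le)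
    then show "(\<integral>y. (centered_mean_abs m y)\<^sup>2 \<partial>gauss m) \<le> 1 / real n" using Pm(4) by linarith
    have "1 / real m \<le> 1" using m by simp
    then show "(\<integral>y. (centered_mean_abs m y)\<^sup>2 \<partial>gauss m) \<le> 1" using Pm(4) by linarith
    show "2 / pi \<le> 1" using pi_ge_two by simp
    show "2 / pi \<le> 1" using pi_ge_two by simp
  qed (use Pn(4) in auto)
  finally show "(\<integral>p. (W p - 2 / pi)\<^sup>2 \<partial>N) \<le> 9 / real n" by simp
qed

section \<open>Distance to the limit and the logarithm of the Laplace transform\<close>

lemma norm_exp_minus_diff_le:
  fixes a b :: complex
  assumes "Re a \<ge> 0" "Re b \<ge> 0"
  shows "norm (exp (- a) - exp (- b)) \<le> norm (a - b)"
proof -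
  have "norm (exp (- a) - exp (- b)) \<le> 1 * norm (a - b)"
  proof (rule field_differentiable_bound[where S="{z. Re z \<ge> 0}" and f'="\<lambda>z. - exp (- z)"])
    show "convex {z. Re z \<ge> 0}" by (rule convex_halfspace_Re_ge)
    show "((\<lambda>z. exp (- z)) has_field_derivative - exp (- z)) (at z within {z. Re z \<ge> 0})" for z
      by (auto intro!: derivative_eq_intros)
  qed (use assms in auto)
  then show ?thesis by simp
qed

text \<open>\<open>exp (- a)\<close> is 1-Lipschitz on the closed right half-plane, so the distance
  is at most |csqrt z| times the mean absolute deviation of W, which the second moment
  controls.\<close>

lemma expectation_prod_resolvent_dist:
  assumes mn: "m \<ge> n" "n \<ge> 1" and z: "Re z > 0"
  shows "norm ((\<integral>p. exp (- csqrt z * of_real (mean_abs_prod m n p)) \<partial>(gauss n \<Otimes>\<^sub>M gauss m)) - exp (- (2 / pi) * csqrt z))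
    \<le> norm (csqrt z) * (3 / sqrt (real n))"
proof -
  let ?N = "gauss n \<Otimes>\<^sub>M gauss m"
  let ?W = "mean_abs_prod m n"
  note mom = mean_abs_prod_moments[OF mn]
  \<comment> \<open>The square root of the variance bound 9 / n. In |d| \<le> h / 2 + d^2 / (2 h)
    this value balances the two terms, giving the same bound as the Cauchy-Schwarz
    inequality.\<close>
  define h where "h = 3 / sqrt (real n)"
  have h: "h > 0" "h\<^sup>2 = 9 / real n" using mn by (auto simp: h_def power_divide)
  have cm: "(\<lambda>x. exp (- csqrt z * complex_of_real x)) \<in> borel_measurable borel"
    by (intro borel_measurable_continuous_onI continuous_intros)
  have int: "integrable ?N (\<lambda>p. exp (- csqrt z * of_real (?W p)))"
    using mean_abs_prod_nonneg[of m n] Re_csqrt[of z]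
    by (intro prob_space_integrable_bound[OF prob_space_gauss_pair, of _ 1] measurable_compose[OF mean_abs_prod_measurable cm]) auto
  have "norm ((\<integral>p. exp (- csqrt z * of_real (?W p)) \<partial>?N) - exp (- (2 / pi) * csqrt z))
    = norm (\<integral>p. exp (- csqrt z * of_real (?W p)) - exp (- (2 / pi) * csqrt z) \<partial>?N)"
    using int measure_gauss_pair by simp
  also have "\<dots> \<le> (\<integral>p. norm (csqrt z) * (h / 2 + (?W p - 2 / pi)\<^sup>2 / (2 * h)) \<partial>?N)"
  proof (rule order_trans[OF integral_norm_bound integral_mono])
    show "integrable ?N (\<lambda>p. norm (exp (- csqrt z * of_real (?W p)) - exp (- (2 / pi) * csqrt z)))" using int by simp
    show "integrable ?N (\<lambda>p. norm (csqrt z) * (h / 2 + (?W p - 2 / pi)\<^sup>2 / (2 * h)))" using mom(3) by simp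
    fix p
    have "norm (exp (- (csqrt z * of_real (?W p))) - exp (- (csqrt z * of_real (2 / pi)))) \<le> norm (csqrt z * of_real (?W p) - csqrt z * of_real (2 / pi))"
      using mean_abs_prod_nonneg[of m n p] Re_csqrt[of z] by (intro norm_exp_minus_diff_le) auto
    also have "\<dots> = norm (csqrt z) * \<bar>?W p - 2 / pi\<bar>"
      by (simp only: right_diff_distrib[symmetric] norm_mult of_real_diff[symmetric] norm_of_real)
    also have "\<dots> \<le> norm (csqrt z) * (h / 2 + (?W p - 2 / pi)\<^sup>2 / (2 * h))"
    proof (rule mult_left_mono)
      have "\<bar>d\<bar> \<le> h / 2 + d\<^sup>2 / (2 * h)" for d :: real
      proof -
        have "0 \<le> (\<bar>d\<bar> - h)\<^sup>2" by simp
        then have "2 * h * \<bar>d\<bar> \<le> h\<^sup>2 + d\<^sup>2" by (simp add: power2_diff algebra_simps)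
        then show ?thesis using h(1) by (simp add: field_simps power2_eq_square)
      qed
      then show "\<bar>?W p - 2 / pi\<bar> \<le> h / 2 + (?W p - 2 / pi)\<^sup>2 / (2 * h)" .
    qed simp
    finally show "norm (exp (- csqrt z * of_real (?W p)) - exp (- (2 / pi) * csqrt z)) \<le> norm (csqrt z) * (h / 2 + (?W p - 2 / pi)\<^sup>2 / (2 * h))"
      by (simp add: mult.commute)
  qed
  also have "\<dots> = norm (csqrt z) * (h / 2 + (\<integral>p. (?W p - 2 / pi)\<^sup>2 \<partial>?N) / (2 * h))"
    using mom(3) measure_gauss_pair by simp
  also have "\<dots> \<le> norm (csqrt z) * (h / 2 + h\<^sup>2 / (2 * h))"
    using mom(4) h by (intro mult_left_mono add_left_mono divide_right_mono) auto
  also have "\<dots> = norm (csqrt z) * h" using h(1) by (simp add: power2_eq_square)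
  finally show ?thesis by (simp only: h_def)
qed

text \<open>From 1 - s \<le> exp (- s) the remainder exp s - 1 - s is at most s (exp s - 1), and the
  last factor is again of order s. Only an upper bound on s enters, which suits an exponent that is
  unbounded below.\<close>

lemma exp_le_quadratic:
  fixes s T :: real
  assumes "s \<le> T" "T \<ge> 0"
  shows "exp s \<le> 1 + s + s\<^sup>2 * exp T"
proof -
  have "1 - s \<le> exp (- s)" using exp_ge_add_one_self[of "-s"] by simp
  then have "(1 - s) * exp s \<le> 1" by (simp add: exp_minus field_simps)
  then have a: "exp s - 1 - s \<le> s * (exp s - 1)" by (simp add: algebra_simps)
  have "s * (exp s - 1) \<le> s\<^sup>2 * exp T"
  proof (cases "s \<ge> 0")
    case True
    have "exp s - 1 \<le> s * exp s" using a by (simp add: algebra_simps)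
    also have "\<dots> \<le> s * exp T" using True assms by (intro mult_left_mono) auto
    finally show ?thesis using True mult_left_mono[of "exp s - 1" "s * exp T" s] by (simp add: power2_eq_square mult.assoc)
  next
    case False
    have "1 - exp s \<le> - s" using exp_ge_add_one_self[of s] by linarith
    then have "- s * (1 - exp s) \<le> - s * - s" using False by (intro mult_left_mono) auto
    also have "\<dots> = s\<^sup>2 * 1" by (simp add: power2_eq_square)
    also have "\<dots> \<le> s\<^sup>2 * exp T" using assms by (intro mult_left_mono) auto
    finally show ?thesis by (simp add: algebra_simps)
  qed
  then show ?thesis using a by simp
qed

text \<open>Lower bound by Jensen's inequality, upper bound by expanding around the mean.\<close>

lemma laplace_mean_abs_prod_bounds:
  assumes mn: "m \<ge> n" "n \<ge> 1" and t: "t \<ge> 0"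
  defines "L \<equiv> (\<integral>p. exp (- t * mean_abs_prod m n p) \<partial>(gauss n \<Otimes>\<^sub>M gauss m))"
  shows "L > 0" and "- (2 / pi) * t \<le> ln L" and "ln L \<le> - (2 / pi) * t + 9 * t\<^sup>2 * exp (2 / pi * t) / real n"
proof -
  let ?N = "gauss n \<Otimes>\<^sub>M gauss m"
  let ?W = "mean_abs_prod m n"
  let ?mu = "2 / pi"
  note mom = mean_abs_prod_moments[OF mn]
  have int: "integrable ?N (\<lambda>p. exp (- t * ?W p))"
    using mean_abs_prod_nonneg[of m n] t by (intro prob_space_integrable_bound[OF prob_space_gauss_pair, of _ 1]) auto
  have split: "exp (- t * ?W p) = exp (- ?mu * t) * exp (- t * (?W p - ?mu))" for p
    by (simp add: exp_add[symmetric] algebra_simps)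
  \<comment> \<open>The tangent at the mean lies below the exponential, and its linear part
    integrates to 0; the lower bound thus carries no error term.\<close>
  have "(\<integral>p. exp (- ?mu * t) * (1 + - t * (?W p - ?mu)) \<partial>?N) \<le> L"
    unfolding L_def
  proof (rule integral_mono[OF _ int])
    show "integrable ?N (\<lambda>p. exp (- ?mu * t) * (1 + - t * (?W p - ?mu)))" using mom(1) by simp
    show "exp (- ?mu * t) * (1 + - t * (?W p - ?mu)) \<le> exp (- t * ?W p)" for p
      unfolding split using exp_ge_add_one_self[of "- t * (?W p - ?mu)"] by (intro mult_left_mono) auto
  qed
  moreover have "(\<integral>p. exp (- ?mu * t) * (1 + - t * (?W p - ?mu)) \<partial>?N) = exp (- ?mu * t)"
    using mom(1,2) measure_gauss_pair by simp
  ultimately have lower: "exp (- ?mu * t) \<le> L" by simp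
  then show L: "L > 0" using exp_gt_zero[of "- ?mu * t"] by linarith
  show "- ?mu * t \<le> ln L" using lower L by (simp add: ln_ge_iff)
  let ?e = "t\<^sup>2 * exp (?mu * t)"
  have "L \<le> (\<integral>p. exp (- ?mu * t) * (1 + - t * (?W p - ?mu) + ?e * (?W p - ?mu)\<^sup>2) \<partial>?N)"
    unfolding L_def
  proof (rule integral_mono[OF int])
    show "integrable ?N (\<lambda>p. exp (- ?mu * t) * (1 + - t * (?W p - ?mu) + ?e * (?W p - ?mu)\<^sup>2))" using mom(1,3) by simp
    fix p
    have "- t * (?W p - ?mu) \<le> ?mu * t" using t mean_abs_prod_nonneg[of m n p] by (simp add: algebra_simps)
    \<comment> \<open>Since W is nonnegative, the deviation enters with exponent at most (2 / pi) t;
      this is the origin of the factor \<open>exp (2 / pi * t)\<close>.\<close>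
    then have "exp (- t * (?W p - ?mu)) \<le> 1 + - t * (?W p - ?mu) + (- t * (?W p - ?mu))\<^sup>2 * exp (?mu * t)"
      by (rule exp_le_quadratic) (use t in simp)
    also have "(- t * (?W p - ?mu))\<^sup>2 * exp (?mu * t) = ?e * (?W p - ?mu)\<^sup>2" by (simp add: power_mult_distrib)
    finally show "exp (- t * ?W p) \<le> exp (- ?mu * t) * (1 + - t * (?W p - ?mu) + ?e * (?W p - ?mu)\<^sup>2)"
      unfolding split by (intro mult_left_mono) auto
  qed
  also have "\<dots> = exp (- ?mu * t) * (1 + ?e * (\<integral>p. (?W p - ?mu)\<^sup>2 \<partial>?N))"
    using mom(1,2,3) measure_gauss_pair by simp
  also have "\<dots> \<le> exp (- ?mu * t) * (1 + ?e * (9 / real n))"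
    using mom(4) by (intro mult_left_mono add_left_mono) auto
  \<comment> \<open>1 + x \<le> exp x moves the error into the exponent, ready for the
    logarithm.\<close>
  also have "\<dots> \<le> exp (- ?mu * t) * exp (?e * (9 / real n))"
    using exp_ge_add_one_self[of "?e * (9 / real n)"] by (intro mult_left_mono) auto
  finally have "L \<le> exp (- ?mu * t + ?e * (9 / real n))" by (simp only: exp_add)
  then have "ln L \<le> - ?mu * t + ?e * (9 / real n)" using L by (metis ln_exp ln_le_cancel_iff exp_gt_zero)
  then show "ln L \<le> - ?mu * t + 9 * t\<^sup>2 * exp (?mu * t) / real n" by (simp add: mult_ac)
qed

section \<open>The limit theorem\<close>

lemma det_powr_resolvent_eq:
  assumes B: "B \<in> carrier_mat m n" and mn: "m \<ge> 1" "n \<ge> 1" and z: "z \<noteq> 0"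
  shows "det_powr (1\<^sub>m n + (z / (of_nat m ^ 2 * of_nat n ^ 2)) \<cdot>\<^sub>m map_mat complex_of_real (B\<^sup>T * B)) s
    = (\<Prod>i=1..n. (1 + z * complex_of_real (scaled_eigenvalue m n B i)) powr s)"
proof -
  have c: "z / (of_nat m ^ 2 * of_nat n ^ 2) \<noteq> 0" using z mn by simp
  show ?thesis unfolding det_powr_gram[OF B c] by (simp add: scaled_eigenvalue_def)
qed

lemma prod_scaled_eigenvalue_powr_eq_det:
  assumes B: "B \<in> carrier_mat m n"
  shows "(\<Prod>i=1..n. (1 + t * scaled_eigenvalue m n B i) powr s)
    = Determinant.det (1\<^sub>m n + (t / (real m ^ 2 * real n ^ 2)) \<cdot>\<^sub>m (B\<^sup>T * B)) powr s"
  unfolding det_gram[OF B] prod_powr_distrib by (simp add: scaled_eigenvalue_def)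

lemma expectation_det_resolvent_real:
  assumes A: "cauchy_random_matrix M m n A" and mn: "m \<ge> 1" "n \<ge> 1"
  shows "(\<integral>\<omega>. Determinant.det (1\<^sub>m n + (t\<^sup>2 / (real m ^ 2 * real n ^ 2)) \<cdot>\<^sub>m ((A \<omega>)\<^sup>T * A \<omega>)) powr (-1/2) \<partial>M)
    = (\<integral>p. exp (- \<bar>t\<bar> * mean_abs_prod m n p) \<partial>(gauss n \<Otimes>\<^sub>M gauss m))"
proof -
  have "(\<integral>\<omega>. Determinant.det (1\<^sub>m n + (t\<^sup>2 / (real m ^ 2 * real n ^ 2)) \<cdot>\<^sub>m ((A \<omega>)\<^sup>T * A \<omega>)) powr (-1/2) \<partial>M)
    = (\<integral>\<omega>. (\<integral>x. exp (- \<bar>t\<bar>\<^sup>2 * (1 / (real m ^ 2 * real n ^ 2) * (\<Sum>j<m. (\<Sum>k<n. A \<omega> $$ (j, k) * x k)\<^sup>2) / 2)) \<partial>gauss n) \<partial>M)"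
  proof (intro Bochner_Integration.integral_cong refl)
    fix \<omega> assume "\<omega> \<in> space M"
    have "0 \<le> t\<^sup>2 / (real m ^ 2 * real n ^ 2)" by simp
    from gauss_det(2)[OF cauchy_matrixD(2)[OF A \<open>\<omega> \<in> space M\<close>] this]
    show "Determinant.det (1\<^sub>m n + (t\<^sup>2 / (real m ^ 2 * real n ^ 2)) \<cdot>\<^sub>m ((A \<omega>)\<^sup>T * A \<omega>)) powr (-1/2)
      = (\<integral>x. exp (- \<bar>t\<bar>\<^sup>2 * (1 / (real m ^ 2 * real n ^ 2) * (\<Sum>j<m. (\<Sum>k<n. A \<omega> $$ (j, k) * x k)\<^sup>2) / 2)) \<partial>gauss n)"
      by simp
  qed
  also have "\<dots> = (\<integral>p. exp (- \<bar>t\<bar> * mean_abs_prod m n p) \<partial>(gauss n \<Otimes>\<^sub>M gauss m))"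
    by (rule expectation_prod_resolvent_real[OF A _ mn]) simp
  finally show ?thesis .
qed

theorem theorem1p1:
  fixes M :: "nat \<Rightarrow> 'w measure" and m :: "nat \<Rightarrow> nat" and A :: "nat \<Rightarrow> 'w \<Rightarrow> real mat"
  assumes m_ge: "\<And>n. n \<ge> 1 \<Longrightarrow> m n \<ge> n"
    and A: "\<And>n. n \<ge> 1 \<Longrightarrow> cauchy_random_matrix (M n) (m n) n (A n)"
  defines "D \<equiv> {z::complex. Re z > 0}"
    and "Edet \<equiv> \<lambda>n z. \<integral>\<omega>. det_powr (1\<^sub>m n + (z / (of_nat (m n) ^ 2 * of_nat n ^ 2)) \<cdot>\<^sub>m
                          map_mat complex_of_real ((A n \<omega>)\<^sup>T * A n \<omega>)) (-1/2) \<partial>M n"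
    and "Eprod \<equiv> \<lambda>n z. \<integral>\<omega>. (\<Prod>i=1..n.
                          (1 + z * complex_of_real (scaled_eigenvalue (m n) n (A n \<omega>) i)) powr (-1/2)) \<partial>M n"
  shows
    "(\<forall>z\<in>D. (\<lambda>n. Edet n z) \<longlonglongrightarrow> exp (- (2 / pi) * csqrt z)) \<and>
     (\<forall>z\<in>D. (\<lambda>n. Eprod n z) \<longlonglongrightarrow> exp (- (2 / pi) * csqrt z)) \<and>
     (\<forall>(P :: 'p measure) X. poisson_point_process P X (\<lambda>x. 1 / (pi * x powr (3/2))) \<longrightarrow>
        (\<forall>z\<in>D. exp (- (2 / pi) * csqrt z) =
           (\<integral>\<omega>. infprod_over (\<lambda>x. (1 + z * complex_of_real x) powr (-1/2)) (X \<omega>) \<partial>P))) \<and>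
     (\<forall>K. compact K \<and> K \<subseteq> D \<longrightarrow>
        uniform_limit K Edet (\<lambda>z. exp (- (2 / pi) * csqrt z)) sequentially \<and>
        uniform_limit K Eprod (\<lambda>z. exp (- (2 / pi) * csqrt z)) sequentially) \<and>
     (\<forall>\<epsilon>>0. \<exists>\<delta> :: nat \<Rightarrow> real \<Rightarrow> real.
        (\<forall>n\<ge>1. \<forall>t::real.
           (\<integral>\<omega>. Determinant.det (1\<^sub>m n + (t\<^sup>2 / (real (m n) ^ 2 * real n ^ 2)) \<cdot>\<^sub>m
                     ((A n \<omega>)\<^sup>T * A n \<omega>)) powr (-1/2) \<partial>M n)
             = exp (- (2 / pi) * \<bar>t\<bar> * (1 + \<delta> n t)) \<and>
           (\<integral>\<omega>. (\<Prod>i=1..n. (1 + t\<^sup>2 * scaled_eigenvalue (m n) n (A n \<omega>) i) powr (-1/2)) \<partial>M n)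
             = exp (- (2 / pi) * \<bar>t\<bar> * (1 + \<delta> n t))) \<and>
        (\<forall>K. compact K \<and> K \<subseteq> {0..} \<longrightarrow>
           uniform_limit {t. \<bar>t\<bar> \<in> K} (\<lambda>n t. \<delta> n t / real n powr (-1/2 + \<epsilon>)) (\<lambda>_. 0) sequentially))"
proof (intro conjI ballI allI impI)
  define Lim where "Lim z = exp (- (2 / pi) * csqrt z)" for z :: complex
  have mn: "m n \<ge> 1" if "n \<ge> 1" for n using m_ge[OF that] that by simp
  have EE: "Edet n z = Eprod n z" if n: "n \<ge> 1" and z: "z \<in> D" for n z
  proof -
    have "z \<noteq> 0" using z by (auto simp: D_def)
    then show ?thesis
      unfolding Edet_def Eprod_def
      by (intro Bochner_Integration.integral_cong refl det_powr_resolvent_eq cauchy_matrixD(2)[OF A] mn n)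
  qed
  have bound: "norm (Eprod n z - Lim z) \<le> norm (csqrt z) * (3 / sqrt (real n))" if n: "n \<ge> 1" and z: "z \<in> D" for n z
  proof -
    have z: "Re z > 0" using z by (simp add: D_def)
    show ?thesis
      unfolding Eprod_def Lim_def expectation_prod_resolvent[OF A[OF n] mn[OF n] n z]
      by (rule expectation_prod_resolvent_dist[OF m_ge[OF n] n z])
  qed
  \<comment> \<open>The error bound depends on \<open>z\<close> only through |csqrt z| = sqrt |z|,
    so it is uniform on bounded subsets of \<open>D\<close>; singletons yield the pointwise limits,
    compact sets the uniform ones.\<close>
  have unif: "uniform_limit K Eprod Lim sequentially" "uniform_limit K Edet Lim sequentially"
    if K: "bounded K" "K \<subseteq> D" for K
  proof -
    \<comment> \<open>For empty \<open>K\<close> the bound \<open>C\<close> may be negative, hence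
      |C| under the root.\<close>
    obtain C where C: "\<And>z. z \<in> K \<Longrightarrow> norm z \<le> C" using K(1) by (auto simp: bounded_iff)
    have small: "\<forall>\<^sub>F n in sequentially. sqrt \<bar>C\<bar> * (3 / sqrt (real n)) < e" if e: "e > 0" for e
    proof -
      have "(\<lambda>n. sqrt \<bar>C\<bar> * (3 / sqrt (real n))) \<longlonglongrightarrow> sqrt \<bar>C\<bar> * 0"
        by (intro tendsto_mult tendsto_const) real_asymp
      then show ?thesis using e by (intro order_tendstoD(2)) auto
    qed
    have dist: "dist (Eprod n z) (Lim z) < e \<and> dist (Edet n z) (Lim z) < e"
      if "sqrt \<bar>C\<bar> * (3 / sqrt (real n)) < e" "n \<ge> 1" "z \<in> K" for n z e
    proof -
      have "z \<in> D" using that K by auto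
      have "norm (csqrt z) \<le> sqrt \<bar>C\<bar>" using C[OF that(3)] by simp
      then have "norm (csqrt z) * (3 / sqrt (real n)) \<le> sqrt \<bar>C\<bar> * (3 / sqrt (real n))"
        by (intro mult_right_mono) auto
      then show ?thesis
        using bound[OF that(2) \<open>z \<in> D\<close>] that(1) EE[OF that(2) \<open>z \<in> D\<close>] by (simp add: dist_norm)
    qed
    show "uniform_limit K Eprod Lim sequentially" "uniform_limit K Edet Lim sequentially"
      unfolding uniform_limit_iff
    proof (safe)
      fix e :: real assume "e > 0"
      show "\<forall>\<^sub>F n in sequentially. \<forall>z\<in>K. dist (Eprod n z) (Lim z) < e"
        using small[OF \<open>e > 0\<close>] eventually_ge_at_top[of 1] by eventually_elim (use dist in blast)
      show "\<forall>\<^sub>F n in sequentially. \<forall>z\<in>K. dist (Edet n z) (Lim z) < e"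
        using small[OF \<open>e > 0\<close>] eventually_ge_at_top[of 1] by eventually_elim (use dist in blast)
    qed
  qed
  show "(\<lambda>n. Edet n z) \<longlonglongrightarrow> exp (- (2 / pi) * csqrt z)" if "z \<in> D" for z
    using tendsto_uniform_limitI[OF unif(2)[of "{z}"]] that by (simp add: Lim_def)
  show "(\<lambda>n. Eprod n z) \<longlonglongrightarrow> exp (- (2 / pi) * csqrt z)" if "z \<in> D" for z
    using tendsto_uniform_limitI[OF unif(1)[of "{z}"]] that by (simp add: Lim_def)
  show "exp (- (2 / pi) * csqrt z) = (\<integral>\<omega>. infprod_over (\<lambda>x. (1 + z * complex_of_real x) powr (-1/2)) (X \<omega>) \<partial>P)"
    if "poisson_point_process P X (\<lambda>x. 1 / (pi * x powr (3/2)))" "z \<in> D" for P :: "'p measure" and X z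
    using poisson_infprod[OF that(1), of z] that(2) by (simp add: D_def)
  show "uniform_limit K Edet (\<lambda>z. exp (- (2 / pi) * csqrt z)) sequentially" if "compact K \<and> K \<subseteq> D" for K
    using unif(2)[of K] that compact_imp_bounded unfolding Lim_def by blast
  show "uniform_limit K Eprod (\<lambda>z. exp (- (2 / pi) * csqrt z)) sequentially" if "compact K \<and> K \<subseteq> D" for K
    using unif(1)[of K] that compact_imp_bounded unfolding Lim_def by blast
next
  fix \<epsilon> :: real assume \<epsilon>: "\<epsilon> > 0"
  have mn: "m n \<ge> 1" if "n \<ge> 1" for n using m_ge[OF that] that by simp
  define L where "L n t = (\<integral>p. exp (- t * mean_abs_prod (m n) n p) \<partial>(gauss n \<Otimes>\<^sub>M gauss (m n)))" for n and t :: real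
  \<comment> \<open>The required identity solved for the error. At t = 0 both sides equal 1 whatever
    the error is, and the value 0 keeps the bound below valid.\<close>
  define \<delta> where "\<delta> n t = (if t = 0 then 0 else - (pi / (2 * \<bar>t\<bar>)) * ln (L n \<bar>t\<bar>) - 1)" for n and t :: real
  have L: "L n \<bar>t\<bar> > 0" "- (2 / pi) * \<bar>t\<bar> \<le> ln (L n \<bar>t\<bar>)"
      "ln (L n \<bar>t\<bar>) \<le> - (2 / pi) * \<bar>t\<bar> + 9 * \<bar>t\<bar>\<^sup>2 * exp (2 / pi * \<bar>t\<bar>) / real n" if "n \<ge> 1" for n t
    using laplace_mean_abs_prod_bounds[OF m_ge[OF that] that, of "\<bar>t\<bar>"] unfolding L_def by auto
  have Lexp: "L n \<bar>t\<bar> = exp (- (2 / pi) * \<bar>t\<bar> * (1 + \<delta> n t))" if "n \<ge> 1" for n t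
  proof (cases "t = 0")
    case True
    show ?thesis using True measure_gauss_pair by (simp add: L_def)
  next
    case False
    then have "- (2 / pi) * \<bar>t\<bar> * (1 + \<delta> n t) = ln (L n \<bar>t\<bar>)" by (simp add: \<delta>_def)
    then show ?thesis using L(1)[OF that] by simp
  qed
  \<comment> \<open>The deviation \<open>d\<close> of the logarithm is of order t^2 / n; dividing by
    |t| still leaves a factor |t|, so the bound does not blow up at 0.\<close>
  have \<delta>_bound: "\<bar>\<delta> n t\<bar> \<le> (9 * pi / 2 * \<bar>t\<bar> * exp (2 / pi * \<bar>t\<bar>)) / real n" if n: "n \<ge> 1" for n t
  proof (cases "t = 0")
    case False
    define d where "d = ln (L n \<bar>t\<bar>) + (2 / pi) * \<bar>t\<bar>"
    have d: "0 \<le> d" "d \<le> 9 * \<bar>t\<bar>\<^sup>2 * exp (2 / pi * \<bar>t\<bar>) / real n" using L(2,3)[OF n, of t] by (auto simp: d_def)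
    have "\<delta> n t = - (pi / (2 * \<bar>t\<bar>)) * d" using False by (simp add: \<delta>_def d_def field_simps)
    then have "\<bar>\<delta> n t\<bar> = pi / (2 * \<bar>t\<bar>) * d" using d(1) by (simp add: abs_mult)
    also have "\<dots> \<le> pi / (2 * \<bar>t\<bar>) * (9 * \<bar>t\<bar>\<^sup>2 * exp (2 / pi * \<bar>t\<bar>) / real n)"
      by (intro mult_left_mono d) auto
    also have "\<dots> = (9 * pi / 2 * \<bar>t\<bar> * exp (2 / pi * \<bar>t\<bar>)) / real n"
      using False by (simp add: power2_eq_square del: abs_mult_self_eq)
    finally show ?thesis .
  qed (simp add: \<delta>_def)
  show "\<exists>\<delta> :: nat \<Rightarrow> real \<Rightarrow> real.
        (\<forall>n\<ge>1. \<forall>t::real.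
           (\<integral>\<omega>. Determinant.det (1\<^sub>m n + (t\<^sup>2 / (real (m n) ^ 2 * real n ^ 2)) \<cdot>\<^sub>m
                     ((A n \<omega>)\<^sup>T * A n \<omega>)) powr (-1/2) \<partial>M n)
             = exp (- (2 / pi) * \<bar>t\<bar> * (1 + \<delta> n t)) \<and>
           (\<integral>\<omega>. (\<Prod>i=1..n. (1 + t\<^sup>2 * scaled_eigenvalue (m n) n (A n \<omega>) i) powr (-1/2)) \<partial>M n)
             = exp (- (2 / pi) * \<bar>t\<bar> * (1 + \<delta> n t))) \<and>
        (\<forall>K. compact K \<and> K \<subseteq> {0..} \<longrightarrow>
           uniform_limit {t. \<bar>t\<bar> \<in> K} (\<lambda>n t. \<delta> n t / real n powr (-1/2 + \<epsilon>)) (\<lambda>_. 0) sequentially)"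
  proof (intro exI[of _ \<delta>] conjI allI impI)
    fix n :: nat and t :: real assume n: "n \<ge> 1"
    have det: "(\<integral>\<omega>. Determinant.det (1\<^sub>m n + (t\<^sup>2 / (real (m n) ^ 2 * real n ^ 2)) \<cdot>\<^sub>m
                     ((A n \<omega>)\<^sup>T * A n \<omega>)) powr (-1/2) \<partial>M n) = L n \<bar>t\<bar>"
      unfolding L_def by (rule expectation_det_resolvent_real[OF A[OF n] mn[OF n] n])
    then show "(\<integral>\<omega>. Determinant.det (1\<^sub>m n + (t\<^sup>2 / (real (m n) ^ 2 * real n ^ 2)) \<cdot>\<^sub>m
                     ((A n \<omega>)\<^sup>T * A n \<omega>)) powr (-1/2) \<partial>M n) = exp (- (2 / pi) * \<bar>t\<bar> * (1 + \<delta> n t))"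
      using Lexp[OF n] by simp
    have "(\<integral>\<omega>. (\<Prod>i=1..n. (1 + t\<^sup>2 * scaled_eigenvalue (m n) n (A n \<omega>) i) powr (-1/2)) \<partial>M n)
      = (\<integral>\<omega>. Determinant.det (1\<^sub>m n + (t\<^sup>2 / (real (m n) ^ 2 * real n ^ 2)) \<cdot>\<^sub>m
                     ((A n \<omega>)\<^sup>T * A n \<omega>)) powr (-1/2) \<partial>M n)"
      by (intro Bochner_Integration.integral_cong refl prod_scaled_eigenvalue_powr_eq_det cauchy_matrixD(2)[OF A[OF n]])
    also note det
    finally show "(\<integral>\<omega>. (\<Prod>i=1..n. (1 + t\<^sup>2 * scaled_eigenvalue (m n) n (A n \<omega>) i) powr (-1/2)) \<partial>M n) = exp (- (2 / pi) * \<bar>t\<bar> * (1 + \<delta> n t))"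
      using Lexp[OF n] by simp
  next
    fix K :: "real set" assume K: "compact K \<and> K \<subseteq> {0..}"
    then obtain T where T: "\<And>t. t \<in> K \<Longrightarrow> \<bar>t\<bar> \<le> T" using compact_imp_bounded[of K] by (auto simp: bounded_iff)
    \<comment> \<open>The bound for the error is increasing in |t|, so its value at the largest |t|
      serves for all of \<open>K\<close>; the absolute value covers an empty
      \<open>K\<close>.\<close>
    define C where "C = 9 * pi / 2 * \<bar>T\<bar> * exp (2 / pi * \<bar>T\<bar>)"
    have small: "\<forall>\<^sub>F n in sequentially. C * real n powr (-1/2 - \<epsilon>) < e" if e: "e > 0" for e
    proof -
      have "(\<lambda>n. real n powr (-1/2 - \<epsilon>)) \<longlonglongrightarrow> 0"
        using \<epsilon> by (intro tendsto_neg_powr filterlim_real_sequentially) auto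
      then have "(\<lambda>n. C * real n powr (-1/2 - \<epsilon>)) \<longlonglongrightarrow> C * 0" by (intro tendsto_intros)
      then show ?thesis using e by (intro order_tendstoD(2)) auto
    qed
    \<comment> \<open>Dividing the order 1 / n by \<open>n powr (-1/2 + \<epsilon>)\<close> leaves
      the exponent -1/2 - \<epsilon>, which is negative.\<close>
    have le: "\<bar>\<delta> n t / real n powr (-1/2 + \<epsilon>)\<bar> \<le> C * real n powr (-1/2 - \<epsilon>)" if n: "n \<ge> 1" and t: "\<bar>t\<bar> \<in> K" for n t
    proof -
      have tT: "\<bar>t\<bar> \<le> \<bar>T\<bar>" using T[OF t] by simp
      have "\<bar>\<delta> n t\<bar> \<le> (9 * pi / 2 * \<bar>t\<bar> * exp (2 / pi * \<bar>t\<bar>)) / real n" by (rule \<delta>_bound[OF n])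
      also have "\<dots> \<le> C / real n"
      proof -
        have "2 / pi * \<bar>t\<bar> \<le> 2 / pi * \<bar>T\<bar>" using tT by (intro mult_left_mono) auto
        then show ?thesis unfolding C_def using tT by (intro divide_right_mono mult_mono iffD2[OF exp_le_cancel_iff]) auto
      qed
      finally have "\<bar>\<delta> n t\<bar> / real n powr (-1/2 + \<epsilon>) \<le> C / real n / real n powr (-1/2 + \<epsilon>)"
        by (intro divide_right_mono) auto
      also have "\<dots> = C / real n powr (1 + (-1/2 + \<epsilon>))" unfolding powr_add using n by simp
      also have "\<dots> = C * real n powr (- (1 + (-1/2 + \<epsilon>)))" by (simp only: powr_minus divide_inverse)
      also have "- (1 + (-1/2 + \<epsilon>)) = -1/2 - \<epsilon>" by simp
      finally show ?thesis by (simp add: abs_divide)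
    qed
    show "uniform_limit {t. \<bar>t\<bar> \<in> K} (\<lambda>n t. \<delta> n t / real n powr (-1/2 + \<epsilon>)) (\<lambda>_. 0) sequentially"
      unfolding uniform_limit_iff
    proof (intro allI impI)
      fix e :: real assume "e > 0"
      show "\<forall>\<^sub>F n in sequentially. \<forall>t\<in>{t. \<bar>t\<bar> \<in> K}. dist (\<delta> n t / real n powr (-1/2 + \<epsilon>)) 0 < e"
        using small[OF \<open>e > 0\<close>] eventually_ge_at_top[of 1]
      proof eventually_elim
        case (elim n)
        show ?case
        proof
          fix t assume "t \<in> {t. \<bar>t\<bar> \<in> K}"
          then have "\<bar>t\<bar> \<in> K" by simp
          from le[OF elim(2) this] elim(1) show "dist (\<delta> n t / real n powr (-1/2 + \<epsilon>)) 0 < e"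
            by (simp only: dist_norm diff_zero real_norm_def)
        qed
      qed
    qed
  qed
qed

end
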